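(* Let $N\ge 2$, $1<q<p<N$, $r,s>1$ and $\lambda\in\mathbb{R}$. Consider the equation $$-\Delta_p u-\Delta_q u=|u|^{r-2}u+\lambda|u|^{s-2}u\quad\text{in }\mathbb{R}^N. \qquad (\mathcal P_\lambda)$$ There exists no nontrivial weak solution of $(\mathcal P_\lambda)$ in $E\cap W^{2,p}_{\mathrm{loc}}(\mathbb{R}^N)$ under each of the following conditions: (a) $\lambda>0$ and either $p^*\le\min\{r,s\}$ or $\max\{r,s\}\le q^*$; (b) $\lambda<0$ and either $s\le p^*\le r$ or $r\le q^*\le s$.
   Context: For $1<m<N$, $m^*=\frac{Nm}{N-m}$, $\Delta_m u=\operatorname{div}(|\nabla u|^{m-2}\nabla u)$, and $\mathcal D^{1,m}(\mathbb{R}^N)=\{u\in L^{m^*}(\mathbb{R}^N): |\nabla u|\in L^m(\mathbb{R}^N)\}$. Set $E=\mathcal D^{1,p}(\mathbb{R}^N)\cap\mathcal D^{1,q}(\mathbb{R}^N)$. A weak solution of $(\mathcal P_\lambda)$ is a function $u\in E$ such that for every $\varphi\in E$ (the integrals being well defined, i.e. the integrands being integrable) $$\int_{\mathbb{R}^N}\left(|\nabla u|^{p-2}\nabla u+|\nabla u|^{q-2}\nabla u\right)\cdot\nabla\varphi=\int_{\mathbb{R}^N}\left(|u|^{r-2}u+\lambda|u|^{s-2}u\right)\varphi .$$ Nontrivial means not identically zero (a.e.). *)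

theory Defs
  imports "HOL-Analysis.Analysis"
begin

primrec C_k :: "nat \<Rightarrow> ('a::euclidean_space \<Rightarrow> real) \<Rightarrow> bool" where
  "C_k 0 f \<longleftrightarrow> continuous_on UNIV f"
| "C_k (Suc k) f \<longleftrightarrow> f differentiable_on UNIV \<and>
     (\<forall>b\<in>Basis. C_k k (\<lambda>x. frechet_derivative f (at x) b))"

definition test_functions :: "('a::euclidean_space \<Rightarrow> real) set" where
  "test_functions = {\<phi>. (\<forall>k. C_k k \<phi>) \<and> compact (closure {x. \<phi> x \<noteq> 0})}"

definition L1_loc :: "('a::euclidean_space \<Rightarrow> 'b::euclidean_space) set" where
  "L1_loc = {f. \<forall>K. compact K \<longrightarrow> f absolutely_integrable_on K}"

definition L_space :: "real \<Rightarrow> ('a::euclidean_space \<Rightarrow> 'b::euclidean_space) set" where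
  "L_space m = {f \<in> borel_measurable lebesgue. integrable lebesgue (\<lambda>x. norm (f x) powr m)}"

definition L_loc :: "real \<Rightarrow> ('a::euclidean_space \<Rightarrow> 'b::euclidean_space) set" where
  "L_loc m = {f \<in> borel_measurable lebesgue.
     \<forall>K. compact K \<longrightarrow> (\<lambda>x. norm (f x) powr m) absolutely_integrable_on K}"

definition has_weak_gradient ::
    "('a::euclidean_space \<Rightarrow> real) \<Rightarrow> ('a \<Rightarrow> 'a) \<Rightarrow> bool" (infix "has'_weak'_gradient" 50) where
  "u has_weak_gradient g \<longleftrightarrow> u \<in> L1_loc \<and> g \<in> L1_loc \<and>
     (\<forall>\<phi>\<in>test_functions. \<forall>b\<in>Basis.
        (\<integral>x. u x * frechet_derivative \<phi> (at x) b \<partial>lebesgue) = - (\<integral>x. (g x \<bullet> b) * \<phi> x \<partial>lebesgue))"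

definition weakly_differentiable :: "('a::euclidean_space \<Rightarrow> real) \<Rightarrow> bool" where
  "weakly_differentiable u \<longleftrightarrow> (\<exists>g. u has_weak_gradient g)"

(* A weak gradient is unique only up to null sets; this selects one representative. It is
   meaningful only for weakly differentiable u, hence the explicit guards below. *)
definition weak_gradient :: "('a::euclidean_space \<Rightarrow> real) \<Rightarrow> 'a \<Rightarrow> 'a" where
  "weak_gradient u = (SOME g. u has_weak_gradient g)"

definition critical_exponent :: "nat \<Rightarrow> real \<Rightarrow> real" where
  "critical_exponent N m = real N * m / (real N - m)"

definition D1 :: "real \<Rightarrow> ('a::euclidean_space \<Rightarrow> real) set" where
  "D1 m = {u \<in> L_space (critical_exponent DIM('a) m).
     weakly_differentiable u \<and> weak_gradient u \<in> L_space m}"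

definition E_space :: "real \<Rightarrow> real \<Rightarrow> ('a::euclidean_space \<Rightarrow> real) set" where
  "E_space p q = D1 p \<inter> D1 q"

(* W_loc k m is the local Sobolev space of order k and integrability exponent m; the weak
   derivatives of order up to k are the iterated components of weak gradients. *)
primrec W_loc :: "nat \<Rightarrow> real \<Rightarrow> ('a::euclidean_space \<Rightarrow> real) set" where
  "W_loc 0 m = L_loc m"
| "W_loc (Suc k) m = {u \<in> L_loc m. weakly_differentiable u \<and>
     (\<forall>b\<in>Basis. (\<lambda>x. weak_gradient u x \<bullet> b) \<in> W_loc k m)}"

(* Since 0 powr a = 0 for every a, the terms t |-> |t|^(m-2) t take the value 0 at t = 0
   also when m < 2. *)
definition weak_solution ::
    "real \<Rightarrow> real \<Rightarrow> real \<Rightarrow> real \<Rightarrow> real \<Rightarrow> ('a::euclidean_space \<Rightarrow> real) \<Rightarrow> bool" where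
  "weak_solution p q r s \<mu> u \<longleftrightarrow> u \<in> E_space p q \<and>
     (\<forall>\<phi>\<in>E_space p q.
        let lhs = (\<lambda>x. (norm (weak_gradient u x) powr (p - 2) *\<^sub>R weak_gradient u x
                      + norm (weak_gradient u x) powr (q - 2) *\<^sub>R weak_gradient u x)
                      \<bullet> weak_gradient \<phi> x);
            rhs = (\<lambda>x. (\<bar>u x\<bar> powr (r - 2) * u x + \<mu> * (\<bar>u x\<bar> powr (s - 2) * u x)) * \<phi> x)
        in integrable lebesgue lhs \<and> integrable lebesgue rhs \<and>
           integral\<^sup>L lebesgue lhs = integral\<^sup>L lebesgue rhs)"

end

theory Submission
  imports Defs
begin

text \<open>
  Testing the equation with \<open>\<psi>(x) (u(x + t b) - u(x)) / t\<close> for a test function \<open>\<psi> \<ge> 0\<close> and a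
  coordinate direction \<open>b\<close> yields a Pohozaev identity without Sobolev embeddings and without a chain
  rule for \<open>F(u)\<close>: these functions belong to \<open>E\<close> because \<open>u\<close> and its translates do. Let
  \<open>A = |\<nabla>u|\<^sup>p\<^sup>-\<^sup>2\<nabla>u + |\<nabla>u|\<^sup>q\<^sup>-\<^sup>2\<nabla>u\<close> and \<open>G = |\<nabla>u|\<^sup>p/p + |\<nabla>u|\<^sup>q/q\<close>. By convexity,
  \<open>A \<bullet> (\<nabla>u(x + t b) - \<nabla>u(x))\<close> differs from the increment of \<open>G\<close> by at most
  \<open>(A(x + t b) - A(x)) \<bullet> (\<nabla>u(x + t b) - \<nabla>u(x))\<close>, which is \<open>o(t)\<close> in \<open>L\<^sup>1\<close> on compact sets, as \<open>A\<close> is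
  translation continuous in \<open>L\<^sup>p\<^sup>'\<close> and \<open>\<nabla>u\<close> has difference quotients bounded in \<open>L\<^sup>p\<close> (this is where
  \<open>u \<in> W\<^sup>2\<^sup>,\<^sup>p\<close> enters). So the limit of \<open>\<integral> f(u) \<psi> (u(x + t b) - u(x)) / t\<close> exists. The remainder
  \<open>F(u(x + t b)) - F(u(x)) - f(u(x)) (u(x + t b) - u(x))\<close> has a fixed sign up to \<open>o(t)\<close>, because \<open>f\<close> is
  monotone outside a bounded interval; dividing by \<open>t > 0\<close> and by \<open>t < 0\<close> shows that it does not
  contribute to the limit. Taking \<open>\<psi> = \<eta>(x/R) x\<^sub>b\<close>, summing over \<open>b\<close> and letting \<open>R \<rightarrow> \<infinity>\<close> gives
  \<open>\<integral>|\<nabla>u|\<^sup>p / p\<^sup>* + \<integral>|\<nabla>u|\<^sup>q / q\<^sup>* = \<integral>|u|\<^sup>r / r + \<mu> \<integral>|u|\<^sup>s / s\<close>. Compared with the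
  equation tested by \<open>u\<close>, this forces \<open>\<nabla>u = 0\<close>, so \<open>u\<close> is translation invariant and integrable to
  the power \<open>p\<^sup>*\<close>, hence zero.
\<close>

section \<open>Test functions\<close>

text \<open>The classical multiplier, the product of \<open>x\<close> with the gradient of
  \<open>u\<close>, is not admissible: nothing places it in \<open>E_space p q\<close>, and as
  \<open>r\<close> or \<open>s\<close> may be supercritical, \<open>f(u)\<close> times a derivative
  of \<open>u\<close> is not known to be integrable even on balls. Hence only increments of
  \<open>G\<close> and \<open>F(u)\<close> occur, which are in L^1 and can be moved onto the test
  function without being differentiated. That \<open>F(u)\<close> is integrable needs an argument of
  its own: testing by \<open>u\<close> controls only the sum of the two powers, where cancellation
  is possible if \<mu> < 0; the critical exponent lying between \<open>r\<close> and
  \<open>s\<close> separates them. The sign argument requires \<psi> \<ge> 0 while a coordinate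
  changes sign; a multiple of the cutoff is added, and removed again by linearity of the resulting
  identity. Finally, \<open>weak_gradient\<close> is an arbitrary choice, measurable only for the
  completed measure, so the analysis runs on Borel representatives over \<open>lborel\<close>, where
  translations and Fubini are directly available.\<close>

lemma C_k_SucI:
  assumes "\<And>x. (f has_derivative f' x) (at x)" "\<And>b. b \<in> Basis \<Longrightarrow> C_k k (\<lambda>x. f' x b)"
  shows "C_k (Suc k) f"
proof -
  have "frechet_derivative f (at x) = f' x" for x
    using frechet_derivative_at[OF assms(1)] by simp
  moreover have "f differentiable_on UNIV"
    using assms(1) unfolding differentiable_on_def differentiable_def by auto
  ultimately show ?thesis using assms(2) by simp
qed

lemma C_k_SucD:
  assumes "C_k (Suc k) f"
  shows "(f has_derivative frechet_derivative f (at x)) (at x)"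
    and "b \<in> Basis \<Longrightarrow> C_k k (\<lambda>x. frechet_derivative f (at x) b)"
  using assms by (auto simp: differentiable_on_def frechet_derivative_works)

lemma C_k_Suc_imp: "C_k (Suc k) f \<Longrightarrow> C_k k f"
proof (induction k arbitrary: f)
  case 0
  then show ?case by (simp add: differentiable_imp_continuous_on)
next
  case (Suc k)
  have "C_k (Suc k) (\<lambda>x. frechet_derivative f (at x) b)" if "b \<in> Basis" for b
    using C_k_SucD(2)[OF Suc.prems that] .
  then have "C_k k (\<lambda>x. frechet_derivative f (at x) b)" if "b \<in> Basis" for b
    using Suc.IH that by blast
  with C_k_SucD(1)[OF Suc.prems] show ?case by (rule C_k_SucI)
qed

lemma C_k_const: "C_k k (\<lambda>x. c)"
proof (induction k arbitrary: c)
  case (Suc k)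
  show ?case by (rule C_k_SucI[where f' = "\<lambda>x h. 0"]) (use Suc in auto)
qed simp

lemma C_k_add: "C_k k f \<Longrightarrow> C_k k g \<Longrightarrow> C_k k (\<lambda>x. f x + g x)"
proof (induction k arbitrary: f g)
  case 0
  then show ?case by (auto intro: continuous_intros)
next
  case (Suc k)
  show ?case
    by (rule C_k_SucI[OF has_derivative_add[OF C_k_SucD(1)[OF Suc.prems(1)] C_k_SucD(1)[OF Suc.prems(2)]]])
      (rule Suc.IH[OF C_k_SucD(2)[OF Suc.prems(1)] C_k_SucD(2)[OF Suc.prems(2)]])
qed

lemma C_k_mult: "C_k k f \<Longrightarrow> C_k k g \<Longrightarrow> C_k k (\<lambda>x. f x * g x)"
proof (induction k arbitrary: f g)
  case 0
  then show ?case by (auto intro: continuous_intros)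
next
  case (Suc k)
  show ?case
    by (rule C_k_SucI[OF has_derivative_mult[OF C_k_SucD(1)[OF Suc.prems(1)] C_k_SucD(1)[OF Suc.prems(2)]]])
      (rule C_k_add[OF Suc.IH[OF C_k_Suc_imp[OF Suc.prems(1)] C_k_SucD(2)[OF Suc.prems(2)]]
          Suc.IH[OF C_k_SucD(2)[OF Suc.prems(1)] C_k_Suc_imp[OF Suc.prems(2)]]])
qed

lemma C_k_cmult: "C_k k f \<Longrightarrow> C_k k (\<lambda>x. c * f x)"
  by (intro C_k_mult C_k_const)

lemma C_k_diff: "C_k k f \<Longrightarrow> C_k k g \<Longrightarrow> C_k k (\<lambda>x. f x - g x)"
  using C_k_add[of k f "\<lambda>x. (-1) * g x"] C_k_cmult[of k g "-1"] by simp

lemma C_k_inner: "C_k k (\<lambda>x. x \<bullet> c)"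
proof (cases k)
  case (Suc j)
  show ?thesis unfolding Suc
    by (rule C_k_SucI[where f' = "\<lambda>x h. h \<bullet> c"]) (auto intro!: derivative_eq_intros C_k_const)
qed (auto intro: continuous_intros)

lemma C_k_sum: "finite I \<Longrightarrow> (\<And>i. i \<in> I \<Longrightarrow> C_k k (f i)) \<Longrightarrow> C_k k (\<lambda>x. \<Sum>i\<in>I. f i x)"
  by (induction I rule: finite_induct) (auto intro: C_k_const C_k_add)

lemma C_k_prod: "finite I \<Longrightarrow> (\<And>i. i \<in> I \<Longrightarrow> C_k k (f i)) \<Longrightarrow> C_k k (\<lambda>x. \<Prod>i\<in>I. f i x)"
  by (induction I rule: finite_induct) (auto intro: C_k_const C_k_mult)

lemma C_k_affine:
  fixes a :: "'a::euclidean_space"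
  shows "C_k k f \<Longrightarrow> C_k k (\<lambda>x. f (a + c *\<^sub>R x))"
proof (induction k arbitrary: f)
  case 0
  have "continuous_on UNIV (\<lambda>x. a + c *\<^sub>R x)"
    by (intro continuous_intros)
  with 0 show ?case
    using continuous_on_compose2[of UNIV f UNIV "\<lambda>x. a + c *\<^sub>R x"] by simp
next
  case (Suc k)
  have lin: "linear (frechet_derivative f (at x))" for x
    using C_k_SucD(1)[OF Suc.prems] by (rule has_derivative_linear)
  have "((\<lambda>x. f (a + c *\<^sub>R x)) has_derivative (\<lambda>h. c * frechet_derivative f (at (a + c *\<^sub>R x)) h)) (at x)" for x
  proof -
    have "((\<lambda>x. a + c *\<^sub>R x) has_derivative (\<lambda>h. c *\<^sub>R h)) (at x)"
      by (auto intro!: derivative_eq_intros)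
    from has_derivative_compose[OF this C_k_SucD(1)[OF Suc.prems]]
    show ?thesis by (simp add: linear_cmul[OF lin])
  qed
  then show ?case
    by (rule C_k_SucI) (rule C_k_cmult[OF Suc.IH[OF C_k_SucD(2)[OF Suc.prems]]])
qed

section \<open>Smooth functions on the line that vanish on the nonpositive half-line\<close>

text \<open>\<open>flat 0\<close> is the classical non-analytic smooth function; the factors
  \<open>(1 / x) ^ n\<close> make the family closed under differentiation up to linear combinations,
  so one induction gives smoothness of every member.\<close>

definition flat :: "nat \<Rightarrow> real \<Rightarrow> real" where
  "flat n x = (if x > 0 then (1 / x) ^ n * exp (- (1 / x)) else 0)"

lemma flat_nonneg: "flat n x \<ge> 0"
  by (simp add: flat_def)

lemma flat_0_le_1: "flat 0 x \<le> 1"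
  by (simp add: flat_def)

text \<open>With y = 1 / x the limit from the right is that of \<open>y ^ n / exp y\<close> at
  infinity; on the left the function is constant.\<close>

lemma flat_tendsto_0: "flat n \<midarrow>0\<rightarrow> 0"
proof -
  have "((\<lambda>x::real. (inverse x) ^ n / exp (inverse x)) \<longlongrightarrow> 0) (at_right 0)"
    by (rule filterlim_compose[OF tendsto_power_div_exp_0 filterlim_inverse_at_top_right])
  then have "(flat n \<longlongrightarrow> 0) (at_right 0)"
    by (rule Lim_transform_eventually)
      (auto simp: eventually_at_right_field flat_def exp_minus divide_simps intro!: exI[of _ 1])
  moreover have "(flat n \<longlongrightarrow> 0) (at_left 0)"
    by (rule Lim_transform_eventually[OF tendsto_const])
      (auto simp: eventually_at_left_field flat_def intro!: exI[of _ "-1"])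
  ultimately show ?thesis
    by (simp add: filterlim_at_split)
qed

lemma flat_has_derivative:
  "(flat n has_real_derivative (flat (n + 2) x - real n * flat (n + 1) x)) (at x)"
proof -
  consider "x > 0" | "x = 0" | "x < 0" by linarith
  then show ?thesis
  proof cases
    case 1
    have inv: "((\<lambda>x. 1 / x) has_real_derivative - ((1 / x) ^ 2)) (at x)"
      using 1 by (auto intro!: derivative_eq_intros simp: power2_eq_square)
    have "((\<lambda>x. (1 / x) ^ n * exp (- (1 / x))) has_real_derivative
       real n * ((1 / x) ^ (n - 1) * - ((1 / x) ^ 2)) * exp (- (1 / x))
       + exp (- (1 / x)) * - (- ((1 / x) ^ 2)) * (1 / x) ^ n) (at x)"
      using DERIV_mult[OF DERIV_power[OF inv, of n] DERIV_chain'[OF DERIV_minus[OF inv] DERIV_exp]]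
      by (simp add: algebra_simps)
    also have "real n * ((1 / x) ^ (n - 1) * - ((1 / x) ^ 2)) * exp (- (1 / x))
       + exp (- (1 / x)) * - (- ((1 / x) ^ 2)) * (1 / x) ^ n
       = flat (n + 2) x - real n * flat (n + 1) x"
      \<comment> \<open>For \<open>n = 0\<close> the truncated exponent \<open>n - 1\<close> is
        harmless, since its coefficient \<open>real n\<close> is 0.\<close>
      using 1 by (cases n) (simp_all add: flat_def power2_eq_square algebra_simps)
    finally have "((\<lambda>x. (1 / x) ^ n * exp (- (1 / x))) has_real_derivative
       (flat (n + 2) x - real n * flat (n + 1) x)) (at x)" .
    then show ?thesis
      by (rule has_field_derivative_transform_within_open[of _ _ _ "{0<..}"]) (use 1 in \<open>auto simp: flat_def\<close>)
  next
    case 2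
    \<comment> \<open>For \<open>h \<noteq> 0\<close> this difference quotient equals
      \<open>flat (Suc n) h\<close>.\<close>
    have "(\<lambda>h. (flat n h - flat n 0) / h) \<midarrow>0\<rightarrow> 0"
      by (rule Lim_transform_eventually[OF flat_tendsto_0[of "Suc n"]])
        (auto simp: flat_def eventually_at intro!: exI[of _ 1])
    then have "(flat n has_real_derivative 0) (at 0)"
      by (simp add: DERIV_def)
    then show ?thesis using 2 by (simp add: flat_def)
  next
    case 3
    have "((\<lambda>x. 0) has_real_derivative 0) (at x)" by simp
    then have "(flat n has_real_derivative 0) (at x)"
      by (rule has_field_derivative_transform_within_open[of _ _ _ "{..<0}"]) (use 3 in \<open>auto simp: flat_def\<close>)
    then show ?thesis using 3 by (simp add: flat_def)
  qed
qed

text \<open>The induction runs over all \<open>n\<close> at once, because one derivative raises the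
  index by one and by two.\<close>

lemma C_k_flat: "(\<And>j. C_k j h) \<Longrightarrow> C_k k (\<lambda>x. flat n (h x))"
proof (induction k arbitrary: n)
  case 0
  have "continuous_on UNIV (flat n)"
    by (rule DERIV_continuous_on[OF has_field_derivative_at_within[OF flat_has_derivative]])
  moreover have "continuous_on UNIV h" using 0[of 0] by simp
  ultimately show ?case
    using continuous_on_compose2[of UNIV "flat n" UNIV h] by simp
next
  case (Suc k)
  note h = Suc.prems[of "Suc k"]
  have "((\<lambda>x. flat n (h x)) has_derivative
     (\<lambda>v. (flat (n + 2) (h x) - real n * flat (n + 1) (h x)) * frechet_derivative h (at x) v)) (at x)" for x
    using has_derivative_compose[OF C_k_SucD(1)[OF h] flat_has_derivative[unfolded has_field_derivative_def]]
    by simp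
  moreover have "C_k k (\<lambda>x. (flat (n + 2) (h x) - real n * flat (n + 1) (h x)) * frechet_derivative h (at x) b)"
    if "b \<in> Basis" for b
  proof -
    have "C_k k (\<lambda>x. flat m (h x))" for m using Suc.IH Suc.prems by blast
    from C_k_mult[OF C_k_diff[OF this[of "n + 2"] C_k_cmult[OF this[of "n + 1"], of "real n"]] C_k_SucD(2)[OF h that]]
    show ?thesis .
  qed
  ultimately show ?case
    by (rule C_k_SucI)
qed

lemma test_functionsI:
  assumes "\<And>k. C_k k \<phi>" "\<And>x. norm x > R \<Longrightarrow> \<phi> x = 0"
  shows "\<phi> \<in> test_functions"
proof -
  have "{x. \<phi> x \<noteq> 0} \<subseteq> cball 0 R"
    using assms(2) by (force simp: not_le)
  then have "bounded {x. \<phi> x \<noteq> 0}"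
    using bounded_cball bounded_subset by blast
  then show ?thesis using assms(1) by (simp add: test_functions_def)
qed

lemma test_functions_C_k: "\<phi> \<in> test_functions \<Longrightarrow> C_k k \<phi>"
  by (simp add: test_functions_def)

lemma test_functions_support:
  assumes "\<phi> \<in> test_functions"
  obtains R where "R > 0" "\<And>x. norm x \<ge> R \<Longrightarrow> \<phi> x = 0"
proof -
  have "bounded (closure {x. \<phi> x \<noteq> 0})"
    using assms by (simp add: test_functions_def compact_imp_bounded)
  then obtain R where R: "\<And>x. x \<in> closure {x. \<phi> x \<noteq> 0} \<Longrightarrow> norm x \<le> R"
    by (auto simp: bounded_iff)
  show ?thesis
  proof
    show "\<bar>R\<bar> + 1 > 0" by simp
    show "\<phi> x = 0" if "norm x \<ge> \<bar>R\<bar> + 1" for x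
    proof (rule ccontr)
      assume "\<phi> x \<noteq> 0"
      then have "x \<in> closure {x. \<phi> x \<noteq> 0}" using closure_subset[of "{x. \<phi> x \<noteq> 0}"] by auto
      from R[OF this] that show False by linarith
    qed
  qed
qed

lemma test_functions_has_derivative:
  "\<phi> \<in> test_functions \<Longrightarrow> (\<phi> has_derivative frechet_derivative \<phi> (at x)) (at x)"
  using C_k_SucD(1) test_functions_C_k by blast

lemma test_functions_continuous: "\<phi> \<in> test_functions \<Longrightarrow> continuous_on UNIV \<phi>"
  using test_functions_C_k[of \<phi> 0] by simp

lemma test_functions_measurable [measurable_dest]: "\<phi> \<in> test_functions \<Longrightarrow> \<phi> \<in> borel_measurable borel"
  by (simp add: borel_measurable_continuous_onI test_functions_continuous)

lemma test_functions_mult: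
  assumes "\<phi> \<in> test_functions" "\<And>k. C_k k h"
  shows "(\<lambda>x. \<phi> x * h x) \<in> test_functions"
proof -
  obtain R where "\<And>x. norm x \<ge> R \<Longrightarrow> \<phi> x = 0"
    using test_functions_support[OF assms(1)] by blast
  then show ?thesis
    by (intro test_functionsI[of "\<lambda>x. \<phi> x * h x" R] C_k_mult[OF test_functions_C_k[OF assms(1)] assms(2)]) auto
qed

lemma test_functions_affine:
  fixes a :: "'a::euclidean_space"
  assumes "\<phi> \<in> test_functions" "c \<noteq> 0"
  shows "(\<lambda>x. \<phi> (a + c *\<^sub>R x)) \<in> test_functions"
proof -
  obtain R where R: "\<And>x. norm x \<ge> R \<Longrightarrow> \<phi> x = 0"
    using test_functions_support[OF assms(1)] by blast
  show ?thesis
  proof (rule test_functionsI[of _ "(R + norm a) / \<bar>c\<bar>"])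
    fix x :: 'a assume "norm x > (R + norm a) / \<bar>c\<bar>"
    then have "norm (c *\<^sub>R x) > R + norm a"
      using assms(2) by (simp add: field_simps)
    moreover have "norm (c *\<^sub>R x) \<le> norm (a + c *\<^sub>R x) + norm a"
      by (metis add.commute add_diff_cancel_left' norm_triangle_ineq4)
    ultimately have "norm (a + c *\<^sub>R x) \<ge> R" by simp
    then show "\<phi> (a + c *\<^sub>R x) = 0" by (rule R)
  qed (rule C_k_affine[OF test_functions_C_k[OF assms(1)]])
qed

lemma test_functions_shift: "\<phi> \<in> test_functions \<Longrightarrow> (\<lambda>x. \<phi> (x + a)) \<in> test_functions"
  using test_functions_affine[of \<phi> 1 a] by (simp add: add.commute)

lemma test_functions_deriv:
  fixes \<phi> :: "'a::euclidean_space \<Rightarrow> real"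
  assumes "\<phi> \<in> test_functions" "b \<in> Basis"
  shows "(\<lambda>x. frechet_derivative \<phi> (at x) b) \<in> test_functions"
proof -
  obtain R where R: "\<And>x. norm x \<ge> R \<Longrightarrow> \<phi> x = 0"
    using test_functions_support[OF assms(1)] by blast
  show ?thesis
  proof (rule test_functionsI[of _ R])
    fix x :: 'a assume x: "norm x > R"
    have "open {y::'a. norm y > R}"
      by (intro open_Collect_less continuous_intros)
    then have "(\<phi> has_derivative (\<lambda>h. 0)) (at x)"
      using has_derivative_transform_within_open[OF has_derivative_const[of 0 "at x"], of "{y. norm y > R}" \<phi>] x R
      by auto
    from frechet_derivative_at[OF this] show "frechet_derivative \<phi> (at x) b = 0" by metis
  qed (rule C_k_SucD(2)[OF test_functions_C_k[OF assms(1)] assms(2)])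
qed

lemma test_functions_bounded:
  assumes "\<phi> \<in> test_functions"
  obtains B where "B > 0" "\<And>x. \<bar>\<phi> x\<bar> \<le> B"
proof -
  obtain R where R: "R > 0" "\<And>x. norm x \<ge> R \<Longrightarrow> \<phi> x = 0"
    using test_functions_support[OF assms(1)] by blast
  have "compact (\<phi> ` cball 0 R)"
    by (intro compact_continuous_image continuous_on_subset[OF test_functions_continuous[OF assms]]) auto
  then obtain B where B: "\<And>x. norm x \<le> R \<Longrightarrow> \<bar>\<phi> x\<bar> \<le> B"
    unfolding compact_eq_bounded_closed bounded_iff by (metis imageI mem_cball_0 real_norm_def)
  show ?thesis
  proof
    show "\<bar>B\<bar> + 1 > 0" by simp
    show "\<bar>\<phi> x\<bar> \<le> \<bar>B\<bar> + 1" for x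
      using B[of x] R(2)[of x] by (cases "norm x \<le> R") auto
  qed
qed

section \<open>Gradients of test functions\<close>

definition grad :: "('a::euclidean_space \<Rightarrow> real) \<Rightarrow> 'a \<Rightarrow> 'a" where
  "grad \<phi> x = (\<Sum>b\<in>Basis. frechet_derivative \<phi> (at x) b *\<^sub>R b)"

lemma grad_inner_Basis: "b \<in> Basis \<Longrightarrow> grad \<phi> x \<bullet> b = frechet_derivative \<phi> (at x) b"
  by (simp add: grad_def inner_sum_left inner_Basis if_distrib sum.delta' cong: if_cong)

lemma grad_inner:
  assumes "\<phi> \<in> test_functions"
  shows "grad \<phi> x \<bullet> h = frechet_derivative \<phi> (at x) h"
proof -
  have lin: "linear (frechet_derivative \<phi> (at x))"
    using test_functions_has_derivative[OF assms] by (rule has_derivative_linear)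
  have "frechet_derivative \<phi> (at x) h = frechet_derivative \<phi> (at x) (\<Sum>b\<in>Basis. (h \<bullet> b) *\<^sub>R b)"
    by (simp add: euclidean_representation)
  also have "\<dots> = (\<Sum>b\<in>Basis. (h \<bullet> b) * frechet_derivative \<phi> (at x) b)"
    by (simp add: linear_sum[OF lin] linear_cmul[OF lin])
  finally show ?thesis
    by (simp add: grad_def inner_sum_left inner_commute[of h] mult.commute)
qed

lemma test_functions_has_grad:
  "\<phi> \<in> test_functions \<Longrightarrow> (\<phi> has_derivative (\<lambda>h. grad \<phi> x \<bullet> h)) (at x)"
  using test_functions_has_derivative[of \<phi> x] grad_inner[of \<phi> x] by (simp add: fun_eq_iff[symmetric] eta_contract_eq)

lemma grad_eqI:
  assumes "(\<phi> has_derivative (\<lambda>h. v \<bullet> h)) (at x)"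
  shows "grad \<phi> x = v"
proof -
  have "frechet_derivative \<phi> (at x) = (\<lambda>h. v \<bullet> h)"
    using frechet_derivative_at[OF assms] by simp
  then show ?thesis by (simp add: grad_def euclidean_representation)
qed

lemma grad_continuous: 
  assumes "\<phi> \<in> test_functions" shows "continuous_on UNIV (grad \<phi>)"
proof -
  have "continuous_on UNIV (\<lambda>x. \<Sum>b\<in>Basis. frechet_derivative \<phi> (at x) b *\<^sub>R b)"
    by (intro continuous_on_sum continuous_on_scaleR continuous_on_const
        test_functions_continuous test_functions_deriv assms)
  then show ?thesis unfolding grad_def[abs_def] .
qed

lemma grad_support:
  fixes \<phi> :: "'a::euclidean_space \<Rightarrow> real"
  assumes "\<phi> \<in> test_functions"
  obtains R where "R > 0" "\<And>x. norm x \<ge> R \<Longrightarrow> \<phi> x = 0" "\<And>x. norm x \<ge> R \<Longrightarrow> grad \<phi> x = 0"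
proof -
  obtain R0 where R0: "R0 > 0" "\<And>x. norm x \<ge> R0 \<Longrightarrow> \<phi> x = 0"
    using test_functions_support[OF assms] by blast
  have "grad \<phi> x = 0" if x: "norm x \<ge> R0 + 1" for x
  proof (rule grad_eqI)
    have "open {y::'a. norm y > R0}"
      by (intro open_Collect_less continuous_intros)
    then show "(\<phi> has_derivative (\<lambda>h. 0 \<bullet> h)) (at x)"
      using has_derivative_transform_within_open[OF has_derivative_const[of 0 "at x"], of "{y. norm y > R0}" \<phi>] x R0
      by auto
  qed
  with R0 show ?thesis by (intro that[of "R0 + 1"]) auto
qed

lemma grad_bounded:
  assumes "\<phi> \<in> test_functions"
  obtains B where "B > 0" "\<And>x. norm (grad \<phi> x) \<le> B"
proof -
  obtain R where R: "R > 0" "\<And>x. norm x \<ge> R \<Longrightarrow> grad \<phi> x = 0"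
    using grad_support[OF assms] by metis
  have "compact (grad \<phi> ` cball 0 R)"
    by (intro compact_continuous_image continuous_on_subset[OF grad_continuous[OF assms]]) auto
  then obtain B where B: "\<And>x. norm x \<le> R \<Longrightarrow> norm (grad \<phi> x) \<le> B"
    unfolding compact_eq_bounded_closed bounded_iff by (metis imageI mem_cball_0)
  show ?thesis
  proof
    show "\<bar>B\<bar> + 1 > 0" by simp
    show "norm (grad \<phi> x) \<le> \<bar>B\<bar> + 1" for x
      using B[of x] R(2)[of x] by (cases "norm x \<le> R") auto
  qed
qed

text \<open>Supplies the dominating constant when difference quotients of a test function are passed
  to the limit under an integral.\<close>

lemma test_functions_lipschitz:
  assumes "\<phi> \<in> test_functions"
  obtains B where "B > 0" "\<And>x. norm (grad \<phi> x) \<le> B" "\<And>x y. \<bar>\<phi> x - \<phi> y\<bar> \<le> B * norm (x - y)"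
proof -
  obtain B where B: "B > 0" "\<And>x. norm (grad \<phi> x) \<le> B"
    using grad_bounded[OF assms] by metis
  have "norm (\<phi> x - \<phi> y) \<le> B * norm (x - y)" for x y
  proof (rule differentiable_bound[of UNIV \<phi> "\<lambda>x h. grad \<phi> x \<bullet> h"])
    show "onorm (\<lambda>h. grad \<phi> x \<bullet> h) \<le> B" for x
    proof (rule onorm_le)
      fix h
      have "norm (grad \<phi> x \<bullet> h) \<le> norm (grad \<phi> x) * norm h"
        using Cauchy_Schwarz_ineq2 by auto
      also have "\<dots> \<le> B * norm h" using B(2) by (intro mult_right_mono) auto
      finally show "norm (grad \<phi> x \<bullet> h) \<le> B * norm h" .
    qed
  qed (auto intro: test_functions_has_grad assms)
  with B show ?thesis by (intro that) auto
qed

section \<open>Local integrability and weak gradients\<close>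

abbreviation cut :: "real \<Rightarrow> 'a::euclidean_space \<Rightarrow> real" where
  "cut R x \<equiv> indicator (cball 0 R) x"

text \<open>Borel measurability and \<open>lborel\<close> replace the completed measure, so that
  translation invariance and Fubini apply directly. Centred balls suffice because every compact set
  lies in one.\<close>

definition loc_int :: "('a::euclidean_space \<Rightarrow> 'b::euclidean_space) \<Rightarrow> bool" where
  "loc_int f \<longleftrightarrow> f \<in> borel_measurable borel \<and>
     (\<forall>R. integrable lborel (\<lambda>x. cut R x *\<^sub>R f x))"

lemma loc_int_measurable [measurable_dest]: "loc_int f \<Longrightarrow> f \<in> borel_measurable borel"
  by (simp add: loc_int_def)

lemma loc_int_integrable: "loc_int f \<Longrightarrow> integrable lborel (\<lambda>x. cut R x *\<^sub>R f x)"
  by (simp add: loc_int_def)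

lemma borel_ball_sets [measurable]:
  "cball (a::'a::metric_space) R \<in> sets borel" "ball a R \<in> sets borel"
  by auto

lemma L1_loc_iff_loc_int:
  assumes [measurable]: "f \<in> borel_measurable borel"
  shows "f \<in> L1_loc \<longleftrightarrow> loc_int f"
proof
  assume f: "f \<in> L1_loc"
  have "integrable lborel (\<lambda>x. cut R x *\<^sub>R f x)" for R
  proof -
    have "f absolutely_integrable_on cball 0 R"
      using f by (auto simp: L1_loc_def)
    then have "integrable lebesgue (\<lambda>x. cut R x *\<^sub>R f x)"
      by (simp add: set_integrable_def)
    then show ?thesis
      by (subst (asm) integrable_completion) measurable
  qed
  then show "loc_int f" by (simp add: loc_int_def)
next
  assume f: "loc_int f"
  have "f absolutely_integrable_on K" if K: "compact K" for K
  proof -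
    obtain R where "K \<subseteq> cball 0 R"
      using compact_imp_bounded[OF K] by (auto simp: bounded_iff subset_iff)
    moreover have "f absolutely_integrable_on cball 0 R"
      using loc_int_integrable[OF f] by (simp add: set_integrable_def integrable_completion)
    ultimately show ?thesis
      using K by (metis set_integrable_subset sets_completionI_sets compact_imp_closed
          borel_closed sets_lborel)
  qed
  then show "f \<in> L1_loc" by (simp add: L1_loc_def)
qed

lemma integrable_loc_int_mult:
  fixes f :: "'a::euclidean_space \<Rightarrow> 'b::euclidean_space" and g :: "'a \<Rightarrow> real"
  assumes f: "loc_int f" and [measurable]: "g \<in> borel_measurable borel"
    and bd: "\<And>x. \<bar>g x\<bar> \<le> B" and sp: "\<And>x. norm x > R \<Longrightarrow> g x = 0"
  shows "integrable lborel (\<lambda>x. g x *\<^sub>R f x)"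
proof (rule Bochner_Integration.integrable_bound)
  show "integrable lborel (\<lambda>x. B *\<^sub>R (cut R x *\<^sub>R f x))"
    by (intro integrable_scaleR_right loc_int_integrable f)
  show "AE x in lborel. norm (g x *\<^sub>R f x) \<le> norm (B *\<^sub>R (cut R x *\<^sub>R f x))"
  proof (rule AE_I2)
    fix x show "norm (g x *\<^sub>R f x) \<le> norm (B *\<^sub>R (cut R x *\<^sub>R f x))"
      using order_trans[OF bd[of x] abs_ge_self[of B]] sp[of x]
      by (auto simp: indicator_def not_le intro!: mult_right_mono)
  qed
qed (use f in measurable)

lemma loc_int_mult:
  fixes f :: "'a::euclidean_space \<Rightarrow> 'b::euclidean_space" and g :: "'a \<Rightarrow> real"
  assumes f: "loc_int f" and [measurable]: "g \<in> borel_measurable borel"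
    and bd: "\<And>x. \<bar>g x\<bar> \<le> B"
  shows "loc_int (\<lambda>x. g x *\<^sub>R f x)"
proof -
  have "integrable lborel (\<lambda>x. (cut R x * g x) *\<^sub>R f x)" for R
    using bd order_trans[OF abs_ge_zero bd]
    by (intro integrable_loc_int_mult[OF f, of _ B R]) (auto simp: indicator_def)
  moreover have "(\<lambda>x. g x *\<^sub>R f x) \<in> borel_measurable borel"
    using f by measurable
  ultimately show ?thesis by (simp add: loc_int_def)
qed

lemma loc_int_add: "loc_int f \<Longrightarrow> loc_int g \<Longrightarrow> loc_int (\<lambda>x. f x + g x)"
  unfolding loc_int_def by (auto simp: scaleR_add_right)

lemma loc_int_scaleR: "loc_int f \<Longrightarrow> loc_int (\<lambda>x. c *\<^sub>R f x)"
  using loc_int_mult[of f "\<lambda>_. c" "\<bar>c\<bar>"] by auto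

lemma loc_int_inner:
  assumes f: "loc_int f" shows "loc_int (\<lambda>x. f x \<bullet> c)"
proof -
  have "integrable lborel (\<lambda>x. (cut R x *\<^sub>R f x) \<bullet> c)" for R
    by (intro integrable_inner_left loc_int_integrable f)
  with f show ?thesis by (auto simp: loc_int_def)
qed

lemma integral_lborel_shift:
  fixes f :: "'a::euclidean_space \<Rightarrow> 'b::euclidean_space"
  assumes [measurable]: "f \<in> borel_measurable borel"
  shows "(LBINT x. f (x + y)) = (LBINT x. f x)"
  by (subst (2) lborel_distr_plus[of y, symmetric]) (simp add: integral_distr add.commute)

lemma integrable_lborel_shift:
  fixes f :: "'a::euclidean_space \<Rightarrow> 'b::euclidean_space"
  assumes f: "integrable lborel f"
  shows "integrable lborel (\<lambda>x. f (x + y))"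
proof -
  have "integrable (distr lborel borel ((+) y)) f"
    using f by (simp add: lborel_distr_plus)
  then show ?thesis
    by (subst (asm) integrable_distr_eq) (use f in \<open>auto simp: add.commute\<close>)
qed

lemma loc_int_shift:
  fixes f :: "'a::euclidean_space \<Rightarrow> 'b::euclidean_space"
  assumes f: "loc_int f"
  shows "loc_int (\<lambda>x. f (x + y))"
proof -
  note [measurable] = loc_int_measurable[OF f]
  have "integrable lborel (\<lambda>x. cut R x *\<^sub>R f (x + y))" for R
  proof -
    have "integrable lborel (\<lambda>x. indicator (cball 0 (R + norm y)) (x + y) *\<^sub>R f (x + y))"
      using integrable_lborel_shift[OF loc_int_integrable[OF f]] .
    then show ?thesis
    proof (rule Bochner_Integration.integrable_bound)
      show "AE x in lborel. norm (cut R x *\<^sub>R f (x + y))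
          \<le> norm (indicator (cball 0 (R + norm y)) (x + y) *\<^sub>R f (x + y))"
      proof (rule AE_I2)
        fix x :: 'a
        have "norm (x + y) \<le> norm x + norm y" by (rule norm_triangle_ineq)
        then show "norm (cut R x *\<^sub>R f (x + y))
          \<le> norm (indicator (cball 0 (R + norm y)) (x + y) *\<^sub>R f (x + y))"
          by (auto simp: indicator_def)
      qed
    qed measurable
  qed
  then show ?thesis by (simp add: loc_int_def)
qed

lemma integrable_test_mult:
  fixes f :: "'a::euclidean_space \<Rightarrow> 'b::euclidean_space"
  assumes f: "loc_int f" and phi: "\<phi> \<in> test_functions"
  shows "integrable lborel (\<lambda>x. \<phi> x *\<^sub>R f x)"
proof -
  obtain R where R: "\<And>x. norm x \<ge> R \<Longrightarrow> \<phi> x = 0"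
    using test_functions_support[OF phi] by blast
  obtain B where B: "\<And>x. \<bar>\<phi> x\<bar> \<le> B"
    using test_functions_bounded[OF phi] by blast
  show ?thesis
    by (rule integrable_loc_int_mult[OF f, of _ B R]) (use R B phi in auto)
qed

section \<open>The fundamental lemma of the calculus of variations\<close>

text \<open>The product is positive exactly on \<open>box a b\<close>, and it converges to the
  indicator of the open box as \<open>c\<close> tends to infinity.\<close>

lemma test_functions_box:
  "(\<lambda>x. \<Prod>i\<in>Basis. flat 0 (c * (x \<bullet> i - a \<bullet> i)) * flat 0 (c * (b \<bullet> i - x \<bullet> i))) \<in> test_functions"
  (is "?f \<in> _") if "c > 0" for a b :: "'a::euclidean_space"
proof -
  have "bounded (box a b)" by simp
  then obtain R where R: "\<And>x. x \<in> box a b \<Longrightarrow> norm x \<le> R"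
    by (auto simp: bounded_iff)
  show ?thesis
  proof (rule test_functionsI)
    fix x :: 'a assume "norm x > R"
    then have "x \<notin> box a b" using R by force
    then obtain i where "i \<in> Basis" "\<not> (a \<bullet> i < x \<bullet> i \<and> x \<bullet> i < b \<bullet> i)"
      by (auto simp: mem_box)
    then have "flat 0 (c * (x \<bullet> i - a \<bullet> i)) * flat 0 (c * (b \<bullet> i - x \<bullet> i)) = 0"
      using that by (auto simp: flat_def zero_less_mult_iff)
    with \<open>i \<in> Basis\<close> show "?f x = 0" by (intro prod_zero) auto
  next
    fix k show "C_k k ?f"
      by (intro C_k_prod finite_Basis C_k_mult C_k_flat C_k_cmult C_k_diff C_k_inner C_k_const)
  qed
qed

lemma flat_0_scaled_tendsto: "(\<lambda>n. flat 0 (real (Suc n) * y)) \<longlonglongrightarrow> (if y > 0 then 1 else 0)"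
proof (cases "y > 0")
  case True
  have "(\<lambda>n. exp (- (inverse (real (Suc n)) * inverse y))) \<longlonglongrightarrow> exp (- (0 * inverse y))"
    by (intro tendsto_intros LIMSEQ_inverse_real_of_nat)
  then show ?thesis using True
    by (simp add: flat_def zero_less_mult_iff field_simps del: of_nat_Suc)
next
  case False
  then show ?thesis by (simp add: flat_def zero_less_mult_iff)
qed

text \<open>Dominated convergence along \<open>test_functions_box\<close> with
  \<open>c = Suc n\<close>: these functions take values in [0, 1] and vanish outside the box, so
  \<bar>h\<bar> on a large ball is a majorant.\<close>

lemma fundamental_lemma_box:
  fixes h :: "'a::euclidean_space \<Rightarrow> real"
  assumes h: "loc_int h" and zero: "\<And>\<phi>. \<phi> \<in> test_functions \<Longrightarrow> (LBINT x. \<phi> x * h x) = 0"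
  shows "(LBINT x. indicator (box a b) x * h x) = 0"
proof -
  note [measurable] = loc_int_measurable[OF h]
  let ?f = "\<lambda>n x. \<Prod>i\<in>Basis. flat 0 (real (Suc n) * (x \<bullet> i - a \<bullet> i)) * flat 0 (real (Suc n) * (b \<bullet> i - x \<bullet> i))"
  have tf: "?f n \<in> test_functions" for n
    by (rule test_functions_box) simp
  obtain R where R: "\<And>x. x \<in> box a b \<Longrightarrow> norm x \<le> R"
    using bounded_box[of a b] by (auto simp: bounded_iff)
  have fbd: "\<bar>?f n x\<bar> \<le> cut R x" for n x
  proof (cases "x \<in> box a b")
    case True
    have "0 \<le> ?f n x" "?f n x \<le> 1"
      by (auto intro!: prod_nonneg prod_le_1 mult_nonneg_nonneg mult_le_one flat_nonneg flat_0_le_1)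
    then show ?thesis using R[OF True] by auto
  next
    case False
    then obtain i where "i \<in> Basis" "\<not> (a \<bullet> i < x \<bullet> i \<and> x \<bullet> i < b \<bullet> i)"
      by (auto simp: mem_box)
    then have "flat 0 (real (Suc n) * (x \<bullet> i - a \<bullet> i)) * flat 0 (real (Suc n) * (b \<bullet> i - x \<bullet> i)) = 0"
      by (auto simp: flat_def zero_less_mult_iff)
    then have "?f n x = 0" using \<open>i \<in> Basis\<close> by (intro prod_zero) auto
    then show ?thesis by (simp only: abs_zero indicator_pos_le)
  qed
  have lim: "(\<lambda>n. ?f n x) \<longlonglongrightarrow> indicator (box a b) x" for x
  proof -
    have "(\<lambda>n. ?f n x) \<longlonglongrightarrow> (\<Prod>i\<in>Basis. (if x \<bullet> i - a \<bullet> i > 0 then 1 else 0) * (if b \<bullet> i - x \<bullet> i > 0 then 1 else 0))"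
      by (intro tendsto_prod tendsto_mult flat_0_scaled_tendsto)
    also have "(\<Prod>i\<in>Basis. (if x \<bullet> i - a \<bullet> i > 0 then 1 else 0) * (if b \<bullet> i - x \<bullet> i > 0 then 1 else 0))
       = (indicator (box a b) x :: real)"
      by (auto simp: mem_box indicator_def intro!: prod.neutral) 
    finally show ?thesis .
  qed
  have "(\<lambda>n. \<integral>x. ?f n x * h x \<partial>lborel) \<longlonglongrightarrow> (LBINT x. indicator (box a b) x * h x)"
  proof (rule integral_dominated_convergence[where w = "\<lambda>x. norm (cut R x *\<^sub>R h x)"])
    show "integrable lborel (\<lambda>x. norm (cut R x *\<^sub>R h x))"
      by (intro integrable_norm loc_int_integrable h)
    show "AE x in lborel. (\<lambda>n. ?f n x * h x) \<longlonglongrightarrow> indicator (box a b) x * h x"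
      by (intro AE_I2 tendsto_mult lim tendsto_const)
    show "AE x in lborel. norm (?f n x * h x) \<le> norm (cut R x *\<^sub>R h x)" for n
      using fbd by (intro AE_I2) (simp add: abs_mult mult_right_mono)
    show "(\<lambda>x. ?f n x * h x) \<in> borel_measurable lborel" for n
      using test_functions_measurable[OF tf] by measurable
  qed measurable
  then have "(\<lambda>n. 0) \<longlonglongrightarrow> (LBINT x. indicator (box a b) x * h x)"
    by (simp only: zero[OF tf])
  then show ?thesis
    using LIMSEQ_unique tendsto_const by blast
qed

text \<open>On a bounded box \<open>\<Omega> n\<close> the positive and negative parts of
  \<open>h\<close> are densities of finite measures. These agree on boxes, an intersection-stable
  generator of the Borel sets, hence everywhere; uniqueness of densities then equates the two parts,
  so both vanish.\<close>

lemma fundamental_lemma: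
  fixes h :: "'a::euclidean_space \<Rightarrow> real"
  assumes h: "loc_int h" and zero: "\<And>\<phi>. \<phi> \<in> test_functions \<Longrightarrow> (LBINT x. \<phi> x * h x) = 0"
  shows "AE x in lborel. h x = 0"
proof -
  note [measurable] = loc_int_measurable[OF h]
  define \<Omega> where "\<Omega> n = box (- (real n *\<^sub>R One)) (real n *\<^sub>R One :: 'a)" for n
  have [measurable]: "\<Omega> n \<in> sets borel" for n by (simp add: \<Omega>_def)
  have "AE x in lborel. x \<in> \<Omega> n \<longrightarrow> h x = 0" for n
  proof -
    let ?p = "\<lambda>x. max 0 (h x) * indicator (\<Omega> n) x" and ?m = "\<lambda>x. max 0 (- h x) * indicator (\<Omega> n) x"
    obtain R where R: "\<Omega> n \<subseteq> cball 0 R"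
      using bounded_box[of "- (real n *\<^sub>R One)" "real n *\<^sub>R One :: 'a"]
      unfolding \<Omega>_def bounded_iff by (auto simp: subset_iff)
    have int: "integrable lborel (\<lambda>x. ?p x * indicator A x)" "integrable lborel (\<lambda>x. ?m x * indicator A x)"
      if [measurable]: "A \<in> sets borel" for A
      by (rule Bochner_Integration.integrable_bound[OF loc_int_integrable[OF h, of R]];
          use R in \<open>force simp: indicator_def intro!: AE_I2\<close>)+
    have em: "emeasure (density lborel (\<lambda>x. ennreal (?p x))) A = ennreal (LBINT x. ?p x * indicator A x)"
       "emeasure (density lborel (\<lambda>x. ennreal (?m x))) A = ennreal (LBINT x. ?m x * indicator A x)"
      if [measurable]: "A \<in> sets borel" for A
      using nn_integral_eq_integral[OF int(1)[OF that]] nn_integral_eq_integral[OF int(2)[OF that]]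
      by (simp_all add: emeasure_density ennreal_mult' ennreal_indicator)
    have "density lborel (\<lambda>x. ennreal (?p x)) = density lborel (\<lambda>x. ennreal (?m x))"
    proof (rule measure_eqI_generator_eq[where E = "range (\<lambda>(a, b). box a b::'a set)" and \<Omega> = UNIV
            and A = \<Omega>])
      show "Int_stable (range (\<lambda>(a, b). box a b::'a set))"
        by (auto simp: Int_stable_def box_Int_box)
      show "range \<Omega> \<subseteq> range (\<lambda>(a, b). box a b::'a set)" "(\<Union>i. \<Omega> i) = UNIV"
        unfolding \<Omega>_def UN_box_eq_UNIV by auto
      show "emeasure (density lborel (\<lambda>x. ennreal (?p x))) (\<Omega> i) \<noteq> \<infinity>" for i
        by (subst em) auto
      fix X assume "X \<in> range (\<lambda>(a, b). box a b::'a set)"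
      then have [measurable]: "X \<in> sets borel" and X: "\<exists>a b. X = box a b" by auto
      have "\<exists>a b. \<Omega> n \<inter> X = box a b"
        using X unfolding \<Omega>_def by (elim exE) (simp only: box_Int_box, blast)
      then obtain a b where ab: "\<Omega> n \<inter> X = box a b" by blast
      have "(LBINT x. ?p x * indicator X x) - (LBINT x. ?m x * indicator X x)
         = (LBINT x. ?p x * indicator X x - ?m x * indicator X x)"
        by (rule Bochner_Integration.integral_diff[symmetric]; rule int) measurable
      also have "\<dots> = (LBINT x. indicator (\<Omega> n \<inter> X) x * h x)"
        by (intro Bochner_Integration.integral_cong) (auto simp: indicator_def)
      also have "\<dots> = 0" unfolding ab by (rule fundamental_lemma_box[OF h zero])
      finally show "emeasure (density lborel (\<lambda>x. ennreal (?p x))) X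
          = emeasure (density lborel (\<lambda>x. ennreal (?m x))) X"
        by (simp add: em)
    qed (simp_all add: borel_eq_box)
    then have "AE x in lborel. ennreal (?p x) = ennreal (?m x)"
      by (subst (asm) sigma_finite_measure.density_unique_iff[OF sigma_finite_lborel]) measurable
    then show ?thesis
      by eventually_elim (auto simp: indicator_def max_def split: if_splits)
  qed
  then have ae: "AE x in lborel. \<forall>n. x \<in> \<Omega> n \<longrightarrow> h x = 0"
    unfolding AE_all_countable ..
  have "(\<Union>n. \<Omega> n) = UNIV"
    unfolding \<Omega>_def by (rule UN_box_eq_UNIV)
  then have ex: "\<exists>n. x \<in> \<Omega> n" for x by blast
  show ?thesis
    using ae by eventually_elim (use ex in blast)
qed


section \<open>Weak gradients of Borel functions\<close>

text \<open>Borel counterpart of \<open>has_weak_gradient\<close>, with integrals over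
  \<open>lborel\<close>. Carrying an explicit gradient \<open>g\<close> avoids computing with the
  arbitrary choice made by \<open>weak_gradient\<close>.\<close>

definition wgrad :: "('a::euclidean_space \<Rightarrow> real) \<Rightarrow> ('a \<Rightarrow> 'a) \<Rightarrow> bool" where
  "wgrad u g \<longleftrightarrow> loc_int u \<and> loc_int g \<and>
     (\<forall>\<phi>\<in>test_functions. \<forall>b\<in>Basis.
        (LBINT x. u x * (grad \<phi> x \<bullet> b)) = - (LBINT x. (g x \<bullet> b) * \<phi> x))"

lemma wgrad_loc_int: "wgrad u g \<Longrightarrow> loc_int u" "wgrad u g \<Longrightarrow> loc_int g"
  by (simp_all add: wgrad_def)

lemma wgradD:
  "wgrad u g \<Longrightarrow> \<phi> \<in> test_functions \<Longrightarrow> b \<in> Basis \<Longrightarrow>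
    (LBINT x. u x * (grad \<phi> x \<bullet> b)) = - (LBINT x. (g x \<bullet> b) * \<phi> x)"
  by (simp add: wgrad_def)

lemma grad_component_test: 
  assumes "\<phi> \<in> test_functions" "b \<in> Basis"
  shows "(\<lambda>x. grad \<phi> x \<bullet> b) \<in> test_functions"
  using test_functions_deriv[OF assms] assms(2) by (simp add: grad_inner_Basis)

lemma grad_measurable [measurable_dest]: "\<phi> \<in> test_functions \<Longrightarrow> grad \<phi> \<in> borel_measurable borel"
  by (simp add: borel_measurable_continuous_onI grad_continuous)

lemma has_weak_gradient_iff_wgrad:
  assumes [measurable]: "u \<in> borel_measurable borel" "g \<in> borel_measurable borel"
  shows "u has_weak_gradient g \<longleftrightarrow> wgrad u g"
proof -
  have "(\<integral>x. u x * frechet_derivative \<phi> (at x) b \<partial>lebesgue) = (LBINT x. u x * (grad \<phi> x \<bullet> b))"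
     "(\<integral>x. (g x \<bullet> b) * \<phi> x \<partial>lebesgue) = (LBINT x. (g x \<bullet> b) * \<phi> x)"
    if "\<phi> \<in> test_functions" "b \<in> Basis" for \<phi> b
  proof -
    note [measurable] = test_functions_measurable[OF that(1)] grad_measurable[OF that(1)]
    show "(\<integral>x. u x * frechet_derivative \<phi> (at x) b \<partial>lebesgue) = (LBINT x. u x * (grad \<phi> x \<bullet> b))"
      unfolding grad_inner_Basis[OF that(2), symmetric] by (rule integral_completion) measurable
    show "(\<integral>x. (g x \<bullet> b) * \<phi> x \<partial>lebesgue) = (LBINT x. (g x \<bullet> b) * \<phi> x)"
      by (rule integral_completion) measurable
  qed
  then show ?thesis
    by (simp add: has_weak_gradient_def wgrad_def L1_loc_iff_loc_int)
qed

lemma L1_loc_cong_AE: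
  assumes ae: "AE x in lebesgue. f x = f' x" and f: "f \<in> L1_loc" and f': "f' \<in> borel_measurable lebesgue"
  shows "f' \<in> L1_loc"
proof -
  have "f' absolutely_integrable_on K" if K: "compact K" for K
  proof -
    have "integrable lebesgue (\<lambda>x. indicator K x *\<^sub>R f x)"
      using f K by (simp add: L1_loc_def set_integrable_def)
    moreover have "(\<lambda>x. indicator K x *\<^sub>R f' x) \<in> borel_measurable lebesgue"
      using K f' by (intro borel_measurable_scaleR borel_measurable_indicator) (auto simp: compact_imp_closed)
    ultimately have "integrable lebesgue (\<lambda>x. indicator K x *\<^sub>R f' x)"
      using ae by (subst integrable_cong_AE[where g = "\<lambda>x. indicator K x *\<^sub>R f x"]) (auto dest: borel_measurable_integrable)
    then show ?thesis by (simp add: set_integrable_def)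
  qed
  then show ?thesis by (simp add: L1_loc_def)
qed

lemma L1_loc_measurable:
  fixes f :: "'a::euclidean_space \<Rightarrow> 'b::euclidean_space"
  assumes "f \<in> L1_loc"
  shows "f \<in> borel_measurable lebesgue"
proof (rule borel_measurable_LIMSEQ_metric)
  show "(\<lambda>x. indicator (cball 0 (real n)) x *\<^sub>R f x) \<in> borel_measurable lebesgue" for n
    using assms by (intro borel_measurable_integrable) (auto simp: L1_loc_def set_integrable_def)
  show "(\<lambda>n. indicator (cball 0 (real n)) x *\<^sub>R f x) \<longlonglongrightarrow> f x" for x
  proof (rule tendsto_eventually)
    obtain N :: nat where "norm x \<le> N" using real_arch_simple by blast
    then show "\<forall>\<^sub>F n in sequentially. indicator (cball 0 (real n)) x *\<^sub>R f x = f x"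
      by (intro eventually_sequentiallyI[of N]) auto
  qed
qed

text \<open>Borel modifications of the finitely many real components are reassembled; the union of
  their exceptional null sets is null.\<close>

lemma ex_borel_representative:
  fixes f :: "'a::euclidean_space \<Rightarrow> 'b::euclidean_space"
  assumes [measurable]: "f \<in> borel_measurable lebesgue"
  obtains f' where "f' \<in> borel_measurable borel" "AE x in lebesgue. f x = f' x"
proof -
  have "\<exists>h\<in>borel_measurable lborel. AE x in lebesgue. f x \<bullet> b = h x" for b
  proof -
    have "(\<lambda>x. f x \<bullet> b) \<in> borel_measurable lebesgue" by measurable
    from completion_ex_borel_measurable_real[OF this] show ?thesis
      by (blast intro: AE_completion)
  qed
  then obtain h where h: "\<And>b. h b \<in> borel_measurable lborel" "\<And>b. AE x in lebesgue. f x \<bullet> b = h b x"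
    by metis
  have [measurable]: "h b \<in> borel_measurable borel" for b using h(1) by simp
  have "AE x in lebesgue. \<forall>b\<in>Basis. f x \<bullet> b = h b x"
    by (rule AE_finite_allI) (use h(2) in auto)
  then have "AE x in lebesgue. f x = (\<Sum>b\<in>Basis. h b x *\<^sub>R b)"
    by eventually_elim (metis (no_types, lifting) euclidean_representation sum.cong)
  then show ?thesis
    by (intro that[of "\<lambda>x. \<Sum>b\<in>Basis. h b x *\<^sub>R b"]) measurable
qed

lemma has_weak_gradient_cong_AE:
  assumes u: "u has_weak_gradient g" and ae: "AE x in lebesgue. u x = u' x" "AE x in lebesgue. g x = g' x"
    and m: "u' \<in> borel_measurable lebesgue" "g' \<in> borel_measurable lebesgue"
  shows "u' has_weak_gradient g'"
proof -
  have mu: "u \<in> borel_measurable lebesgue" "g \<in> borel_measurable lebesgue"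
    using u by (auto simp: has_weak_gradient_def intro: L1_loc_measurable)
  have "(\<integral>x. u' x * frechet_derivative \<phi> (at x) b \<partial>lebesgue) = - (\<integral>x. (g' x \<bullet> b) * \<phi> x \<partial>lebesgue)"
    if phi: "\<phi> \<in> test_functions" "b \<in> Basis" for \<phi> b
  proof -
    have [measurable]: "(\<lambda>x. frechet_derivative \<phi> (at x) b) \<in> borel_measurable lebesgue" "\<phi> \<in> borel_measurable lebesgue"
      using test_functions_measurable[OF test_functions_deriv[OF phi]] test_functions_measurable[OF phi(1)]
      by (auto intro: measurable_completion)
    have "(\<integral>x. u' x * frechet_derivative \<phi> (at x) b \<partial>lebesgue) = (\<integral>x. u x * frechet_derivative \<phi> (at x) b \<partial>lebesgue)"
      using ae(1) mu m by (intro integral_cong_AE) (measurable, auto)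
    also have "\<dots> = - (\<integral>x. (g x \<bullet> b) * \<phi> x \<partial>lebesgue)"
      using u phi by (simp add: has_weak_gradient_def)
    also have "(\<integral>x. (g x \<bullet> b) * \<phi> x \<partial>lebesgue) = (\<integral>x. (g' x \<bullet> b) * \<phi> x \<partial>lebesgue)"
      using ae(2) mu m by (intro integral_cong_AE) (measurable, auto)
    finally show ?thesis .
  qed
  with u ae m show ?thesis
    by (auto simp: has_weak_gradient_def intro: L1_loc_cong_AE)
qed

lemma has_weak_gradient_wgrad:
  assumes u: "u has_weak_gradient g" and m: "u' \<in> borel_measurable borel" "g' \<in> borel_measurable borel"
    and ae: "AE x in lebesgue. u x = u' x" "AE x in lebesgue. g x = g' x"
  shows "wgrad u' g'"
proof -
  have "u' \<in> borel_measurable lebesgue" "g' \<in> borel_measurable lebesgue"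
    by (rule measurable_completion; simp add: m)+
  from has_weak_gradient_cong_AE[OF u ae this] show ?thesis
    by (rule has_weak_gradient_iff_wgrad[OF m, THEN iffD1])
qed

text \<open>Each component of the difference is annihilated by all test functions, so
  \<open>fundamental_lemma\<close> applies to it.\<close>

lemma wgrad_unique:
  assumes "wgrad u g" "wgrad u g'"
  shows "AE x in lborel. g x = g' x"
proof -
  have "AE x in lborel. (g x - g' x) \<bullet> b = 0" if b: "b \<in> Basis" for b
  proof (rule fundamental_lemma)
    have "loc_int (\<lambda>x. g x + (-1) *\<^sub>R g' x)"
      by (intro loc_int_add loc_int_scaleR wgrad_loc_int(2)[OF assms(1)] wgrad_loc_int(2)[OF assms(2)])
    from loc_int_inner[OF this, of b] show "loc_int (\<lambda>x. (g x - g' x) \<bullet> b)" by simp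
    fix \<phi> :: "'a \<Rightarrow> real" assume phi: "\<phi> \<in> test_functions"
    have "(LBINT x. \<phi> x * ((g x - g' x) \<bullet> b)) = (LBINT x. \<phi> x *\<^sub>R (g x \<bullet> b) - \<phi> x *\<^sub>R (g' x \<bullet> b))"
      by (simp add: inner_diff_left algebra_simps)
    also have "\<dots> = (LBINT x. \<phi> x *\<^sub>R (g x \<bullet> b)) - (LBINT x. \<phi> x *\<^sub>R (g' x \<bullet> b))"
      by (intro Bochner_Integration.integral_diff integrable_test_mult loc_int_inner phi
          wgrad_loc_int(2)[OF assms(1)] wgrad_loc_int(2)[OF assms(2)])
    also have "\<dots> = 0"
      using wgradD[OF assms(1) phi b] wgradD[OF assms(2) phi b] by (simp add: mult.commute)
    finally show "(LBINT x. \<phi> x * ((g x - g' x) \<bullet> b)) = 0" .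
  qed
  then have "AE x in lborel. \<forall>b\<in>Basis. (g x - g' x) \<bullet> b = 0"
    by (intro AE_finite_allI) auto
  then show ?thesis
    by eventually_elim (simp add: euclidean_eq_iff[of "g _"] inner_diff_left)
qed

text \<open>The chosen gradient is known only to be Lebesgue measurable. Its Borel modification
  still satisfies \<open>wgrad\<close>, so uniqueness identifies it with \<open>g\<close> almost
  everywhere.\<close>

lemma weak_gradient_AE_wgrad:
  assumes "wgrad u g"
  shows "AE x in lebesgue. weak_gradient u x = g x" "weakly_differentiable u"
    "weak_gradient u \<in> borel_measurable lebesgue"
proof -
  note [measurable] = loc_int_measurable[OF wgrad_loc_int(1)[OF assms]] loc_int_measurable[OF wgrad_loc_int(2)[OF assms]]
  have "u has_weak_gradient g"
    using assms by (simp add: has_weak_gradient_iff_wgrad)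
  then show "weakly_differentiable u" by (auto simp: weakly_differentiable_def)
  have w: "u has_weak_gradient weak_gradient u"
    unfolding weak_gradient_def by (rule someI[where P = "\<lambda>g. u has_weak_gradient g"]) fact
  then show m: "weak_gradient u \<in> borel_measurable lebesgue"
    by (auto simp: has_weak_gradient_def intro: L1_loc_measurable)
  obtain g' where g': "g' \<in> borel_measurable borel" "AE x in lebesgue. weak_gradient u x = g' x"
    using ex_borel_representative[OF m] by blast
  have "wgrad u g'"
    by (rule has_weak_gradient_wgrad[OF w _ g'(1) _ g'(2)]) auto
  from wgrad_unique[OF this assms] have "AE x in lebesgue. g' x = g x"
    by (rule AE_completion)
  with g'(2) show "AE x in lebesgue. weak_gradient u x = g x"
    by eventually_elim simp
qed

text \<open>The means of recognising admissible test functions: the integrability conditions may be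
  checked on any Borel gradient.\<close>

lemma D1_intro:
  fixes u :: "'a::euclidean_space \<Rightarrow> real"
  assumes w: "wgrad u g"
    and "integrable lborel (\<lambda>x. \<bar>u x\<bar> powr critical_exponent DIM('a) m)"
    and "integrable lborel (\<lambda>x. norm (g x) powr m)"
  shows "u \<in> D1 m"
proof -
  note [measurable] = loc_int_measurable[OF wgrad_loc_int(1)[OF w]] loc_int_measurable[OF wgrad_loc_int(2)[OF w]]
  have [measurable]: "weak_gradient u \<in> borel_measurable lebesgue"
    by (rule weak_gradient_AE_wgrad(3)[OF w])
  have [measurable]: "g \<in> borel_measurable lebesgue"
    by (intro measurable_completion) measurable
  have "integrable lebesgue (\<lambda>x. norm (g x) powr m)"
    using assms(3) by (subst integrable_completion) measurable
  then have "integrable lebesgue (\<lambda>x. norm (weak_gradient u x) powr m)"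
    using weak_gradient_AE_wgrad(1)[OF w]
    by (subst integrable_cong_AE[where g = "\<lambda>x. norm (g x) powr m"]) (measurable, auto)
  moreover have "integrable lebesgue (\<lambda>x. \<bar>u x\<bar> powr critical_exponent DIM('a) m)"
    using assms(2) by (subst integrable_completion) measurable
  moreover have "u \<in> borel_measurable lebesgue"
    by (intro measurable_completion) measurable
  ultimately show ?thesis
    using weak_gradient_AE_wgrad(2)[OF w] by (auto simp: D1_def L_space_def)
qed

lemma grad_shift:
  assumes "\<phi> \<in> test_functions"
  shows "grad (\<lambda>x. \<phi> (x + a)) x = grad \<phi> (x + a)"
proof (rule grad_eqI)
  have "((\<lambda>x. x + a) has_derivative (\<lambda>h. h)) (at x)"
    by (auto intro!: derivative_eq_intros)
  from has_derivative_compose[OF this test_functions_has_grad[OF assms]]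
  show "((\<lambda>x. \<phi> (x + a)) has_derivative (\<lambda>h. grad \<phi> (x + a) \<bullet> h)) (at x)" .
qed

lemma grad_mult:
  assumes "\<phi> \<in> test_functions" "\<psi> \<in> test_functions"
  shows "grad (\<lambda>x. \<phi> x * \<psi> x) x = \<phi> x *\<^sub>R grad \<psi> x + \<psi> x *\<^sub>R grad \<phi> x"
  by (rule grad_eqI)
    (use has_derivative_mult[OF test_functions_has_grad[OF assms(1)] test_functions_has_grad[OF assms(2)]]
     in \<open>simp add: inner_add_left mult.commute\<close>)

text \<open>A change of variables moves the shift onto the test function, and test functions are
  closed under shifts.\<close>

lemma wgrad_shift:
  assumes w: "wgrad u g"
  shows "wgrad (\<lambda>x. u (x + a)) (\<lambda>x. g (x + a))"
  unfolding wgrad_def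
proof (intro conjI ballI loc_int_shift wgrad_loc_int(1)[OF w] wgrad_loc_int(2)[OF w])
  fix \<phi> :: "'a \<Rightarrow> real" and b :: 'a assume phi: "\<phi> \<in> test_functions" and b: "b \<in> Basis"
  let ?\<phi> = "\<lambda>x. \<phi> (x + - a)"
  have phi': "?\<phi> \<in> test_functions" by (rule test_functions_shift[OF phi])
  note [measurable] = loc_int_measurable[OF wgrad_loc_int(1)[OF w]] loc_int_measurable[OF wgrad_loc_int(2)[OF w]]
    test_functions_measurable[OF phi'] grad_measurable[OF phi']
  have "(LBINT x. u (x + a) * (grad \<phi> x \<bullet> b)) = (LBINT x. u (x + a) * (grad ?\<phi> (x + a) \<bullet> b))"
    by (simp only: grad_shift[OF phi]) simp
  also have "\<dots> = (LBINT x. u x * (grad ?\<phi> x \<bullet> b))"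
    by (rule integral_lborel_shift[where f = "\<lambda>x. u x * (grad ?\<phi> x \<bullet> b)"]) measurable
  also have "\<dots> = - (LBINT x. (g x \<bullet> b) * ?\<phi> x)"
    by (rule wgradD[OF w phi' b])
  also have "(LBINT x. (g x \<bullet> b) * ?\<phi> x) = (LBINT x. (g (x + a) \<bullet> b) * ?\<phi> (x + a))"
    by (rule integral_lborel_shift[where f = "\<lambda>x. (g x \<bullet> b) * ?\<phi> x", symmetric]) measurable
  also have "\<dots> = (LBINT x. (g (x + a) \<bullet> b) * \<phi> x)" by simp
  finally show "(LBINT x. u (x + a) * (grad \<phi> x \<bullet> b)) = - (LBINT x. (g (x + a) \<bullet> b) * \<phi> x)" .
qed

lemma wgrad_diff:
  assumes w: "wgrad u g" and w': "wgrad u' g'"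
  shows "wgrad (\<lambda>x. u x - u' x) (\<lambda>x. g x - g' x)"
  unfolding wgrad_def
proof (intro conjI ballI)
  note l = wgrad_loc_int(1)[OF w] wgrad_loc_int(2)[OF w] wgrad_loc_int(1)[OF w'] wgrad_loc_int(2)[OF w']
  show "loc_int (\<lambda>x. u x - u' x)"
    using loc_int_add[OF l(1) loc_int_scaleR[OF l(3), of "-1"]] by simp
  show "loc_int (\<lambda>x. g x - g' x)"
    using loc_int_add[OF l(2) loc_int_scaleR[OF l(4), of "-1"]] by simp
  fix \<phi> :: "'a \<Rightarrow> real" and b :: 'a assume phi: "\<phi> \<in> test_functions" and b: "b \<in> Basis"
  note i = integrable_test_mult[OF l(1) grad_component_test[OF phi b]]
    integrable_test_mult[OF l(3) grad_component_test[OF phi b]]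
    integrable_test_mult[OF loc_int_inner[OF l(2), of b] phi]
    integrable_test_mult[OF loc_int_inner[OF l(4), of b] phi]
  have "(LBINT x. (u x - u' x) * (grad \<phi> x \<bullet> b))
      = (LBINT x. u x * (grad \<phi> x \<bullet> b)) - (LBINT x. u' x * (grad \<phi> x \<bullet> b))"
    using Bochner_Integration.integral_diff[OF i(1,2)] by (simp add: algebra_simps)
  moreover have "(LBINT x. ((g x - g' x) \<bullet> b) * \<phi> x)
      = (LBINT x. (g x \<bullet> b) * \<phi> x) - (LBINT x. (g' x \<bullet> b) * \<phi> x)"
    using Bochner_Integration.integral_diff[OF i(3,4)] by (simp add: algebra_simps inner_diff_left)
  ultimately show "(LBINT x. (u x - u' x) * (grad \<phi> x \<bullet> b)) = - (LBINT x. ((g x - g' x) \<bullet> b) * \<phi> x)"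
    using wgradD[OF w phi b] wgradD[OF w' phi b] by simp
qed

lemma loc_int_mult_continuous:
  assumes "loc_int u" "continuous_on UNIV c" "\<And>x. norm (c x) \<le> B"
  shows "loc_int (\<lambda>x. u x *\<^sub>R c x)"
proof -
  have m [measurable]: "c \<in> borel_measurable borel"
    using assms(2) by (rule borel_measurable_continuous_onI)
  note [measurable] = loc_int_measurable[OF assms(1)]
  have "integrable lborel (\<lambda>x. cut R x *\<^sub>R (u x *\<^sub>R c x))" for R
  proof (rule Bochner_Integration.integrable_bound)
    show "integrable lborel (\<lambda>x. B * (cut R x *\<^sub>R u x))"
      by (intro integrable_mult_right loc_int_integrable assms(1))
    show "AE x in lborel. norm (cut R x *\<^sub>R (u x *\<^sub>R c x)) \<le> norm (B * (cut R x *\<^sub>R u x))"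
    proof (rule AE_I2)
      fix x show "norm (cut R x *\<^sub>R (u x *\<^sub>R c x)) \<le> norm (B * (cut R x *\<^sub>R u x))"
        using order_trans[OF assms(3)[of x] abs_ge_self[of B]] mult_right_mono[of "norm (c x)" "\<bar>B\<bar>" "\<bar>u x\<bar>"]
        by (auto simp: indicator_def abs_mult mult.commute)
    qed
  qed measurable
  then show ?thesis by (simp add: loc_int_def)
qed

text \<open>The definition of \<open>wgrad u g\<close> is applied to the test function \<phi>
  \<psi>; the product rule for smooth functions then isolates the term with
  \<open>grad \<phi>\<close>.\<close>

lemma wgrad_test_mult:
  assumes w: "wgrad u g" and psi: "\<psi> \<in> test_functions"
  shows "wgrad (\<lambda>x. \<psi> x * u x) (\<lambda>x. \<psi> x *\<^sub>R g x + u x *\<^sub>R grad \<psi> x)"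
  unfolding wgrad_def
proof (intro conjI ballI)
  note l = wgrad_loc_int(1)[OF w] wgrad_loc_int(2)[OF w]
  note [measurable] = test_functions_measurable[OF psi] grad_measurable[OF psi]
  obtain B where B: "\<And>x. \<bar>\<psi> x\<bar> \<le> B" using test_functions_bounded[OF psi] by blast
  obtain B' where B': "\<And>x. norm (grad \<psi> x) \<le> B'" using grad_bounded[OF psi] by blast
  show "loc_int (\<lambda>x. \<psi> x * u x)"
    using loc_int_mult[OF l(1) _ B] by simp
  show "loc_int (\<lambda>x. \<psi> x *\<^sub>R g x + u x *\<^sub>R grad \<psi> x)"
    by (intro loc_int_add loc_int_mult[OF l(2) _ B] loc_int_mult_continuous[OF l(1) grad_continuous[OF psi] B']) simp
  fix \<phi> :: "'a \<Rightarrow> real" and b :: 'a assume phi: "\<phi> \<in> test_functions" and b: "b \<in> Basis"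
  have pp: "(\<lambda>x. \<phi> x * \<psi> x) \<in> test_functions"
    by (rule test_functions_mult[OF phi test_functions_C_k[OF psi]])
  have pg: "(\<lambda>x. \<phi> x * (grad \<psi> x \<bullet> b)) \<in> test_functions"
    by (rule test_functions_mult[OF phi test_functions_C_k[OF grad_component_test[OF psi b]]])
  have gp: "(\<lambda>x. \<psi> x * (grad \<phi> x \<bullet> b)) \<in> test_functions"
    by (rule test_functions_mult[OF psi test_functions_C_k[OF grad_component_test[OF phi b]]])
  note i = integrable_test_mult[OF l(1) pg] integrable_test_mult[OF l(1) gp]
    integrable_test_mult[OF loc_int_inner[OF l(2), of b] pp]
  have "(LBINT x. u x * (grad (\<lambda>x. \<phi> x * \<psi> x) x \<bullet> b))
     = (LBINT x. \<psi> x * u x * (grad \<phi> x \<bullet> b)) + (LBINT x. u x * \<phi> x * (grad \<psi> x \<bullet> b))"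
    using Bochner_Integration.integral_add[OF i(1,2)]
    by (simp add: grad_mult[OF phi psi] inner_add_left algebra_simps)
  moreover have "(LBINT x. ((\<psi> x *\<^sub>R g x + u x *\<^sub>R grad \<psi> x) \<bullet> b) * \<phi> x)
     = (LBINT x. (g x \<bullet> b) * (\<phi> x * \<psi> x)) + (LBINT x. u x * \<phi> x * (grad \<psi> x \<bullet> b))"
    using Bochner_Integration.integral_add[OF i(3,1)]
    by (simp add: inner_add_left algebra_simps)
  ultimately show "(LBINT x. \<psi> x * u x * (grad \<phi> x \<bullet> b))
      = - (LBINT x. ((\<psi> x *\<^sub>R g x + u x *\<^sub>R grad \<psi> x) \<bullet> b) * \<phi> x)"
    using wgradD[OF w pp b] by simp
qed

section \<open>Continuity of translations\<close>

text \<open>Translation continuity survives L^1 limits: with error below e / 4, the two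
  approximation terms (equal by translation invariance) and the translation term of \<open>s\<close>
  add up to less than e.\<close>

lemma translation_L1_closure:
  fixes w :: "'a::euclidean_space \<Rightarrow> real"
  assumes w: "integrable lborel w"
    and approx: "\<And>e. e > 0 \<Longrightarrow> \<exists>s. integrable lborel s \<and> (LBINT x. \<bar>w x - s x\<bar>) < e \<and>
        ((\<lambda>y. \<integral>x. \<bar>s (x + y) - s x\<bar> \<partial>lborel) \<longlongrightarrow> 0) (at 0)"
  shows "((\<lambda>y. \<integral>x. \<bar>w (x + y) - w x\<bar> \<partial>lborel) \<longlongrightarrow> 0) (at 0)"
proof (rule order_tendstoI)
  fix e :: real assume "e < 0"
  then show "\<forall>\<^sub>F y in at 0. e < (LBINT x. \<bar>w (x + y) - w x\<bar>)"
    by (auto intro!: always_eventually intro: less_le_trans)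
next
  fix e :: real assume e: "0 < e"
  obtain s where s: "integrable lborel s" "(LBINT x. \<bar>w x - s x\<bar>) < e / 4"
    "((\<lambda>y. \<integral>x. \<bar>s (x + y) - s x\<bar> \<partial>lborel) \<longlongrightarrow> 0) (at 0)"
    using approx[of "e / 4"] e by auto
  have "\<forall>\<^sub>F y in at 0. (LBINT x. \<bar>s (x + y) - s x\<bar>) < e / 4"
    using order_tendstoD(2)[OF s(3), of "e / 4"] e by simp
  then show "\<forall>\<^sub>F y in at 0. (LBINT x. \<bar>w (x + y) - w x\<bar>) < e"
  proof eventually_elim
    case (elim y)
    note i = w s(1) integrable_lborel_shift[OF w, of y] integrable_lborel_shift[OF s(1), of y]
    have j: "integrable lborel (\<lambda>x. \<bar>w (x + y) - s (x + y)\<bar>)" "integrable lborel (\<lambda>x. \<bar>s (x + y) - s x\<bar>)"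
      "integrable lborel (\<lambda>x. \<bar>w x - s x\<bar>)" "integrable lborel (\<lambda>x. \<bar>w (x + y) - w x\<bar>)"
      using i by auto
    have "(LBINT x. \<bar>w (x + y) - w x\<bar>)
        \<le> (LBINT x. \<bar>w (x + y) - s (x + y)\<bar> + \<bar>s (x + y) - s x\<bar> + \<bar>w x - s x\<bar>)"
      by (rule integral_mono[OF j(4) Bochner_Integration.integrable_add[OF Bochner_Integration.integrable_add[OF j(1,2)] j(3)]]) auto
    also have "\<dots> = (LBINT x. \<bar>w (x + y) - s (x + y)\<bar>) + (LBINT x. \<bar>s (x + y) - s x\<bar>) + (LBINT x. \<bar>w x - s x\<bar>)"
      using j by simp
    also have "(LBINT x. \<bar>w (x + y) - s (x + y)\<bar>) = (LBINT x. \<bar>w x - s x\<bar>)"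
      using w s(1) by (intro integral_lborel_shift[where f = "\<lambda>x. \<bar>w x - s x\<bar>"]) simp
    finally show ?case using elim s(2) e by linarith
  qed
qed

text \<open>Pointwise convergence of the shifted indicator can fail at boundary points outside
  \<open>U\<close>. The positive part of \<open>indicat_real U x - indicat_real U (x + y)\<close>
  does tend to 0 everywhere, as \<open>U\<close> is open, and the negative part has the same
  integral because the two indicators have equal integrals.\<close>

lemma translation_L1_open:
  fixes U :: "'a::euclidean_space set"
  assumes U: "open U" "emeasure lborel U < \<infinity>"
  shows "((\<lambda>y. \<integral>x. \<bar>indicat_real U (x + y) - indicat_real U x\<bar> \<partial>lborel) \<longlongrightarrow> 0) (at 0)"
proof -
  have iU: "integrable lborel (indicat_real U)"
    using U by (simp add: integrable_indicator_iff)
  have [measurable]: "U \<in> sets borel" using U by simp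
  have eq: "(LBINT x. \<bar>indicat_real U (x + y) - indicat_real U x\<bar>)
      = 2 * (LBINT x. max 0 (indicat_real U x - indicat_real U (x + y)))" for y
  proof -
    note i = iU integrable_lborel_shift[OF iU, of y]
    have m: "integrable lborel (\<lambda>x. max 0 (indicat_real U x - indicat_real U (x + y)))"
      by (rule Bochner_Integration.integrable_bound[OF Bochner_Integration.integrable_diff[OF i]]) (auto intro!: AE_I2)
    have "(LBINT x. \<bar>indicat_real U (x + y) - indicat_real U x\<bar>)
      = (LBINT x. 2 * max 0 (indicat_real U x - indicat_real U (x + y)) + (indicat_real U (x + y) - indicat_real U x))"
      by (intro Bochner_Integration.integral_cong) (auto simp: indicator_def)
    also have "\<dots> = 2 * (LBINT x. max 0 (indicat_real U x - indicat_real U (x + y)))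
       + ((LBINT x. indicat_real U (x + y)) - (LBINT x. indicat_real U x))"
      using m i by simp
    also have "(LBINT x. indicat_real U (x + y)) = (LBINT x. indicat_real U x)"
      by (rule integral_lborel_shift) simp
    finally show ?thesis by simp
  qed
  have "((\<lambda>y. \<integral>x. max 0 (indicat_real U x - indicat_real U (x + y)) \<partial>lborel) \<longlongrightarrow> 0) (at 0)"
    unfolding tendsto_at_iff_sequentially
  proof (intro allI impI)
    fix X :: "nat \<Rightarrow> 'a" assume X: "X \<longlonglongrightarrow> 0"
    have "(\<lambda>n. \<integral>x. max 0 (indicat_real U x - indicat_real U (x + X n)) \<partial>lborel) \<longlonglongrightarrow> (\<integral>x. 0 \<partial>(lborel::'a measure))"
    proof (rule integral_dominated_convergence[where w = "indicat_real U"])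
      show "AE x in lborel. (\<lambda>n. max 0 (indicat_real U x - indicat_real U (x + X n))) \<longlonglongrightarrow> 0"
      proof (rule AE_I2)
        fix x :: 'a
        have "\<forall>\<^sub>F n in sequentially. max 0 (indicat_real U x - indicat_real U (x + X n)) = 0"
        proof (cases "x \<in> U")
          case True
          have "(\<lambda>n. x + X n) \<longlonglongrightarrow> x" using tendsto_add[OF tendsto_const X, of x] by simp
          then have "\<forall>\<^sub>F n in sequentially. x + X n \<in> U"
            using U(1) True by (rule topological_tendstoD)
          then show ?thesis by eventually_elim (use True in simp)
        qed simp
        then show "(\<lambda>n. max 0 (indicat_real U x - indicat_real U (x + X n))) \<longlonglongrightarrow> 0"
          by (rule tendsto_eventually)
      qed
    qed (use iU in \<open>auto intro!: AE_I2 simp: indicator_def\<close>)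
    then show "((\<lambda>y. \<integral>x. max 0 (indicat_real U x - indicat_real U (x + y)) \<partial>lborel) \<circ> X) \<longlonglongrightarrow> 0"
      by (simp add: o_def)
  qed
  from tendsto_mult[OF tendsto_const[of 2] this] show ?thesis by (simp add: eq)
qed

text \<open>Open sets come first; outer regularity passes to Borel sets of finite measure, sums to
  simple functions, and dominated convergence to all integrable functions.\<close>

theorem translation_continuous_L1:
  fixes w :: "'a::euclidean_space \<Rightarrow> real"
  assumes w: "integrable lborel w"
  shows "((\<lambda>y. \<integral>x. \<bar>w (x + y) - w x\<bar> \<partial>lborel) \<longlongrightarrow> 0) (at 0)"
  using w
proof (induct rule: integrable_induct)
  case (base A c)
  then have A [measurable]: "A \<in> sets borel" by simp
  have "((\<lambda>y. \<integral>x. \<bar>indicat_real A (x + y) - indicat_real A x\<bar> \<partial>lborel) \<longlongrightarrow> 0) (at 0)"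
  proof (rule translation_L1_closure)
    show "integrable lborel (indicat_real A)"
      using base by (simp add: integrable_indicator_iff)
    fix e :: real assume "e > 0"
    obtain U where U: "open U" "A \<subseteq> U" "emeasure lborel (U - A) < e"
      using outer_regular_lborel[OF A \<open>e > 0\<close>] .
    have "emeasure lborel U \<le> emeasure lborel (U - A) + emeasure lborel A"
      using emeasure_subadditive[of "U - A" lborel A] U by (simp add: Un_absorb2)
    also have "\<dots> < \<infinity>"
      using order.strict_trans[OF U(3), of \<infinity>] base by (simp add: less_top[symmetric])
    finally have fU: "emeasure lborel U < \<infinity>" .
    have "(LBINT x. \<bar>indicat_real A x - indicat_real U x\<bar>) = (LBINT x. indicat_real (U - A) x)"
      using U(2) by (intro Bochner_Integration.integral_cong) (auto simp: indicator_def)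
    also have "\<dots> = measure lborel (U - A)" by simp
    also have "\<dots> < e"
    proof -
      have "ennreal (measure lborel (U - A)) = emeasure lborel (U - A)"
        using order.strict_trans[OF U(3), of top] by (intro emeasure_eq_ennreal_measure[symmetric]) auto
      with U(3) show ?thesis by (metis ennreal_less_iff measure_nonneg)
    qed
    finally show "\<exists>s. integrable lborel s \<and> (LBINT x. \<bar>indicat_real A x - s x\<bar>) < e \<and>
        ((\<lambda>y. \<integral>x. \<bar>s (x + y) - s x\<bar> \<partial>lborel) \<longlongrightarrow> 0) (at 0)"
      using fU U(1) translation_L1_open[OF U(1) fU]
      by (intro exI[of _ "indicat_real U"]) (auto simp: integrable_indicator_iff)
  qed
  from tendsto_mult[OF this tendsto_const[of "\<bar>c\<bar>"]] show ?case
    by (simp add: left_diff_distrib[symmetric] abs_mult)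
next
  case (add f g)
  show ?case
  proof (rule tendsto_sandwich[OF _ _ tendsto_const])
    show "((\<lambda>y. (LBINT x. \<bar>f (x + y) - f x\<bar>) + (LBINT x. \<bar>g (x + y) - g x\<bar>)) \<longlongrightarrow> 0) (at 0)"
      using tendsto_add[OF add(2,4)] by simp
    show "\<forall>\<^sub>F y in at 0. (LBINT x. \<bar>f (x + y) + g (x + y) - (f x + g x)\<bar>)
       \<le> (LBINT x. \<bar>f (x + y) - f x\<bar>) + (LBINT x. \<bar>g (x + y) - g x\<bar>)"
    proof (intro always_eventually allI)
      fix y
      note i = add(1,3) integrable_lborel_shift[OF add(1), of y] integrable_lborel_shift[OF add(3), of y]
      show "(LBINT x. \<bar>f (x + y) + g (x + y) - (f x + g x)\<bar>)
       \<le> (LBINT x. \<bar>f (x + y) - f x\<bar>) + (LBINT x. \<bar>g (x + y) - g x\<bar>)"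
        using integral_mono[of lborel "\<lambda>x. \<bar>f (x + y) + g (x + y) - (f x + g x)\<bar>"
            "\<lambda>x. \<bar>f (x + y) - f x\<bar> + \<bar>g (x + y) - g x\<bar>"] i by simp
    qed
  qed auto
next
  case (lim f s)
  show ?case
  proof (rule translation_L1_closure[OF lim(5)])
    fix e :: real assume e: "e > 0"
    have "(\<lambda>i. \<integral>x. \<bar>f x - s i x\<bar> \<partial>lborel) \<longlonglongrightarrow> (\<integral>x. 0 \<partial>(lborel :: 'a measure))"
    proof (rule integral_dominated_convergence[where w = "\<lambda>x. 3 * \<bar>f x\<bar>"])
      show "AE x in lborel. (\<lambda>i. \<bar>f x - s i x\<bar>) \<longlonglongrightarrow> 0"
      proof (rule AE_I2)
        fix x :: 'a assume "x \<in> space lborel"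
        from tendsto_rabs[OF tendsto_diff[OF tendsto_const lim(3)[OF this], of "f x"]]
        show "(\<lambda>i. \<bar>f x - s i x\<bar>) \<longlonglongrightarrow> 0" by simp
      qed
      show "AE x in lborel. norm \<bar>f x - s i x\<bar> \<le> 3 * \<bar>f x\<bar>" for i
      proof (rule AE_I2)
        fix x :: 'a assume "x \<in> space lborel"
        from lim(4)[OF this, of i] show "norm \<bar>f x - s i x\<bar> \<le> 3 * \<bar>f x\<bar>" by simp
      qed
    qed (use lim in auto)
    then have "\<forall>\<^sub>F i in sequentially. (LBINT x. \<bar>f x - s i x\<bar>) < e"
      using e by (intro order_tendstoD(2)) auto
    then obtain i where "(LBINT x. \<bar>f x - s i x\<bar>) < e"
      by (auto simp: eventually_sequentially)
    with lim(1,2) show "\<exists>s. integrable lborel s \<and> (LBINT x. \<bar>f x - s x\<bar>) < e \<and>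
        ((\<lambda>y. \<integral>x. \<bar>s (x + y) - s x\<bar> \<partial>lborel) \<longlongrightarrow> 0) (at 0)"
      by blast
  qed
qed

section \<open>Power inequalities and translations in L^m\<close>

text \<open>Each summand satisfies z^m \<le> z (x + y)^(m - 1); the two bounds add up to the
  right-hand side.\<close>

lemma powr_superadditive:
  fixes x y m :: real
  assumes "x \<ge> 0" "y \<ge> 0" "m \<ge> 1"
  shows "x powr m + y powr m \<le> (x + y) powr m"
proof (cases "x + y = 0")
  case True
  then have "x = 0" "y = 0" using assms by linarith+
  then show ?thesis by simp
next
  case False
  then have s: "x + y > 0" using assms by linarith
  have *: "z powr m \<le> z * (x + y) powr (m - 1)" if "0 \<le> z" "z \<le> x + y" for z
  proof (cases "z = 0")
    case False
    then have "z powr m = z * z powr (m - 1)"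
      using that(1) powr_add[of z 1 "m - 1"] by simp
    also have "\<dots> \<le> z * (x + y) powr (m - 1)"
      using that assms by (intro mult_left_mono powr_mono2) auto
    finally show ?thesis .
  qed simp
  have "x powr m + y powr m \<le> x * (x + y) powr (m - 1) + y * (x + y) powr (m - 1)"
    using assms by (intro add_mono *) auto
  also have "\<dots> = (x + y) powr m"
    using s powr_add[of "x + y" 1 "m - 1"] by (simp add: algebra_simps)
  finally show ?thesis .
qed

lemma powr_add_le:
  fixes x y m :: real
  assumes "x \<ge> 0" "y \<ge> 0" "m \<ge> 0"
  shows "(x + y) powr m \<le> 2 powr m * (x powr m + y powr m)"
proof -
  have "(x + y) powr m \<le> (2 * max x y) powr m"
    using assms by (intro powr_mono2) auto
  also have "\<dots> = 2 powr m * (max x y) powr m"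
    using assms by (simp add: powr_mult)
  also have "\<dots> \<le> 2 powr m * (x powr m + y powr m)"
    by (intro mult_left_mono) (auto simp: max_def)
  finally show ?thesis .
qed

text \<open>This reduces L^m continuity of \<open>f\<close> to L^1 continuity of its signed m-th
  power. For equal signs superadditivity gives the bound with factor 1; the factor
  \<open>2 powr m\<close> covers opposite signs.\<close>

lemma powr_diff_le:
  fixes a b m :: real
  assumes "m \<ge> 1"
  shows "\<bar>a - b\<bar> powr m \<le> 2 powr m * \<bar>sgn a * \<bar>a\<bar> powr m - sgn b * \<bar>b\<bar> powr m\<bar>"
proof -
  have two: "1 \<le> 2 powr m" using assms by (simp add: ge_one_powr_ge_zero)
  have *: "(a - b) powr m \<le> 2 powr m * \<bar>a powr m - b powr m\<bar>" if "0 \<le> b" "b \<le> a" for a b :: real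
  proof -
    have "(a - b) powr m \<le> a powr m - b powr m"
      using powr_superadditive[of "a - b" b m] that assms by simp
    also have "\<dots> \<le> 1 * \<bar>a powr m - b powr m\<bar>" by simp
    also have "\<dots> \<le> 2 powr m * \<bar>a powr m - b powr m\<bar>"
      using two by (intro mult_right_mono) auto
    finally show ?thesis .
  qed
  consider "0 \<le> b" "b \<le> a" | "0 \<le> a" "a \<le> b" | "a \<le> 0" "b \<le> a" | "b \<le> 0" "a \<le> b"
    | "a < 0" "0 < b" | "b < 0" "0 < a" by linarith
  then show ?thesis
  proof cases
    case 1 with *[of b a] two show ?thesis by (simp add: sgn_if)
  next
    case 2 with *[of a b] two show ?thesis by (simp add: sgn_if abs_minus_commute)
  next
    case 3 with *[of "-a" "-b"] two show ?thesis by (auto simp: sgn_if abs_minus_commute)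
  next
    case 4 with *[of "-b" "-a"] two show ?thesis by (auto simp: sgn_if abs_minus_commute)
  next
    case 5
    have "\<bar>- ((-a) powr m) - b powr m\<bar> = (-a) powr m + b powr m"
      using powr_ge_zero[of "-a" m] powr_ge_zero[of b m] by linarith
    with 5 powr_add_le[of "-a" b m] assms show ?thesis by (simp add: sgn_if)
  next
    case 6
    have "\<bar>a powr m + (-b) powr m\<bar> = a powr m + (-b) powr m"
      using powr_ge_zero[of a m] powr_ge_zero[of "-b" m] by linarith
    with 6 powr_add_le[of a "-b" m] assms show ?thesis by (simp add: sgn_if)
  qed
qed

lemma translation_continuous_Lp:
  fixes f :: "'a::euclidean_space \<Rightarrow> real"
  assumes [measurable]: "f \<in> borel_measurable borel" and f: "integrable lborel (\<lambda>x. \<bar>f x\<bar> powr m)" and m: "m \<ge> 1"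
  shows "integrable lborel (\<lambda>x. \<bar>f (x + y) - f x\<bar> powr m)"
    and "((\<lambda>y. \<integral>x. \<bar>f (x + y) - f x\<bar> powr m \<partial>lborel) \<longlongrightarrow> 0) (at 0)"
proof -
  define w where "w x = sgn (f x) * \<bar>f x\<bar> powr m" for x
  have [measurable]: "w \<in> borel_measurable borel" unfolding w_def by measurable
  have w: "integrable lborel w"
    by (rule Bochner_Integration.integrable_bound[OF f]) (auto intro!: AE_I2 simp: w_def abs_mult sgn_if)
  note iw = integrable_mult_right[OF integrable_abs[OF Bochner_Integration.integrable_diff[OF integrable_lborel_shift[OF w] w]], of "2 powr m"]
  have le: "\<bar>f (x + y) - f x\<bar> powr m \<le> 2 powr m * \<bar>w (x + y) - w x\<bar>" for x y
    unfolding w_def by (rule powr_diff_le[OF m])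
  show int: "integrable lborel (\<lambda>x. \<bar>f (x + y) - f x\<bar> powr m)" for y
    by (rule Bochner_Integration.integrable_bound[OF iw[of y]]) (use le in \<open>auto intro!: AE_I2\<close>)
  show "((\<lambda>y. \<integral>x. \<bar>f (x + y) - f x\<bar> powr m \<partial>lborel) \<longlongrightarrow> 0) (at 0)"
  proof (rule tendsto_sandwich[OF _ _ tendsto_const])
    show "((\<lambda>y. 2 powr m * (LBINT x. \<bar>w (x + y) - w x\<bar>)) \<longlongrightarrow> 0) (at 0)"
      using tendsto_mult[OF tendsto_const[of "2 powr m"] translation_continuous_L1[OF w]] by simp
    show "\<forall>\<^sub>F y in at 0. (LBINT x. \<bar>f (x + y) - f x\<bar> powr m) \<le> 2 powr m * (LBINT x. \<bar>w (x + y) - w x\<bar>)"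
      using integral_mono[OF int iw le] by (intro always_eventually allI) simp
  qed auto
qed

lemma integrable_pair_strip:
  fixes F :: "real \<times> 'a::euclidean_space \<Rightarrow> real"
  assumes [measurable]: "F \<in> borel_measurable (lborel \<Otimes>\<^sub>M lborel)"
    and i: "\<And>s. s \<in> {0..1} \<Longrightarrow> integrable lborel (\<lambda>x. F (s, x))"
    and bd: "\<And>s. s \<in> {0..1} \<Longrightarrow> (LBINT x. \<bar>F (s, x)\<bar>) \<le> C"
    and z: "\<And>s x. s \<notin> {0..1} \<Longrightarrow> F (s, x) = 0"
  shows "integrable (lborel \<Otimes>\<^sub>M lborel) F"
proof (rule lborel_pair.Fubini_integrable)
  show "AE s in lborel. integrable lborel (\<lambda>x. F (s, x))"
  proof (rule AE_I2)
    fix s :: real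
    show "integrable lborel (\<lambda>x. F (s, x))"
      by (cases "s \<in> {0..1}") (simp_all add: i z)
  qed
  show "integrable lborel (\<lambda>s. \<integral>x. norm (F (s, x)) \<partial>lborel)"
  proof (rule Bochner_Integration.integrable_bound)
    show "integrable lborel (\<lambda>s. indicator {0..1::real} s * C)"
      by (intro integrable_mult_left integrable_real_indicator) auto
    show "AE s in lborel. norm (LBINT x. norm (F (s, x))) \<le> norm (indicator {0..1::real} s * C)"
    proof (rule AE_I2)
      fix s :: real
      show "norm (LBINT x. norm (F (s, x))) \<le> norm (indicator {0..1::real} s * C)"
      proof (cases "s \<in> {0..1}")
        case True
        have "0 \<le> (LBINT x. \<bar>F (s, x)\<bar>)" by (intro Bochner_Integration.integral_nonneg) auto
        with bd[OF True] True show ?thesis by simp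
      qed (simp add: z)
    qed
  qed measurable
qed measurable

section \<open>Difference quotients of weakly differentiable functions\<close>

abbreviation diff_quot :: "('a::euclidean_space \<Rightarrow> real) \<Rightarrow> 'a \<Rightarrow> real \<Rightarrow> 'a \<Rightarrow> real" where
  "diff_quot v b t x \<equiv> (v (x + t *\<^sub>R b) - v x) / t"

text \<open>The instances \<open>z = 0\<close> and \<open>y = 0\<close> justify Fubini before and
  after the shift is moved from one factor to the other. The majorant lives on radius
  \<open>R + norm z + norm y\<close> because \<open>s\<close> is at most 1, and translation
  invariance makes its integral independent of \<open>s\<close>.\<close>

lemma integrable_strip_shift:
  fixes g \<theta> :: "'a::euclidean_space \<Rightarrow> real"
  assumes g: "loc_int g" and [measurable]: "\<theta> \<in> borel_measurable borel"
    and bd: "\<And>x. \<bar>\<theta> x\<bar> \<le> B" and sp: "\<And>x. norm x > R \<Longrightarrow> \<theta> x = 0"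
  shows "integrable (lborel \<Otimes>\<^sub>M lborel)
    (\<lambda>(s, x). indicator {0..1::real} s * (\<theta> (x + s *\<^sub>R z) * g (x + s *\<^sub>R y)))"
proof -
  note [measurable] = loc_int_measurable[OF g]
  let ?w = "\<lambda>x. B * \<bar>cut (R + norm z + norm y) x *\<^sub>R g x\<bar>"
  have iw: "integrable lborel ?w"
    by (intro integrable_mult_right integrable_abs loc_int_integrable g)
  have B: "B \<ge> 0" using bd[of 0] by linarith
  have le: "\<bar>\<theta> (x + s *\<^sub>R z) * g (x + s *\<^sub>R y)\<bar> \<le> ?w (x + s *\<^sub>R y)" if s: "s \<in> {0..1}" for x s
  proof (cases "norm (x + s *\<^sub>R z) > R")
    case True
    then show ?thesis using B by (simp add: sp)
  next
    case False
    have "norm (s *\<^sub>R y) \<le> 1 * norm y" "norm (s *\<^sub>R z) \<le> 1 * norm z"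
      using s by (simp_all add: mult_left_le_one_le)
    then have "norm (x + s *\<^sub>R y) \<le> R + norm z + norm y"
      using False norm_triangle_ineq[of x "s *\<^sub>R y"] norm_triangle_ineq4[of "x + s *\<^sub>R z" "s *\<^sub>R z"] by simp
    then show ?thesis using bd[of "x + s *\<^sub>R z"] by (simp add: abs_mult mult_right_mono)
  qed
  have i: "integrable lborel (\<lambda>x. \<theta> (x + s *\<^sub>R z) * g (x + s *\<^sub>R y))" if "s \<in> {0..1}" for s
    by (rule Bochner_Integration.integrable_bound[OF integrable_lborel_shift[OF iw, of "s *\<^sub>R y"]])
      (use le[OF that] B in \<open>auto intro!: AE_I2\<close>)
  have "(LBINT x. \<bar>\<theta> (x + s *\<^sub>R z) * g (x + s *\<^sub>R y)\<bar>) \<le> (LBINT x. ?w x)" if s: "s \<in> {0..1}" for s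
    using integral_mono[OF integrable_abs[OF i[OF s]] integrable_lborel_shift[OF iw] le[OF s]]
    by (subst integral_lborel_shift[of ?w "s *\<^sub>R y", symmetric]) auto
  with i show ?thesis
    by (intro integrable_pair_strip[where C = "LBINT x. ?w x"]) auto
qed

lemmas integrable_strip_right = integrable_strip_shift[where z = 0, unfolded scaleR_zero_right add_0_right]
lemmas integrable_strip_left = integrable_strip_shift[where y = 0, unfolded scaleR_zero_right add_0_right]

lemma test_function_FTC:
  assumes phi: "\<phi> \<in> test_functions"
  shows "(LBINT s. indicator {0..1::real} s * (grad \<phi> (x + s *\<^sub>R y) \<bullet> y)) = \<phi> (x + y) - \<phi> x"
proof -
  have "(LBINT s. (grad \<phi> (x + s *\<^sub>R y) \<bullet> y) * indicator {0..1} s) = \<phi> (x + 1 *\<^sub>R y) - \<phi> (x + 0 *\<^sub>R y)"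
  proof (rule integral_FTC_Icc_real)
    fix s :: real
    have "((\<lambda>s. x + s *\<^sub>R y) has_derivative (\<lambda>h. h *\<^sub>R y)) (at s)"
      by (auto intro!: derivative_eq_intros)
    from has_derivative_compose[OF this test_functions_has_grad[OF phi]]
    show "((\<lambda>s. \<phi> (x + s *\<^sub>R y)) has_real_derivative grad \<phi> (x + s *\<^sub>R y) \<bullet> y) (at s)"
      by (simp add: has_field_derivative_def mult.commute[of _ "grad \<phi> _ \<bullet> y"] mult_commute_abs)
    have "isCont (grad \<phi>) (x + s *\<^sub>R y)"
      using grad_continuous[OF phi] by (simp add: continuous_on_eq_continuous_at)
    moreover have "isCont (\<lambda>s. x + s *\<^sub>R y) s" by (intro continuous_intros)
    ultimately have "isCont (\<lambda>s. grad \<phi> (x + s *\<^sub>R y)) s"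
      by (rule isCont_o2[rotated])
    then show "isCont (\<lambda>s. grad \<phi> (x + s *\<^sub>R y) \<bullet> y) s"
      by (intro continuous_intros)
  qed simp
  then show ?thesis by (simp add: mult.commute)
qed

text \<open>Tested against \<phi>, the right-hand side becomes by Fubini and the weak derivative an
  integral of the classical derivative of \<phi> along the segment, where the ordinary fundamental
  theorem applies. The exceptional set depends on \<open>t\<close>, which is harmless since only
  integrals in \<open>x\<close> at fixed \<open>t\<close> are formed.\<close>

theorem wgrad_FTC_AE:
  fixes v :: "'a::euclidean_space \<Rightarrow> real"
  assumes w: "wgrad v G" and b: "b \<in> Basis"
  shows "AE x in lborel. v (x + t *\<^sub>R b) - v x
     = t * (LBINT s. indicator {0..1::real} s * (G (x + s *\<^sub>R (t *\<^sub>R b)) \<bullet> b))"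
proof -
  define y where "y = t *\<^sub>R b"
  define I where "I x = (LBINT s. indicator {0..1::real} s * (G (x + s *\<^sub>R y) \<bullet> b))" for x
  define h where "h x = v (x + y) - v x - t * I x" for x
  note lv = wgrad_loc_int(1)[OF w] and lG = loc_int_inner[OF wgrad_loc_int(2)[OF w], of b]
  note [measurable] = loc_int_measurable[OF lv] loc_int_measurable[OF lG]
  have [measurable]: "I \<in> borel_measurable borel"
    unfolding I_def by measurable
  have lI: "loc_int I"
    unfolding loc_int_def
  proof (intro conjI allI)
    fix R
    have "integrable lborel (\<lambda>x. \<integral>s. indicator {0..1::real} s * (cut R x * (G (x + s *\<^sub>R y) \<bullet> b)) \<partial>lborel)"
      by (rule lborel_pair.integrable_snd[OF integrable_strip_right[OF lG, of _ 1 R]]) auto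
    then show "integrable lborel (\<lambda>x. cut R x *\<^sub>R I x)"
      by (simp add: I_def mult.left_commute flip: integral_mult_right_zero)
  qed measurable
  have "h = (\<lambda>x. v (x + y) + (-1) *\<^sub>R v x + (- t) *\<^sub>R I x)"
    by (rule ext) (simp add: h_def)
  then have lh: "loc_int h"
    using loc_int_add[OF loc_int_add[OF loc_int_shift[OF lv, of y] loc_int_scaleR[OF lv, of "-1"]]
        loc_int_scaleR[OF lI, of "-t"]] by (simp only:)
  have "AE x in lborel. h x = 0"
  proof (rule fundamental_lemma[OF lh])
    fix \<phi> :: "'a \<Rightarrow> real" assume phi: "\<phi> \<in> test_functions"
    note [measurable] = test_functions_measurable[OF phi] grad_measurable[OF phi]
    obtain R where R: "\<And>x. norm x \<ge> R \<Longrightarrow> \<phi> x = 0" "\<And>x. norm x \<ge> R \<Longrightarrow> grad \<phi> x = 0"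
      using grad_support[OF phi] by metis
    obtain B where B: "\<And>x. \<bar>\<phi> x\<bar> \<le> B" using test_functions_bounded[OF phi] by blast
    obtain B' where B': "\<And>x. \<bar>grad \<phi> x \<bullet> b\<bar> \<le> B'"
      using test_functions_bounded[OF grad_component_test[OF phi b]] by blast
    \<comment> \<open>Integration by parts at fixed \<open>s\<close>, with the test function shifted
      by \<open>- s y\<close> instead of \<open>G\<close> by \<open>s y\<close>.\<close>
    have shift_eq: "(LBINT x. \<phi> x * (G (x + s *\<^sub>R y) \<bullet> b)) = - (LBINT x. (grad \<phi> (x + s *\<^sub>R (- y)) \<bullet> b) * v x)" for s
    proof -
      let ?\<phi> = "\<lambda>x. \<phi> (x + s *\<^sub>R (-y))"
      have phi': "?\<phi> \<in> test_functions" by (rule test_functions_shift[OF phi])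
      have "(LBINT x. \<phi> x * (G (x + s *\<^sub>R y) \<bullet> b)) = (LBINT x. ?\<phi> (x + s *\<^sub>R y) * (G (x + s *\<^sub>R y) \<bullet> b))"
        by simp
      also have "\<dots> = (LBINT x. ?\<phi> x * (G x \<bullet> b))"
        by (rule integral_lborel_shift[where f = "\<lambda>x. ?\<phi> x * (G x \<bullet> b)"]) measurable
      also have "\<dots> = - (LBINT x. v x * (grad ?\<phi> x \<bullet> b))"
        using wgradD[OF w phi' b] by (simp add: mult.commute)
      finally show ?thesis unfolding grad_shift[OF phi] by (simp only: mult.commute)
    qed
    have "t * (LBINT x. \<phi> x * I x)
      = t * (LBINT x. (LBINT s. indicator {0..1::real} s * (\<phi> x * (G (x + s *\<^sub>R y) \<bullet> b))))"
      by (simp add: I_def mult.left_commute flip: integral_mult_right_zero)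
    also have "\<dots> = t * (LBINT s. (LBINT x. indicator {0..1::real} s * (\<phi> x * (G (x + s *\<^sub>R y) \<bullet> b))))"
      by (subst lborel_pair.Fubini_integral[OF integrable_strip_right[OF lG, of \<phi> B R]]) (use B R in auto)
    also have "\<dots> = - t * (LBINT s. (LBINT x. indicator {0..1::real} s * ((grad \<phi> (x + s *\<^sub>R (- y)) \<bullet> b) * v x)))"
      by (simp add: shift_eq)
    also have "\<dots> = - t * (LBINT x. (LBINT s. indicator {0..1::real} s * ((grad \<phi> (x + s *\<^sub>R (- y)) \<bullet> b) * v x)))"
      by (subst lborel_pair.Fubini_integral[OF integrable_strip_left[OF lv, of "\<lambda>x. grad \<phi> x \<bullet> b" B' R]])
        (use B' R in auto)
    also have "\<dots> = (LBINT x. (LBINT s. indicator {0..1::real} s * (grad \<phi> (x + s *\<^sub>R (- y)) \<bullet> (- y))) * v x)"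
      by (simp add: y_def ac_simps flip: integral_mult_right_zero integral_mult_left_zero)
    also have "\<dots> = (LBINT x. (\<phi> (x + (- y)) - \<phi> x) * v x)"
      by (simp only: test_function_FTC[OF phi])
    also have "\<dots> = (LBINT x. \<phi> (x + (- y)) *\<^sub>R v x) - (LBINT x. \<phi> x *\<^sub>R v x)"
      using Bochner_Integration.integral_diff[OF integrable_test_mult[OF lv test_functions_shift[OF phi, of "- y"]]
          integrable_test_mult[OF lv phi]] by (simp add: algebra_simps)
    also have "(LBINT x. \<phi> (x + (- y)) *\<^sub>R v x) = (LBINT x. \<phi> (x + y + (- y)) *\<^sub>R v (x + y))"
      by (rule integral_lborel_shift[where f = "\<lambda>x. \<phi> (x + (- y)) *\<^sub>R v x", symmetric]) measurable
    finally have eq: "t * (LBINT x. \<phi> x *\<^sub>R I x) = (LBINT x. \<phi> x *\<^sub>R v (x + y)) - (LBINT x. \<phi> x *\<^sub>R v x)"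
      by simp
    note i = integrable_test_mult[OF loc_int_shift[OF lv, of y] phi] integrable_test_mult[OF lv phi]
      integrable_test_mult[OF lI phi]
    have "(LBINT x. \<phi> x * h x) = (LBINT x. \<phi> x *\<^sub>R v (x + y) - \<phi> x *\<^sub>R v x - t * (\<phi> x *\<^sub>R I x))"
      by (simp add: h_def algebra_simps)
    also have "\<dots> = (LBINT x. \<phi> x *\<^sub>R v (x + y)) - (LBINT x. \<phi> x *\<^sub>R v x) - t * (LBINT x. \<phi> x *\<^sub>R I x)"
      using Bochner_Integration.integral_diff[OF Bochner_Integration.integrable_diff[OF i(1,2)] integrable_mult_right[OF i(3), of t]]
        Bochner_Integration.integral_diff[OF i(1,2)] by (simp only: integral_mult_right_zero)
    finally show "(LBINT x. \<phi> x * h x) = 0" using eq by simp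
  qed
  then show ?thesis
    by eventually_elim (simp add: h_def I_def y_def)
qed

section \<open>Jensen's inequality and integrals tending to zero\<close>

text \<open>The tangent line inequality for the m-th power at \<open>c\<close>, cleared of
  denominators. It serves both Jensen's inequality and the convexity of
  \<open>norm \<xi> powr m / m\<close>.\<close>

lemma Youngs_powr:
  fixes a c m :: real
  assumes "m > 1" "a \<ge> 0" "c \<ge> 0"
  shows "m * (c powr (m - 1) * a) \<le> a powr m + (m - 1) * c powr m"
proof -
  have q: "m / (m - 1) > 1" "1 / m + 1 / (m / (m - 1)) = 1"
    using assms(1) by (auto simp: field_simps)
  have "a * c powr (m - 1) \<le> a powr m / m + (c powr (m - 1)) powr (m / (m - 1)) / (m / (m - 1))"
    using Youngs_inequality[OF assms(1) q assms(2), of "c powr (m - 1)"] by simp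
  also have "(c powr (m - 1)) powr (m / (m - 1)) = c powr m"
    using assms(1) by (simp add: powr_powr)
  finally show ?thesis using assms(1) by (simp add: field_simps)
qed

text \<open>The inequality \<open>Youngs_powr\<close> is integrated with \<open>c\<close> the mean
  \<open>M\<close> of \<bar>k\<bar> over the unit interval. Stating it in \<open>ennreal\<close>
  covers an infinite right-hand side.\<close>

lemma Jensen_unit_interval:
  fixes k :: "real \<Rightarrow> real"
  assumes [measurable]: "k \<in> borel_measurable borel" and m: "m > 1"
  shows "ennreal (\<bar>\<integral>s. indicator {0..1} s * k s \<partial>lborel\<bar> powr m)
     \<le> (\<integral>\<^sup>+s. ennreal (indicator {0..1} s * \<bar>k s\<bar> powr m) \<partial>lborel)"
proof (cases "(\<integral>\<^sup>+s. ennreal (indicator {0..1} s * \<bar>k s\<bar> powr m) \<partial>lborel) = \<infinity>")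
  case True
  then show ?thesis by simp
next
  case False
  have ip: "integrable lborel (\<lambda>s. indicator {0..1} s * \<bar>k s\<bar> powr m)"
    using False by (intro integrableI_nonneg) (auto simp: less_top)
  have i1: "integrable lborel (indicat_real {0..1::real})" by simp
  have ik: "integrable lborel (\<lambda>s. indicator {0..1} s * k s)"
  proof (rule Bochner_Integration.integrable_bound[OF Bochner_Integration.integrable_add[OF i1 ip]])
    show "AE s in lborel. norm (indicator {0..1} s * k s) \<le> norm (indicat_real {0..1} s + indicator {0..1} s * \<bar>k s\<bar> powr m)"
    proof (rule AE_I2)
      fix s
      have "\<bar>k s\<bar> \<le> 1 + \<bar>k s\<bar> powr m"
      proof (cases "\<bar>k s\<bar> \<le> 1")
        case False
        then have "\<bar>k s\<bar> powr 1 \<le> \<bar>k s\<bar> powr m" using m by (intro powr_mono) auto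
        then show ?thesis using False by simp
      qed (simp add: add_increasing2)
      then show "norm (indicator {0..1} s * k s) \<le> norm (indicat_real {0..1} s + indicator {0..1} s * \<bar>k s\<bar> powr m)"
        by (simp add: indicator_def)
    qed
  qed measurable
  define M where "M = (LBINT s. \<bar>indicator {0..1} s * k s\<bar>)"
  have M0: "M \<ge> 0" unfolding M_def by (intro Bochner_Integration.integral_nonneg) auto
  have "m * (M powr (m - 1) * M) = (LBINT s. m * (M powr (m - 1) * \<bar>indicator {0..1} s * k s\<bar>))"
    by (simp add: M_def)
  also have "\<dots> \<le> (LBINT s. indicator {0..1} s * \<bar>k s\<bar> powr m + (m - 1) * M powr m * indicat_real {0..1} s)"
  proof (rule integral_mono)
    show "integrable lborel (\<lambda>s. m * (M powr (m - 1) * \<bar>indicator {0..1} s * k s\<bar>))"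
      using ik by simp
    show "integrable lborel (\<lambda>s. indicator {0..1} s * \<bar>k s\<bar> powr m + (m - 1) * M powr m * indicat_real {0..1} s)"
      using ip i1 by simp
    show "m * (M powr (m - 1) * \<bar>indicator {0..1} s * k s\<bar>) \<le> indicator {0..1} s * \<bar>k s\<bar> powr m + (m - 1) * M powr m * indicat_real {0..1} s" for s
      using Youngs_powr[OF m abs_ge_zero M0, of "k s"] by (simp add: indicator_def)
  qed
  also have "\<dots> = (LBINT s. indicator {0..1} s * \<bar>k s\<bar> powr m) + (m - 1) * M powr m"
    using ip i1 by simp
  finally have main: "m * (M powr (m - 1) * M) \<le> (LBINT s. indicator {0..1} s * \<bar>k s\<bar> powr m) + (m - 1) * M powr m" .
  have "M powr (m - 1) * M = M powr m"
    using M0 powr_add[of M "m - 1" 1] m by (cases "M = 0") auto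
  with main have le: "M powr m \<le> (LBINT s. indicator {0..1} s * \<bar>k s\<bar> powr m)"
    by (simp only:) (simp add: left_diff_distrib)
  have "\<bar>\<integral>s. indicator {0..1} s * k s \<partial>lborel\<bar> \<le> M"
    unfolding M_def by (rule integral_abs_bound)
  then have "\<bar>\<integral>s. indicator {0..1} s * k s \<partial>lborel\<bar> powr m \<le> M powr m"
    using m by (intro powr_mono2) auto
  with le have "\<bar>\<integral>s. indicator {0..1} s * k s \<partial>lborel\<bar> powr m \<le> (LBINT s. indicator {0..1} s * \<bar>k s\<bar> powr m)"
    by linarith
  then show ?thesis
    using nn_integral_eq_integral[OF ip] by (simp add: ennreal_leI)
qed

lemma ennreal_tendsto_0I:
  fixes f :: "'b \<Rightarrow> ennreal"
  assumes "\<And>e::real. e > 0 \<Longrightarrow> \<forall>\<^sub>F t in F. f t \<le> ennreal e"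
  shows "(f \<longlongrightarrow> 0) F"
proof (rule order_tendstoI)
  fix e :: ennreal assume "0 < e"
  then obtain d where d: "0 < d" "d < e" using dense by blast
  then have "d < top" by (rule_tac order.strict_trans2) auto
  then obtain r where r: "d = ennreal r" "r > 0"
    using d(1) by (cases d) (auto simp: ennreal_less_zero_iff)
  from assms[OF r(2)] show "\<forall>\<^sub>F t in F. f t < e"
    by eventually_elim (use d(2) r(1) in simp)
qed auto

lemma ennreal_tendsto_0D:
  fixes f :: "'b \<Rightarrow> ennreal"
  assumes "(f \<longlongrightarrow> 0) F" "e > 0"
  shows "\<forall>\<^sub>F t in F. f t \<le> ennreal e"
  using order_tendstoD(2)[OF assms(1), of "ennreal e"] assms(2)
  by (auto elim: eventually_mono)

lemma tendsto_integral_0: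
  fixes f :: "'b \<Rightarrow> 'a::euclidean_space \<Rightarrow> real"
  assumes "((\<lambda>t. \<integral>\<^sup>+x. ennreal \<bar>f t x\<bar> \<partial>lborel) \<longlongrightarrow> 0) F"
  shows "((\<lambda>t. \<integral>x. f t x \<partial>lborel) \<longlongrightarrow> 0) F"
proof (rule tendstoI)
  fix e :: real assume e: "e > 0"
  from ennreal_tendsto_0D[OF assms, of "e / 2"] e
  have "\<forall>\<^sub>F t in F. (\<integral>\<^sup>+x. ennreal \<bar>f t x\<bar> \<partial>lborel) \<le> ennreal (e / 2)" by simp
  then show "\<forall>\<^sub>F t in F. dist (LBINT x. f t x) 0 < e"
  proof eventually_elim
    case (elim t)
    have "\<bar>\<integral>x. f t x \<partial>lborel\<bar> \<le> e / 2"
    proof (cases "integrable lborel (f t)")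
      case True
      have "ennreal \<bar>\<integral>x. f t x \<partial>lborel\<bar> \<le> (\<integral>\<^sup>+x. ennreal \<bar>f t x\<bar> \<partial>lborel)"
        using integral_norm_bound_ennreal[OF True] by simp
      also note elim
      finally show ?thesis using e by (simp add: ennreal_le_iff)
    next
      \<comment> \<open>The Bochner integral of a non-integrable function is 0 by convention, so no
        integrability has to be assumed.\<close>
      case False
      then show ?thesis using e by (simp add: not_integrable_integral_eq)
    qed
    then show ?case using e by simp
  qed
qed

lemma tendsto_0_nn_integral_mono:
  fixes f :: "'b \<Rightarrow> 'a::euclidean_space \<Rightarrow> real" and g :: "'i \<Rightarrow> 'b \<Rightarrow> 'a \<Rightarrow> real"
  assumes lim: "\<And>i. i \<in> I \<Longrightarrow> ((\<lambda>t. \<integral>\<^sup>+x. ennreal \<bar>g i t x\<bar> \<partial>lborel) \<longlongrightarrow> 0) F"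
    and C: "C \<ge> 0" and I: "finite I"
    and le: "\<And>t x. \<bar>f t x\<bar> \<le> C * (\<Sum>i\<in>I. \<bar>g i t x\<bar>)"
    and [measurable]: "\<And>i t. i \<in> I \<Longrightarrow> g i t \<in> borel_measurable borel"
  shows "((\<lambda>t. \<integral>\<^sup>+x. ennreal \<bar>f t x\<bar> \<partial>lborel) \<longlongrightarrow> 0) F"
proof (rule tendsto_sandwich[OF _ _ tendsto_const])
  have "(\<integral>\<^sup>+x. ennreal \<bar>f t x\<bar> \<partial>lborel) \<le> ennreal C * (\<Sum>i\<in>I. \<integral>\<^sup>+x. ennreal \<bar>g i t x\<bar> \<partial>lborel)" for t
  proof -
    have "(\<integral>\<^sup>+x. ennreal \<bar>f t x\<bar> \<partial>lborel) \<le> (\<integral>\<^sup>+x. ennreal C * (\<Sum>i\<in>I. ennreal \<bar>g i t x\<bar>) \<partial>lborel)"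
      using le[of t] C by (intro nn_integral_mono) (simp add: ennreal_mult'[symmetric] sum_nonneg ennreal_leI)
    also have "\<dots> = ennreal C * (\<Sum>i\<in>I. \<integral>\<^sup>+x. ennreal \<bar>g i t x\<bar> \<partial>lborel)"
      by (simp add: nn_integral_cmult nn_integral_sum del: sum_ennreal)
    finally show ?thesis .
  qed
  then show "\<forall>\<^sub>F t in F. (\<integral>\<^sup>+x. ennreal \<bar>f t x\<bar> \<partial>lborel) \<le> ennreal C * (\<Sum>i\<in>I. \<integral>\<^sup>+x. ennreal \<bar>g i t x\<bar> \<partial>lborel)"
    by (intro always_eventually allI)
  have "((\<lambda>t. \<Sum>i\<in>I. \<integral>\<^sup>+x. ennreal \<bar>g i t x\<bar> \<partial>lborel) \<longlongrightarrow> (\<Sum>i\<in>I. 0)) F"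
    by (intro tendsto_sum lim)
  from ennreal_tendsto_cmult[OF _ this, of "ennreal C"]
  show "((\<lambda>t. ennreal C * (\<Sum>i\<in>I. \<integral>\<^sup>+x. ennreal \<bar>g i t x\<bar> \<partial>lborel)) \<longlongrightarrow> 0) F" by simp
qed auto

section \<open>Local L^m spaces and convergence of difference quotients in them\<close>

definition Lp_loc :: "real \<Rightarrow> ('a::euclidean_space \<Rightarrow> real) \<Rightarrow> bool" where
  "Lp_loc m f \<longleftrightarrow> f \<in> borel_measurable borel \<and>
     (\<forall>R. integrable lborel (\<lambda>x. cut R x * \<bar>f x\<bar> powr m))"

lemma Lp_loc_measurable [measurable_dest]: "Lp_loc m f \<Longrightarrow> f \<in> borel_measurable borel"
  by (simp add: Lp_loc_def)

lemma Lp_loc_integrable: "Lp_loc m f \<Longrightarrow> integrable lborel (\<lambda>x. \<bar>cut R x * f x\<bar> powr m)"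
proof -
  assume "Lp_loc m f"
  moreover have "(\<lambda>x. \<bar>cut R x * f x\<bar> powr m) = (\<lambda>x. cut R x * \<bar>f x\<bar> powr m)"
    by (auto simp: indicator_def fun_eq_iff)
  ultimately show ?thesis by (simp only: Lp_loc_def)
qed

lemma Lp_locI:
  assumes "f \<in> borel_measurable borel" "integrable lborel (\<lambda>x. \<bar>f x\<bar> powr m)"
  shows "Lp_loc m f"
  unfolding Lp_loc_def
proof (intro conjI allI)
  fix R show "integrable lborel (\<lambda>x. cut R x * \<bar>f x\<bar> powr m)"
    by (rule Bochner_Integration.integrable_bound[OF assms(2)])
      (use assms(1) in \<open>auto intro!: AE_I2 simp: indicator_def\<close>)
qed fact

text \<open>Constants are integrable over balls, so a pointwise growth bound transfers local
  integrability between different exponents.\<close>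

lemma Lp_loc_bound:
  assumes f: "Lp_loc m f" and [measurable]: "h \<in> borel_measurable borel"
    and le: "\<And>x. \<bar>h x\<bar> powr m' \<le> C * (1 + \<bar>f x\<bar> powr m)" and C: "C \<ge> 0"
  shows "Lp_loc m' h"
  unfolding Lp_loc_def
proof (intro conjI allI)
  fix R
  note [measurable] = Lp_loc_measurable[OF f]
  have i1: "integrable lborel (indicat_real (cball 0 R))"
    using emeasure_bounded_finite[OF bounded_cball] by (intro integrable_real_indicator) auto
  have "integrable lborel (\<lambda>x. cut R x * \<bar>f x\<bar> powr m)"
    using f by (simp add: Lp_loc_def)
  from integrable_mult_right[OF Bochner_Integration.integrable_add[OF i1 this], of C]
  show "integrable lborel (\<lambda>x. cut R x * \<bar>h x\<bar> powr m')"
  proof (rule Bochner_Integration.integrable_bound)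
    show "AE x in lborel. norm (cut R x * \<bar>h x\<bar> powr m')
      \<le> norm (C * (indicat_real (cball 0 R) x + cut R x * \<bar>f x\<bar> powr m))"
      using le C by (auto intro!: AE_I2 simp: indicator_def)
  qed measurable
qed fact

lemma Lp_loc_bounded:
  assumes [measurable]: "h \<in> borel_measurable borel" and le: "\<And>x. \<bar>h x\<bar> \<le> K" and m: "m \<ge> 0"
  shows "Lp_loc m h"
proof -
  have "\<bar>h x\<bar> powr m \<le> K powr m" for x
    using le m by (intro powr_mono2) auto
  then have *: "\<bar>h x\<bar> powr m \<le> K powr m * (1 + \<bar>0\<bar> powr m)" for x by simp
  have "Lp_loc m (\<lambda>x::'a. 0)" unfolding Lp_loc_def by simp
  then show ?thesis
    by (rule Lp_loc_bound[OF _ _ *]) auto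
qed

lemma Lp_loc_bounded_mult:
  assumes f: "Lp_loc m f" and [measurable]: "h \<in> borel_measurable borel" and le: "\<And>x. \<bar>h x\<bar> \<le> K" and m: "m \<ge> 0"
  shows "Lp_loc m (\<lambda>x. h x * f x)"
proof (rule Lp_loc_bound[OF f])
  note [measurable] = Lp_loc_measurable[OF f]
  show "(\<lambda>x. h x * f x) \<in> borel_measurable borel" by measurable
  show "\<bar>h x * f x\<bar> powr m \<le> K powr m * (1 + \<bar>f x\<bar> powr m)" for x
  proof -
    have "\<bar>h x * f x\<bar> powr m = \<bar>h x\<bar> powr m * \<bar>f x\<bar> powr m" by (simp add: abs_mult powr_mult)
    also have "\<dots> \<le> K powr m * (1 + \<bar>f x\<bar> powr m)"
      using le m by (intro mult_mono powr_mono2) auto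
    finally show ?thesis .
  qed
qed simp

lemma translation_Lp_loc:
  assumes B: "Lp_loc m B" and m: "m \<ge> 1" and b: "norm b = 1"
  shows "((\<lambda>t. \<integral>\<^sup>+x. ennreal (\<bar>cut R x * (B (x + t *\<^sub>R b) - B x)\<bar> powr m) \<partial>lborel) \<longlongrightarrow> 0) (at (0::real))"
proof (rule ennreal_tendsto_0I)
  fix e :: real assume e: "e > 0"
  note [measurable] = Lp_loc_measurable[OF B]
  \<comment> \<open>For \<bar>t\<bar> < 1 a shift by \<open>t b\<close> leads from radius
    \<open>R\<close> to radius at most \<open>R + 1\<close>, where \<open>B'\<close> still agrees
    with \<open>B\<close>.\<close>
  define B' where "B' x = cut (R + 1) x * B x" for x
  have [measurable]: "B' \<in> borel_measurable borel" unfolding B'_def by measurable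
  have iB: "integrable lborel (\<lambda>x. \<bar>B' x\<bar> powr m)"
    unfolding B'_def by (rule Lp_loc_integrable[OF B])
  note tr = translation_continuous_Lp[OF _ iB m]
  have "\<forall>\<^sub>F y in at 0. (LBINT x. \<bar>B' (x + y) - B' x\<bar> powr m) < e"
    using order_tendstoD(2)[OF tr(2) e] by simp
  then obtain d where d: "d > 0" "\<And>y. y \<noteq> 0 \<Longrightarrow> norm y < d \<Longrightarrow> (LBINT x. \<bar>B' (x + y) - B' x\<bar> powr m) < e"
    by (auto simp: eventually_at dist_norm)
  have "(\<integral>\<^sup>+x. ennreal (\<bar>cut R x * (B (x + t *\<^sub>R b) - B x)\<bar> powr m) \<partial>lborel) \<le> ennreal e"
    if t: "t \<noteq> 0" "\<bar>t\<bar> < min d 1" for t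
  proof -
    have "(\<integral>\<^sup>+x. ennreal (\<bar>cut R x * (B (x + t *\<^sub>R b) - B x)\<bar> powr m) \<partial>lborel)
      \<le> (\<integral>\<^sup>+x. ennreal (\<bar>B' (x + t *\<^sub>R b) - B' x\<bar> powr m) \<partial>lborel)"
    proof (intro nn_integral_mono ennreal_leI)
      fix x
      have "norm (x + t *\<^sub>R b) \<le> norm x + 1"
        using norm_triangle_ineq[of x "t *\<^sub>R b"] t b by simp
      then show "\<bar>cut R x * (B (x + t *\<^sub>R b) - B x)\<bar> powr m \<le> \<bar>B' (x + t *\<^sub>R b) - B' x\<bar> powr m"
        by (cases "norm x \<le> R") (auto simp: B'_def)
    qed
    also have "\<dots> = ennreal (LBINT x. \<bar>B' (x + t *\<^sub>R b) - B' x\<bar> powr m)"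
      by (intro nn_integral_eq_integral tr(1)) auto
    also have "\<dots> \<le> ennreal e"
    proof -
      have "norm (t *\<^sub>R b) = \<bar>t\<bar>" "b \<noteq> 0" using b by auto
      then show ?thesis using d(2)[of "t *\<^sub>R b"] t by (intro ennreal_leI less_imp_le) auto
    qed
    finally show ?thesis .
  qed
  then show "\<forall>\<^sub>F t in at (0::real). (\<integral>\<^sup>+x. ennreal (\<bar>cut R x * (B (x + t *\<^sub>R b) - B x)\<bar> powr m) \<partial>lborel) \<le> ennreal e"
    unfolding eventually_at using d(1) by (intro exI[of _ "min d 1"]) auto
qed

text \<open>By \<open>wgrad_FTC_AE\<close> the error is the average over \<open>s\<close> in [0, 1]
  of \<open>g (x + s t b) - g x\<close>. Jensen and Fubini bound its m-th power integral by an
  average of translation errors of \<open>g\<close>, each at most \<open>e\<close> for small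
  \<open>t\<close>.\<close>

theorem difference_quotient_Lp_loc:
  assumes w: "wgrad v G" and b: "b \<in> Basis" and m: "m > 1" and G: "Lp_loc m (\<lambda>x. G x \<bullet> b)"
  shows "((\<lambda>t. \<integral>\<^sup>+x. ennreal (\<bar>cut R x * (diff_quot v b t x - G x \<bullet> b)\<bar> powr m) \<partial>lborel) \<longlongrightarrow> 0) (at (0::real))"
proof (rule ennreal_tendsto_0I)
  fix e :: real assume e: "e > 0"
  define g where "g x = G x \<bullet> b" for x
  note lg = loc_int_inner[OF wgrad_loc_int(2)[OF w], of b]
  note [measurable] = Lp_loc_measurable[OF G] loc_int_measurable[OF wgrad_loc_int(1)[OF w]]
  have [measurable]: "g \<in> borel_measurable borel" unfolding g_def by measurable
  define g' where "g' x = cut (R + 1) x * g x" for x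
  have [measurable]: "g' \<in> borel_measurable borel" unfolding g'_def by measurable
  have iB: "integrable lborel (\<lambda>x. \<bar>g' x\<bar> powr m)"
    unfolding g'_def g_def by (rule Lp_loc_integrable[OF G])
  note tr = translation_continuous_Lp[OF _ iB less_imp_le[OF m]]
  have "\<forall>\<^sub>F y in at 0. (LBINT x. \<bar>g' (x + y) - g' x\<bar> powr m) < e"
    using order_tendstoD(2)[OF tr(2) e] by simp
  then obtain d where d: "d > 0" "\<And>y. y \<noteq> 0 \<Longrightarrow> norm y < d \<Longrightarrow> (LBINT x. \<bar>g' (x + y) - g' x\<bar> powr m) < e"
    by (auto simp: eventually_at dist_norm)
  have "(\<integral>\<^sup>+x. ennreal (\<bar>cut R x * (diff_quot v b t x - G x \<bullet> b)\<bar> powr m) \<partial>lborel) \<le> ennreal e"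
    if t: "t \<noteq> 0" "\<bar>t\<bar> < min d 1" for t
  proof -
    define y where "y = t *\<^sub>R b"
    have y: "norm y < d" "norm y < 1" "y \<noteq> 0" using t b by (auto simp: y_def)
    have "AE x in lborel. integrable lborel (\<lambda>s. indicator {0..1::real} s * (cut R x * (G (x + s *\<^sub>R y) \<bullet> b)))"
      by (rule lborel_pair.AE_integrable_snd[OF integrable_strip_right[OF lg, of _ 1 R]]) auto
    then have "AE x in lborel. ennreal (\<bar>cut R x * (diff_quot v b t x - G x \<bullet> b)\<bar> powr m)
       \<le> (\<integral>\<^sup>+s. ennreal (indicator {0..1::real} s * \<bar>g' (x + s *\<^sub>R y) - g' x\<bar> powr m) \<partial>lborel)"
      using wgrad_FTC_AE[OF w b, of t]
    proof eventually_elim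
      case (elim x)
      show ?case
      proof (cases "norm x \<le> R")
        case False
        then show ?thesis by simp
      next
        case True
        have g': "g' (x + s *\<^sub>R y) = G (x + s *\<^sub>R y) \<bullet> b" "g' x = G x \<bullet> b" if "s \<in> {0..1}" for s
        proof -
          have "norm (s *\<^sub>R y) \<le> 1 * norm y" using that by (simp add: mult_left_le_one_le)
          then have "norm (x + s *\<^sub>R y) \<le> R + 1"
            using norm_triangle_ineq[of x "s *\<^sub>R y"] y True by linarith
          then show "g' (x + s *\<^sub>R y) = G (x + s *\<^sub>R y) \<bullet> b" "g' x = G x \<bullet> b"
            using True by (auto simp: g'_def g_def)
        qed
        have i1: "integrable lborel (\<lambda>s. indicator {0..1::real} s * (G (x + s *\<^sub>R y) \<bullet> b))"
          using elim(1) True by simp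
        have i2: "integrable lborel (\<lambda>s. indicator {0..1::real} s * (G x \<bullet> b))"
          by (intro integrable_mult_left) simp
        have "diff_quot v b t x - G x \<bullet> b
          = (LBINT s. indicator {0..1::real} s * (G (x + s *\<^sub>R y) \<bullet> b)) - (LBINT s. indicator {0..1::real} s * (G x \<bullet> b))"
          using elim(2) t by (simp add: y_def)
        also have "\<dots> = (LBINT s. indicator {0..1::real} s * (G (x + s *\<^sub>R y) \<bullet> b) - indicator {0..1::real} s * (G x \<bullet> b))"
          by (rule Bochner_Integration.integral_diff[OF i1 i2, symmetric])
        also have "\<dots> = (LBINT s. indicator {0..1::real} s * (g' (x + s *\<^sub>R y) - g' x))"
          using g' by (intro Bochner_Integration.integral_cong) (auto simp: indicator_def)
        finally show ?thesis
          using Jensen_unit_interval[OF _ m, of "\<lambda>s. g' (x + s *\<^sub>R y) - g' x"] True by simp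
      qed
    qed
    then have "(\<integral>\<^sup>+x. ennreal (\<bar>cut R x * (diff_quot v b t x - G x \<bullet> b)\<bar> powr m) \<partial>lborel)
      \<le> (\<integral>\<^sup>+x. (\<integral>\<^sup>+s. ennreal (indicator {0..1::real} s * \<bar>g' (x + s *\<^sub>R y) - g' x\<bar> powr m) \<partial>lborel) \<partial>lborel)"
      by (rule nn_integral_mono_AE)
    also have "\<dots> = (\<integral>\<^sup>+s. (\<integral>\<^sup>+x. ennreal (indicator {0..1::real} s * \<bar>g' (x + s *\<^sub>R y) - g' x\<bar> powr m) \<partial>lborel) \<partial>lborel)"
      by (rule lborel_pair.Fubini') measurable
    also have "\<dots> \<le> (\<integral>\<^sup>+s. ennreal e * indicator {0..1::real} s \<partial>lborel)"
    proof (rule nn_integral_mono)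
      fix s :: real
      show "(\<integral>\<^sup>+x. ennreal (indicator {0..1::real} s * \<bar>g' (x + s *\<^sub>R y) - g' x\<bar> powr m) \<partial>lborel) \<le> ennreal e * indicator {0..1::real} s"
      proof (cases "s \<in> {0..1}")
        case True
        have "(\<integral>\<^sup>+x. ennreal (\<bar>g' (x + s *\<^sub>R y) - g' x\<bar> powr m) \<partial>lborel) = ennreal (LBINT x. \<bar>g' (x + s *\<^sub>R y) - g' x\<bar> powr m)"
          by (intro nn_integral_eq_integral tr(1)) auto
        also have "\<dots> \<le> ennreal e"
        \<comment> \<open>The choice of \<open>d\<close> speaks of nonzero shifts only; for
          \<open>s = 0\<close> the integrand vanishes.\<close>
        proof (cases "s = 0")
          case False
          have "norm (s *\<^sub>R y) \<le> 1 * norm y" using True by (simp add: mult_left_le_one_le)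
          then have "norm (s *\<^sub>R y) < d" using y by linarith
          moreover have "s *\<^sub>R y \<noteq> 0" using False y by simp
          ultimately show ?thesis using d(2)[of "s *\<^sub>R y"] by (intro ennreal_leI) simp
        qed simp
        finally show ?thesis using True by simp
      qed simp
    qed
    also have "\<dots> = ennreal e" by (simp add: nn_integral_cmult)
    finally show ?thesis .
  qed
  then show "\<forall>\<^sub>F t in at (0::real). (\<integral>\<^sup>+x. ennreal (\<bar>cut R x * (diff_quot v b t x - G x \<bullet> b)\<bar> powr m) \<partial>lborel) \<le> ennreal e"
    unfolding eventually_at using d(1) by (intro exI[of _ "min d 1"]) auto
qed

text \<open>The factors \<open>1 / m\<close> and \<open>1 / m'\<close> are bounded by 1. The free
  scale \<delta> lets this inequality do the work of Hoelder's in
  \<open>tendsto_pairing\<close>.\<close>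

lemma Young_scaled:
  fixes a c m m' :: real
  assumes "m > 1" "m' > 1" "1 / m + 1 / m' = 1" "\<delta> > 0"
  shows "\<bar>a * c\<bar> \<le> (1 / \<delta>) powr m * \<bar>a\<bar> powr m + \<delta> powr m' * \<bar>c\<bar> powr m'"
proof -
  have "\<bar>a * c\<bar> = (\<bar>a\<bar> / \<delta>) * (\<delta> * \<bar>c\<bar>)" using assms(4) by (simp add: abs_mult)
  also have "\<dots> \<le> (\<bar>a\<bar> / \<delta>) powr m / m + (\<delta> * \<bar>c\<bar>) powr m' / m'"
    using assms by (intro Youngs_inequality) auto
  also have "\<dots> \<le> (\<bar>a\<bar> / \<delta>) powr m / 1 + (\<delta> * \<bar>c\<bar>) powr m' / 1"
    using assms by (intro add_mono divide_left_mono) auto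
  also have "\<dots> = (1 / \<delta>) powr m * \<bar>a\<bar> powr m + \<delta> powr m' * \<bar>c\<bar> powr m'"
    using assms by (simp add: powr_mult powr_divide)
  finally show ?thesis .
qed

text \<open>A family vanishing in L^m is paired with one bounded in the dual exponent. First
  \<delta> makes the bounded factor contribute at most e / 2, then the vanishing factor is taken
  small relative to that \<delta>. Nonnegative integrals avoid integrability conditions.\<close>

lemma tendsto_pairing:
  fixes a c :: "'b \<Rightarrow> 'a::euclidean_space \<Rightarrow> real"
  assumes m: "m > 1" "m' > 1" "1 / m + 1 / m' = 1"
    and [measurable]: "\<And>t. a t \<in> borel_measurable borel" "\<And>t. c t \<in> borel_measurable borel"
    and a: "((\<lambda>t. \<integral>\<^sup>+x. ennreal (\<bar>a t x\<bar> powr m) \<partial>lborel) \<longlongrightarrow> 0) F"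
    and c: "\<forall>\<^sub>F t in F. (\<integral>\<^sup>+x. ennreal (\<bar>c t x\<bar> powr m') \<partial>lborel) \<le> ennreal C"
  shows "((\<lambda>t. \<integral>\<^sup>+x. ennreal \<bar>a t x * c t x\<bar> \<partial>lborel) \<longlongrightarrow> 0) F"
proof (rule ennreal_tendsto_0I)
  fix e :: real assume e: "e > 0"
  define K where "K = \<bar>C\<bar> + 1"
  have K: "K > 0" "C \<le> K" by (auto simp: K_def)
  \<comment> \<open>Solves \<open>\<delta> powr m' * K = e / 2\<close>; the positive
    \<open>K\<close> replaces \<open>C\<close>, whose sign is unknown.\<close>
  define \<delta> where "\<delta> = (e / (2 * K)) powr (1 / m')"
  have \<delta>: "\<delta> > 0" using e K by (simp add: \<delta>_def)
  have \<delta>m: "\<delta> powr m' * K = e / 2" using e K m by (simp add: \<delta>_def powr_powr)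
  define \<kappa> where "\<kappa> = (1 / \<delta>) powr m"
  have \<kappa>: "\<kappa> > 0" using \<delta> by (simp add: \<kappa>_def)
  have "\<forall>\<^sub>F t in F. (\<integral>\<^sup>+x. ennreal (\<bar>a t x\<bar> powr m) \<partial>lborel) \<le> ennreal (e / (2 * \<kappa>))"
    using e \<kappa> by (intro ennreal_tendsto_0D[OF a]) simp
  then show "\<forall>\<^sub>F t in F. (\<integral>\<^sup>+x. ennreal \<bar>a t x * c t x\<bar> \<partial>lborel) \<le> ennreal e"
    using c
  proof eventually_elim
    case (elim t)
    have "(\<integral>\<^sup>+x. ennreal \<bar>a t x * c t x\<bar> \<partial>lborel)
       \<le> (\<integral>\<^sup>+x. ennreal \<kappa> * ennreal (\<bar>a t x\<bar> powr m) + ennreal (\<delta> powr m') * ennreal (\<bar>c t x\<bar> powr m') \<partial>lborel)"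
      using Young_scaled[OF m \<delta>] \<kappa>
      by (intro nn_integral_mono) (simp add: \<kappa>_def ennreal_mult'[symmetric] ennreal_plus[symmetric] ennreal_leI del: ennreal_plus)
    also have "\<dots> = ennreal \<kappa> * (\<integral>\<^sup>+x. ennreal (\<bar>a t x\<bar> powr m) \<partial>lborel)
        + ennreal (\<delta> powr m') * (\<integral>\<^sup>+x. ennreal (\<bar>c t x\<bar> powr m') \<partial>lborel)"
      by (simp add: nn_integral_add nn_integral_cmult)
    also have "\<dots> \<le> ennreal \<kappa> * ennreal (e / (2 * \<kappa>)) + ennreal (\<delta> powr m') * ennreal K"
      using elim K by (intro add_mono mult_left_mono) (auto elim: order_trans intro: ennreal_leI)
    also have "\<dots> = ennreal (\<kappa> * (e / (2 * \<kappa>)) + \<delta> powr m' * K)"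
      using \<kappa> e K by (simp add: ennreal_mult'[symmetric] ennreal_plus[symmetric] del: ennreal_plus)
    also have "\<kappa> * (e / (2 * \<kappa>)) + \<delta> powr m' * K = e" using \<delta>m \<kappa> by simp
    finally show ?case .
  qed
qed

lemma Lp_loc_mult_integrable:
  assumes m: "m > 1" "m' > 1" "1 / m + 1 / m' = 1" and a: "Lp_loc m a" and c: "Lp_loc m' c"
  shows "integrable lborel (\<lambda>x. cut R x * (a x * c x))"
proof -
  note [measurable] = Lp_loc_measurable[OF a] Lp_loc_measurable[OF c]
  have "integrable lborel (\<lambda>x. \<bar>cut R x * a x\<bar> powr m + \<bar>cut R x * c x\<bar> powr m')"
    by (intro Bochner_Integration.integrable_add Lp_loc_integrable a c)
  then show ?thesis
  proof (rule Bochner_Integration.integrable_bound)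
    show "AE x in lborel. norm (cut R x * (a x * c x))
      \<le> norm (\<bar>cut R x * a x\<bar> powr m + \<bar>cut R x * c x\<bar> powr m')"
    proof (rule AE_I2)
      fix x
      show "norm (cut R x * (a x * c x))
      \<le> norm (\<bar>cut R x * a x\<bar> powr m + \<bar>cut R x * c x\<bar> powr m')"
        using Young_scaled[OF m, of 1 "a x" "c x"] by (simp add: indicator_def)
    qed
  qed measurable
qed

text \<open>Near \<open>t = 0\<close> the quotient is within distance 1 (in m-th power integral) of
  the locally integrable derivative.\<close>

lemma difference_quotient_bounded:
  assumes w: "wgrad v G" and b: "b \<in> Basis" and m: "m > 1" and G: "Lp_loc m (\<lambda>x. G x \<bullet> b)"
  obtains C where "\<forall>\<^sub>F t in at (0::real). (\<integral>\<^sup>+x. ennreal (\<bar>cut R x * diff_quot v b t x\<bar> powr m) \<partial>lborel) \<le> ennreal C"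
proof -
  note [measurable] = Lp_loc_measurable[OF G] loc_int_measurable[OF wgrad_loc_int(1)[OF w]]
  note iG = Lp_loc_integrable[OF G, of R]
  define I where "I = (LBINT x. \<bar>cut R x * (G x \<bullet> b)\<bar> powr m)"
  have I0: "I \<ge> 0" unfolding I_def by (intro Bochner_Integration.integral_nonneg) auto
  have "\<forall>\<^sub>F t in at (0::real). (\<integral>\<^sup>+x. ennreal (\<bar>cut R x * (diff_quot v b t x - G x \<bullet> b)\<bar> powr m) \<partial>lborel) \<le> ennreal 1"
    by (rule ennreal_tendsto_0D[OF difference_quotient_Lp_loc[OF w b m G]]) simp
  then have "\<forall>\<^sub>F t in at (0::real). (\<integral>\<^sup>+x. ennreal (\<bar>cut R x * diff_quot v b t x\<bar> powr m) \<partial>lborel)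
       \<le> ennreal (2 powr m * (1 + I))"
  proof eventually_elim
    case (elim t)
    let ?D = "\<lambda>x. cut R x * (diff_quot v b t x - G x \<bullet> b)"
    let ?g = "\<lambda>x. cut R x * (G x \<bullet> b)"
    have "(\<integral>\<^sup>+x. ennreal (\<bar>cut R x * diff_quot v b t x\<bar> powr m) \<partial>lborel)
      \<le> (\<integral>\<^sup>+x. ennreal (2 powr m) * (ennreal (\<bar>?D x\<bar> powr m) + ennreal (\<bar>?g x\<bar> powr m)) \<partial>lborel)"
    proof (rule nn_integral_mono)
      fix x
      have "\<bar>cut R x * diff_quot v b t x\<bar> \<le> \<bar>?D x\<bar> + \<bar>?g x\<bar>"
        using abs_triangle_ineq[of "diff_quot v b t x - G x \<bullet> b" "G x \<bullet> b"]
        by (simp add: indicator_def del: abs_divide)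
      then have "\<bar>cut R x * diff_quot v b t x\<bar> powr m \<le> (\<bar>?D x\<bar> + \<bar>?g x\<bar>) powr m"
        using m by (intro powr_mono2) auto
      also have "\<dots> \<le> 2 powr m * (\<bar>?D x\<bar> powr m + \<bar>?g x\<bar> powr m)"
        using m by (intro powr_add_le) auto
      finally show "ennreal (\<bar>cut R x * diff_quot v b t x\<bar> powr m)
        \<le> ennreal (2 powr m) * (ennreal (\<bar>?D x\<bar> powr m) + ennreal (\<bar>?g x\<bar> powr m))"
        by (simp add: ennreal_mult'[symmetric] ennreal_plus[symmetric] ennreal_leI del: ennreal_plus)
    qed
    also have "\<dots> = ennreal (2 powr m) * ((\<integral>\<^sup>+x. ennreal (\<bar>?D x\<bar> powr m) \<partial>lborel) + (\<integral>\<^sup>+x. ennreal (\<bar>?g x\<bar> powr m) \<partial>lborel))"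
      by (simp add: nn_integral_cmult nn_integral_add)
    also have "(\<integral>\<^sup>+x. ennreal (\<bar>?g x\<bar> powr m) \<partial>lborel) = ennreal I"
      unfolding I_def by (intro nn_integral_eq_integral iG) auto
    also have "ennreal (2 powr m) * ((\<integral>\<^sup>+x. ennreal (\<bar>?D x\<bar> powr m) \<partial>lborel) + ennreal I)
       \<le> ennreal (2 powr m) * (ennreal 1 + ennreal I)"
      using elim by (intro mult_left_mono add_right_mono) auto
    also have "\<dots> = ennreal (2 powr m * (1 + I))"
      using I0 by (simp add: ennreal_mult'[symmetric] ennreal_plus[symmetric] del: ennreal_plus ennreal_1)
    finally show ?case .
  qed
  then show ?thesis by (rule that)
qed


lemma Lp_loc_iff_loc_int:
  "Lp_loc m f \<longleftrightarrow> f \<in> borel_measurable borel \<and> loc_int (\<lambda>x. \<bar>f x\<bar> powr m)"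
  by (auto simp: Lp_loc_def loc_int_def)

lemma Lp_loc_shift: "Lp_loc m f \<Longrightarrow> Lp_loc m (\<lambda>x. f (x + y))"
  using loc_int_shift[of "\<lambda>x. \<bar>f x\<bar> powr m" y] by (auto simp: Lp_loc_iff_loc_int)

lemma Lp_loc_diff:
  assumes f: "Lp_loc m f" and g: "Lp_loc m g" and m: "m \<ge> 0"
  shows "Lp_loc m (\<lambda>x. f x - g x)"
  unfolding Lp_loc_def
proof (intro conjI allI)
  note [measurable] = Lp_loc_measurable[OF f] Lp_loc_measurable[OF g]
  show "(\<lambda>x. f x - g x) \<in> borel_measurable borel" by measurable
  fix R
  have "integrable lborel (\<lambda>x. 2 powr m * (cut R x * \<bar>f x\<bar> powr m + cut R x * \<bar>g x\<bar> powr m))"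
    using f g by (intro integrable_mult_right Bochner_Integration.integrable_add) (auto simp: Lp_loc_def)
  then show "integrable lborel (\<lambda>x. cut R x * \<bar>f x - g x\<bar> powr m)"
  proof (rule Bochner_Integration.integrable_bound)
    have "\<bar>f x - g x\<bar> powr m \<le> 2 powr m * (\<bar>f x\<bar> powr m + \<bar>g x\<bar> powr m)" for x
    proof -
      have "\<bar>f x - g x\<bar> powr m \<le> (\<bar>f x\<bar> + \<bar>g x\<bar>) powr m" using m by (intro powr_mono2) auto
      also have "\<dots> \<le> 2 powr m * (\<bar>f x\<bar> powr m + \<bar>g x\<bar> powr m)" using m by (intro powr_add_le) auto
      finally show ?thesis .
    qed
    then show "AE x in lborel. norm (cut R x * \<bar>f x - g x\<bar> powr m)
       \<le> norm (2 powr m * (cut R x * \<bar>f x\<bar> powr m + cut R x * \<bar>g x\<bar> powr m))"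
      by (intro AE_I2) (simp add: indicator_def)
  qed measurable
qed

text \<open>The source of both error estimates of order o(t): it is applied with \<open>B\<close> a
  component of the flux and \<open>v\<close> the same component of the gradient, and again with
  \<open>B\<close> a bounded function of \<open>u\<close> and \<open>v = u\<close>.\<close>

lemma translation_difference_quotient:
  assumes w: "wgrad v G" and b: "b \<in> Basis" and m: "m > 1" "m' > 1" "1 / m + 1 / m' = 1"
    and G: "Lp_loc m (\<lambda>x. G x \<bullet> b)" and B: "Lp_loc m' B"
  shows "((\<lambda>t. \<integral>\<^sup>+x. ennreal \<bar>(cut R x * (B (x + t *\<^sub>R b) - B x))
      * (cut R x * diff_quot v b t x)\<bar> \<partial>lborel) \<longlongrightarrow> 0) (at (0::real))"
proof -
  note [measurable] = Lp_loc_measurable[OF B] loc_int_measurable[OF wgrad_loc_int(1)[OF w]]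
  obtain C where C: "\<forall>\<^sub>F t in at (0::real). (\<integral>\<^sup>+x. ennreal (\<bar>cut R x * diff_quot v b t x\<bar> powr m) \<partial>lborel) \<le> ennreal C"
    using difference_quotient_bounded[OF w b m(1) G] by blast
  show ?thesis
    by (rule tendsto_pairing[OF m(2,1) _ _ _ translation_Lp_loc[OF B _ norm_Basis[OF b]] C])
      (use m in \<open>simp_all add: add.commute\<close>)
qed

lemma difference_quotient_pairing:
  assumes w: "wgrad v G" and b: "b \<in> Basis" and m: "m > 1" "m' > 1" "1 / m + 1 / m' = 1"
    and G: "Lp_loc m (\<lambda>x. G x \<bullet> b)" and C: "Lp_loc m' C" and v: "Lp_loc m v"
    and sp: "\<And>x. norm x > R \<Longrightarrow> C x = 0"
  shows "((\<lambda>t. \<integral>x. C x * diff_quot v b t x \<partial>lborel) \<longlongrightarrow> (LBINT x. C x * (G x \<bullet> b))) (at (0::real))"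
proof -
  note [measurable] = Lp_loc_measurable[OF C] Lp_loc_measurable[OF G] loc_int_measurable[OF wgrad_loc_int(1)[OF w]]
  have indC: "(cut R x * y) * (cut R x * C x) = C x * y"
    "cut R x * (y * C x) = C x * y" for x y
    using sp[of x] by (cases "norm x \<le> R"; simp)+
  define K where "K = (LBINT x. \<bar>cut R x * C x\<bar> powr m')"
  have "(\<integral>\<^sup>+x. ennreal (\<bar>cut R x * C x\<bar> powr m') \<partial>lborel) \<le> ennreal K"
    unfolding K_def using nn_integral_eq_integral[OF Lp_loc_integrable[OF C, of R]] by simp
  then have "((\<lambda>t. \<integral>\<^sup>+x. ennreal \<bar>(cut R x * (diff_quot v b t x - G x \<bullet> b))
      * (cut R x * C x)\<bar> \<partial>lborel) \<longlongrightarrow> 0) (at (0::real))"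
    by (intro tendsto_pairing[OF m _ _ difference_quotient_Lp_loc[OF w b m(1) G]]) (auto intro: always_eventually)
  from tendsto_integral_0[OF this]
  have lim: "((\<lambda>t. \<integral>x. C x * (diff_quot v b t x - G x \<bullet> b) \<partial>lborel) \<longlongrightarrow> 0) (at 0)"
    unfolding indC .
  have iG: "integrable lborel (\<lambda>x. C x * (G x \<bullet> b))"
    using Lp_loc_mult_integrable[OF m G C, of R] unfolding indC .
  have iD: "integrable lborel (\<lambda>x. C x * diff_quot v b t x)" for t
  proof -
    have "integrable lborel (\<lambda>x. cut R x * ((v (x + t *\<^sub>R b) - v x) * C x))"
      using m by (intro Lp_loc_mult_integrable[OF m _ C] Lp_loc_diff Lp_loc_shift v) auto
    then have "integrable lborel (\<lambda>x. (1 / t) * (C x * (v (x + t *\<^sub>R b) - v x)))"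
      unfolding indC by (rule integrable_mult_right)
    then show ?thesis by (simp add: mult.commute)
  qed
  have "((\<lambda>t. (LBINT x. C x * (diff_quot v b t x - G x \<bullet> b)) + (LBINT x. C x * (G x \<bullet> b))) \<longlongrightarrow> 0 + (LBINT x. C x * (G x \<bullet> b))) (at 0)"
    by (intro tendsto_add lim tendsto_const)
  moreover have "(LBINT x. C x * (diff_quot v b t x - G x \<bullet> b)) + (LBINT x. C x * (G x \<bullet> b))
     = (LBINT x. C x * diff_quot v b t x)" for t
    using Bochner_Integration.integral_diff[OF iD[of t] iG] by (simp only: right_diff_distrib) 
  ultimately show ?thesis by (simp only: add_0_left)
qed

text \<open>The increment is shifted onto \<psi>, so \<open>w\<close> needs no derivative at all.
  The Lipschitz constant of \<psi> times \<bar>w\<bar> dominates.\<close>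

lemma difference_quotient_by_parts:
  fixes w :: "'a::euclidean_space \<Rightarrow> real"
  assumes w: "integrable lborel w" and psi: "\<psi> \<in> test_functions" and b: "b \<in> Basis"
  shows "integrable lborel (\<lambda>x. \<psi> x * ((w (x + t *\<^sub>R b) - w x) / t))"
    and "((\<lambda>t. \<integral>x. \<psi> x * ((w (x + t *\<^sub>R b) - w x) / t) \<partial>lborel) \<longlongrightarrow> - (LBINT x. w x * (grad \<psi> x \<bullet> b))) (at (0::real))"
proof -
  have [measurable]: "w \<in> borel_measurable borel" using w by simp
  note [measurable] = test_functions_measurable[OF psi] grad_measurable[OF psi]
  obtain B where B: "\<And>x. \<bar>\<psi> x\<bar> \<le> B" using test_functions_bounded[OF psi] by blast
  obtain L where L: "L > 0" "\<And>x. norm (grad \<psi> x) \<le> L" "\<And>x y. \<bar>\<psi> x - \<psi> y\<bar> \<le> L * norm (x - y)"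
    using test_functions_lipschitz[OF psi] by metis
  have bd: "integrable lborel (\<lambda>x. \<theta> x * z x)"
    if z: "integrable lborel z" and [measurable]: "\<theta> \<in> borel_measurable borel" and "\<And>x. \<bar>\<theta> x\<bar> \<le> B" for z \<theta> :: "'a \<Rightarrow> real"
  proof (rule Bochner_Integration.integrable_bound[OF integrable_mult_right[OF z, of B]])
    show "AE x in lborel. norm (\<theta> x * z x) \<le> norm (B * z x)"
      using that(3) order_trans[OF that(3) abs_ge_self] by (intro AE_I2) (auto simp: abs_mult intro!: mult_right_mono)
  qed (use z in measurable)
  have i1: "integrable lborel (\<lambda>x. \<psi> x * w (x + y))" for y
    by (rule bd[OF integrable_lborel_shift[OF w]]) (use B in auto)
  have i2: "integrable lborel (\<lambda>x. \<psi> (x - y) * w x)" for y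
    by (rule bd[OF w]) (use B in auto)
  have i3: "integrable lborel (\<lambda>x. \<psi> x * w x)" using i1[of 0] by simp
  show "integrable lborel (\<lambda>x. \<psi> x * ((w (x + t *\<^sub>R b) - w x) / t))" for t
    using integrable_mult_right[OF Bochner_Integration.integrable_diff[OF i1[of "t *\<^sub>R b"] i3], of "1 / t"]
    by (simp add: algebra_simps diff_divide_distrib)
  have eq: "(LBINT x. \<psi> x * ((w (x + t *\<^sub>R b) - w x) / t)) = (LBINT x. (\<psi> (x - t *\<^sub>R b) - \<psi> x) / t * w x)" for t
  proof -
    have "(LBINT x. \<psi> x * ((w (x + t *\<^sub>R b) - w x) / t))
      = (LBINT x. (1 / t) * (\<psi> x * w (x + t *\<^sub>R b) - \<psi> x * w x))"
      by (simp add: algebra_simps diff_divide_distrib)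
    also have "\<dots> = (1 / t) * ((LBINT x. \<psi> x * w (x + t *\<^sub>R b)) - (LBINT x. \<psi> x * w x))"
      by (simp only: integral_mult_right_zero Bochner_Integration.integral_diff[OF i1[of "t *\<^sub>R b"] i3])
    also have "(LBINT x. \<psi> x * w (x + t *\<^sub>R b)) = (LBINT x. \<psi> (x + t *\<^sub>R b - t *\<^sub>R b) * w (x + t *\<^sub>R b))"
      by simp
    also have "\<dots> = (LBINT x. \<psi> (x - t *\<^sub>R b) * w x)"
      by (rule integral_lborel_shift[where f = "\<lambda>x. \<psi> (x - t *\<^sub>R b) * w x"]) measurable
    also have "(1 / t) * ((LBINT x. \<psi> (x - t *\<^sub>R b) * w x) - (LBINT x. \<psi> x * w x))
       = (LBINT x. (1 / t) * (\<psi> (x - t *\<^sub>R b) * w x - \<psi> x * w x))"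
      by (simp only: integral_mult_right_zero Bochner_Integration.integral_diff[OF i2[of "t *\<^sub>R b"] i3])
    also have "\<dots> = (LBINT x. (\<psi> (x - t *\<^sub>R b) - \<psi> x) / t * w x)"
      by (simp add: algebra_simps diff_divide_distrib)
    finally show ?thesis .
  qed
  have "((\<lambda>t. \<integral>x. (\<psi> (x - t *\<^sub>R b) - \<psi> x) / t * w x \<partial>lborel) \<longlongrightarrow> (LBINT x. - (grad \<psi> x \<bullet> b) * w x)) (at 0)"
    unfolding tendsto_at_iff_sequentially
  proof (intro allI impI)
    fix X :: "nat \<Rightarrow> real" assume X0: "\<forall>i. X i \<in> UNIV - {0}" and X: "X \<longlonglongrightarrow> 0"
    have "(\<lambda>n. \<integral>x. (\<psi> (x - X n *\<^sub>R b) - \<psi> x) / X n * w x \<partial>lborel) \<longlonglongrightarrow> (LBINT x. - (grad \<psi> x \<bullet> b) * w x)"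
    proof (rule integral_dominated_convergence[where w = "\<lambda>x. L * \<bar>w x\<bar>"])
      show "integrable lborel (\<lambda>x. L * \<bar>w x\<bar>)" using w by simp
      show "AE x in lborel. (\<lambda>n. (\<psi> (x - X n *\<^sub>R b) - \<psi> x) / X n * w x) \<longlonglongrightarrow> - (grad \<psi> x \<bullet> b) * w x"
      proof (rule AE_I2, rule tendsto_mult[OF _ tendsto_const])
        fix x
        have "((\<lambda>t. x - t *\<^sub>R b) has_derivative (\<lambda>h. - (h *\<^sub>R b))) (at 0)"
          by (auto intro!: derivative_eq_intros)
        from has_derivative_compose[OF this, of \<psi> "\<lambda>h. grad \<psi> x \<bullet> h"] test_functions_has_grad[OF psi, of x]
        have "((\<lambda>t. \<psi> (x - t *\<^sub>R b)) has_derivative (\<lambda>h. - (h * (grad \<psi> x \<bullet> b)))) (at 0)"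
          by simp
        moreover have "(\<lambda>h. - (h * (grad \<psi> x \<bullet> b))) = (*) (- (grad \<psi> x \<bullet> b))"
          by (auto simp: mult.commute)
        ultimately have "((\<lambda>t. \<psi> (x - t *\<^sub>R b)) has_real_derivative - (grad \<psi> x \<bullet> b)) (at 0)"
          unfolding has_field_derivative_def by simp
        then have "((\<lambda>h. (\<psi> (x - h *\<^sub>R b) - \<psi> x) / h) \<longlongrightarrow> - (grad \<psi> x \<bullet> b)) (at 0)"
          by (simp add: DERIV_def)
        then show "(\<lambda>n. (\<psi> (x - X n *\<^sub>R b) - \<psi> x) / X n) \<longlonglongrightarrow> - (grad \<psi> x \<bullet> b)"
          using X0 X unfolding tendsto_at_iff_sequentially by (auto simp: o_def)
      qed
      show "AE x in lborel. norm ((\<psi> (x - X n *\<^sub>R b) - \<psi> x) / X n * w x) \<le> L * \<bar>w x\<bar>" for n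
      proof (rule AE_I2)
        fix x
        have "X n \<noteq> 0" using X0 by auto
        then have "\<bar>(\<psi> (x - X n *\<^sub>R b) - \<psi> x) / X n\<bar> \<le> L"
          using L(3)[of "x - X n *\<^sub>R b" x] b by (simp add: field_simps)
        then show "norm ((\<psi> (x - X n *\<^sub>R b) - \<psi> x) / X n * w x) \<le> L * \<bar>w x\<bar>"
          unfolding real_norm_def abs_mult by (intro mult_right_mono) auto
      qed
    qed measurable
    then show "((\<lambda>t. \<integral>x. (\<psi> (x - t *\<^sub>R b) - \<psi> x) / t * w x \<partial>lborel) \<circ> X) \<longlonglongrightarrow> (LBINT x. - (grad \<psi> x \<bullet> b) * w x)"
      by (simp add: o_def)
  qed
  then show "((\<lambda>t. \<integral>x. \<psi> x * ((w (x + t *\<^sub>R b) - w x) / t) \<partial>lborel) \<longlongrightarrow> - (LBINT x. w x * (grad \<psi> x \<bullet> b))) (at (0::real))"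
    unfolding eq by (simp add: mult.commute)
qed

section \<open>The local Pohozaev identity\<close>

text \<open>The flux of the m-Laplacian, that is the gradient of
  \<open>norm \<xi> powr m / m\<close>; its value at 0 is 0 also for m < 2.\<close>

definition power_field :: "real \<Rightarrow> 'a::euclidean_space \<Rightarrow> 'a" where
  "power_field m \<xi> = norm \<xi> powr (m - 2) *\<^sub>R \<xi>"

lemma power_field_self: "power_field m \<xi> \<bullet> \<xi> = norm \<xi> powr m"
proof (cases "\<xi> = 0")
  case False
  then have "norm \<xi> powr (m - 2) * (norm \<xi>)\<^sup>2 = norm \<xi> powr m"
    using powr_add[of "norm \<xi>" "m - 2" 2] by (simp add: powr_numeral)
  then show ?thesis by (simp add: power_field_def power2_norm_eq_inner)
qed (simp add: power_field_def)

lemma norm_power_field: "norm (power_field m \<xi>) = norm \<xi> powr (m - 1)"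
proof (cases "\<xi> = 0")
  case False
  then show ?thesis
    using powr_add[of "norm \<xi>" "m - 2" 1] by (simp add: power_field_def)
qed (simp add: power_field_def)

text \<open>The subgradient inequality for \<open>norm \<xi> powr m / m\<close>, obtained from
  Cauchy-Schwarz and the scalar tangent inequality \<open>Youngs_powr\<close>, without
  differentiating the norm.\<close>

lemma power_field_convex:
  assumes m: "m > 1"
  shows "power_field m \<xi> \<bullet> (\<eta> - \<xi>) \<le> norm \<eta> powr m / m - norm \<xi> powr m / m"
proof -
  have "power_field m \<xi> \<bullet> \<eta> \<le> norm (power_field m \<xi>) * norm \<eta>"
    by (rule norm_cauchy_schwarz)
  then have "m * (power_field m \<xi> \<bullet> \<eta>) \<le> m * (norm \<xi> powr (m - 1) * norm \<eta>)"
    using m by (simp add: norm_power_field)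
  also have "\<dots> \<le> norm \<eta> powr m + (m - 1) * norm \<xi> powr m"
    by (rule Youngs_powr[OF m]) auto
  finally have "power_field m \<xi> \<bullet> \<eta> \<le> (norm \<eta> powr m + (m - 1) * norm \<xi> powr m) / m"
    using m by (simp add: field_simps)
  also have "\<dots> = norm \<eta> powr m / m - norm \<xi> powr m / m + norm \<xi> powr m"
    using m by (simp add: field_simps)
  finally show ?thesis by (simp add: inner_diff_right power_field_self)
qed

lemma power_field_measurable [measurable]: "power_field m \<in> borel_measurable borel"
  unfolding power_field_def[abs_def] by measurable

lemma powr_le_1_add_powr:
  fixes x a b :: real
  assumes "x \<ge> 0" "0 \<le> a" "a \<le> b"
  shows "x powr a \<le> 1 + x powr b"
proof (cases "x \<le> 1")
  case True
  then have "x powr a \<le> 1 powr a" using assms by (intro powr_mono2) auto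
  then show ?thesis by (simp add: add_increasing2)
next
  case False
  then have "x powr a \<le> x powr b" using assms by (intro powr_mono) auto
  then show ?thesis by simp
qed

text \<open>The data of the Pohozaev argument in Borel form. \<open>H c\<close> is the weak gradient
  of the component of \<open>g\<close> along \<open>c\<close>; \<open>P\<close> and \<open>Q\<close>
  stand for the critical exponents of \<open>p\<close> and \<open>q\<close>. The functions
  \<open>f\<close> and \<open>F\<close> are linked only by \<open>nonlinearity\<close>, where the
  bounded \<open>k i\<close> measure how far \<sigma> \<open>F\<close> is from being convex; no
  growth condition appears.\<close>

locale quasilinear_solution =
  fixes u :: "'a::euclidean_space \<Rightarrow> real" and g :: "'a \<Rightarrow> 'a" and H :: "'a \<Rightarrow> 'a \<Rightarrow> 'a"
    and p q P Q :: real and f F :: "real \<Rightarrow> real" and \<sigma> :: real and k :: "nat \<Rightarrow> real \<Rightarrow> real" and n :: nat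
  assumes q1: "1 < q" and qp: "q < p" and PQ: "P \<ge> 0" "Q \<ge> 0"
    and wu: "wgrad u g"
    and wg: "\<And>c. c \<in> Basis \<Longrightarrow> wgrad (\<lambda>x. g x \<bullet> c) (H c)"
    and H_loc: "\<And>b c. b \<in> Basis \<Longrightarrow> c \<in> Basis \<Longrightarrow> Lp_loc p (\<lambda>x. H c x \<bullet> b)"
    and u_loc: "Lp_loc p u"
    and gp: "integrable lborel (\<lambda>x. norm (g x) powr p)"
    and gq: "integrable lborel (\<lambda>x. norm (g x) powr q)"
    and uP: "integrable lborel (\<lambda>x. \<bar>u x\<bar> powr P)"
    and uQ: "integrable lborel (\<lambda>x. \<bar>u x\<bar> powr Q)"
    and F_int: "integrable lborel (\<lambda>x. F (u x))"
    and \<sigma>: "\<sigma> = 1 \<or> \<sigma> = - 1"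
    and k_meas: "\<And>i. i < n \<Longrightarrow> k i \<in> borel_measurable borel"
    and k_bounded: "\<And>i. i < n \<Longrightarrow> \<exists>K. \<forall>y. \<bar>k i y\<bar> \<le> K"
    and nonlinearity: "\<And>y z. - (\<Sum>i<n. \<bar>k i z - k i y\<bar>) * \<bar>z - y\<bar> \<le> \<sigma> * (F z - F y - f y * (z - y))"
    and weak: "\<And>\<phi> h. wgrad \<phi> h \<Longrightarrow> integrable lborel (\<lambda>x. \<bar>\<phi> x\<bar> powr P) \<Longrightarrow> integrable lborel (\<lambda>x. \<bar>\<phi> x\<bar> powr Q)
      \<Longrightarrow> integrable lborel (\<lambda>x. norm (h x) powr p) \<Longrightarrow> integrable lborel (\<lambda>x. norm (h x) powr q)
      \<Longrightarrow> integrable lborel (\<lambda>x. (power_field p (g x) + power_field q (g x)) \<bullet> h x)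
        \<and> integrable lborel (\<lambda>x. f (u x) * \<phi> x)
        \<and> (LBINT x. (power_field p (g x) + power_field q (g x)) \<bullet> h x) = (LBINT x. f (u x) * \<phi> x)"
begin

definition A :: "'a \<Rightarrow> 'a" where "A x = power_field p (g x) + power_field q (g x)"
definition G :: "'a \<Rightarrow> real" where "G x = norm (g x) powr p / p + norm (g x) powr q / q"
definition p' :: real where "p' = p / (p - 1)"

lemma exponents: "p > 1" "p' > 1" "1 / p + 1 / p' = 1"
  using q1 qp by (auto simp: p'_def field_simps)

lemma u_meas [measurable]: "u \<in> borel_measurable borel"
  by (rule loc_int_measurable[OF wgrad_loc_int(1)[OF wu]])

lemma g_meas [measurable]: "g \<in> borel_measurable borel"
  by (rule loc_int_measurable[OF wgrad_loc_int(2)[OF wu]])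

lemma A_meas [measurable]: "A \<in> borel_measurable borel"
  unfolding A_def[abs_def] by measurable

lemma G_meas [measurable]: "G \<in> borel_measurable borel"
  unfolding G_def[abs_def] by measurable

lemma G_int: "integrable lborel G"
  unfolding G_def[abs_def] by (intro Bochner_Integration.integrable_add integrable_divide gp gq)

lemma g_loc: "Lp_loc p (\<lambda>x. norm (g x))"
  by (rule Lp_locI) (use gp in auto)

lemma g_comp_loc:
  assumes "b \<in> Basis" shows "Lp_loc p (\<lambda>x. g x \<bullet> b)"
proof (rule Lp_loc_bound[OF g_loc])
  show "\<bar>g x \<bullet> b\<bar> powr p \<le> 1 * (1 + \<bar>norm (g x)\<bar> powr p)" for x
  proof -
    have "\<bar>g x \<bullet> b\<bar> powr p \<le> norm (g x) powr p"
      using exponents Basis_le_norm[OF assms] by (intro powr_mono2) auto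
    then show ?thesis by simp
  qed
qed auto

lemma uq_loc: "Lp_loc q u"
proof (rule Lp_loc_bound[OF u_loc])
  show "\<bar>u x\<bar> powr q \<le> 1 * (1 + \<bar>u x\<bar> powr p)" for x
    using powr_le_1_add_powr[of "\<bar>u x\<bar>" q p] q1 qp by simp
qed auto

text \<open>The dual exponent of the larger power works for both terms of the flux: (p - 1) p' = p,
  and (q - 1) p' \<le> p because q < p.\<close>

lemma A_loc: "Lp_loc p' (\<lambda>x. norm (A x))"
proof (rule Lp_loc_bound[OF g_loc])
  fix x
  have e: "(p - 1) * p' = p" "(q - 1) * p' \<le> p" "0 \<le> (q - 1) * p'"
    using q1 qp exponents by (auto simp: p'_def field_simps)
  have "norm (A x) \<le> norm (g x) powr (p - 1) + norm (g x) powr (q - 1)"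
    unfolding A_def using norm_triangle_ineq[of "power_field p (g x)" "power_field q (g x)"] by (simp add: norm_power_field)
  then have "\<bar>norm (A x)\<bar> powr p' \<le> (norm (g x) powr (p - 1) + norm (g x) powr (q - 1)) powr p'"
    using exponents by (intro powr_mono2) auto
  also have "\<dots> \<le> 2 powr p' * (norm (g x) powr p + norm (g x) powr ((q - 1) * p'))"
    using powr_add_le[of "norm (g x) powr (p - 1)" "norm (g x) powr (q - 1)" p'] exponents e(1)
    by (simp add: powr_powr)
  also have "\<dots> \<le> 2 powr p' * (2 * (1 + norm (g x) powr p))"
  proof (intro mult_left_mono)
    show "norm (g x) powr p + norm (g x) powr ((q - 1) * p') \<le> 2 * (1 + norm (g x) powr p)"
      using powr_le_1_add_powr[OF norm_ge_zero e(3,2), of "g x"] powr_ge_zero[of "norm (g x)" p]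
      unfolding distrib_left mult_2 by linarith
  qed auto
  finally show "\<bar>norm (A x)\<bar> powr p' \<le> (2 * 2 powr p') * (1 + \<bar>norm (g x)\<bar> powr p)"
    by (simp add: algebra_simps)
qed auto

lemma A_inner_loc:
  assumes [measurable]: "w \<in> borel_measurable borel" and "\<And>x. norm (w x) \<le> K"
  shows "Lp_loc p' (\<lambda>x. A x \<bullet> w x)"
proof (rule Lp_loc_bound[OF A_loc])
  show "\<bar>A x \<bullet> w x\<bar> powr p' \<le> \<bar>K\<bar> powr p' * (1 + \<bar>norm (A x)\<bar> powr p')" for x
  proof -
    have "\<bar>A x \<bullet> w x\<bar> \<le> norm (A x) * norm (w x)" by (rule Cauchy_Schwarz_ineq2)
    also have "\<dots> \<le> norm (A x) * \<bar>K\<bar>"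
      using assms(2)[of x] by (intro mult_left_mono) auto
    finally have "\<bar>A x \<bullet> w x\<bar> powr p' \<le> (norm (A x) * \<bar>K\<bar>) powr p'"
      using exponents by (intro powr_mono2) auto
    also have "\<dots> = \<bar>K\<bar> powr p' * norm (A x) powr p'" by (simp add: powr_mult)
    also have "\<dots> \<le> \<bar>K\<bar> powr p' * (1 + \<bar>norm (A x)\<bar> powr p')" by (intro mult_left_mono) auto
    finally show ?thesis .
  qed
qed auto

lemma G_convex:
  "A x \<bullet> (g y - g x) \<le> G y - G x"
  using power_field_convex[of p "g x" "g y"] power_field_convex[of q "g x" "g y"] q1 qp
  unfolding A_def G_def by (simp add: inner_add_left)

text \<open>Convexity at \<open>x\<close> bounds the error below by 0, convexity at \<open>y\<close>
  bounds it above by the product of increments. The componentwise form matches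
  \<open>translation_difference_quotient\<close>.\<close>

lemma G_error:
  "\<bar>G y - G x - A x \<bullet> (g y - g x)\<bar> \<le> (\<Sum>c\<in>Basis. \<bar>A y \<bullet> c - A x \<bullet> c\<bar> * \<bar>g y \<bullet> c - g x \<bullet> c\<bar>)"
proof -
  have "0 \<le> G y - G x - A x \<bullet> (g y - g x)" using G_convex[of x y] by simp
  moreover have "G y - G x - A x \<bullet> (g y - g x) \<le> (A y - A x) \<bullet> (g y - g x)"
    using G_convex[of y x] by (simp add: inner_diff_left inner_diff_right)
  moreover have "(A y - A x) \<bullet> (g y - g x) = (\<Sum>c\<in>Basis. ((A y - A x) \<bullet> c) * ((g y - g x) \<bullet> c))"
    by (rule euclidean_inner)
  moreover have "\<dots> \<le> (\<Sum>c\<in>Basis. \<bar>A y \<bullet> c - A x \<bullet> c\<bar> * \<bar>g y \<bullet> c - g x \<bullet> c\<bar>)"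
  proof (rule sum_mono)
    fix c show "((A y - A x) \<bullet> c) * ((g y - g x) \<bullet> c) \<le> \<bar>A y \<bullet> c - A x \<bullet> c\<bar> * \<bar>g y \<bullet> c - g x \<bullet> c\<bar>"
      using abs_ge_self[of "((A y - A x) \<bullet> c) * ((g y - g x) \<bullet> c)"] by (simp add: abs_mult inner_diff_left)
  qed
  ultimately show ?thesis by linarith
qed

lemma integrable_powr_shift_diff:
  fixes w :: "'a \<Rightarrow> 'b::euclidean_space"
  assumes [measurable]: "w \<in> borel_measurable borel" and w: "integrable lborel (\<lambda>x. norm (w x) powr m)" and m: "m \<ge> 0"
    and [measurable]: "\<theta> \<in> borel_measurable borel" and B: "\<And>x. \<bar>\<theta> x\<bar> \<le> B"
  shows "integrable lborel (\<lambda>x. norm (\<theta> x *\<^sub>R (w (x + y) - w x)) powr m)"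
proof (rule Bochner_Integration.integrable_bound)
  show "integrable lborel (\<lambda>x. B powr m * (2 powr m * (norm (w (x + y)) powr m + norm (w x) powr m)))"
    by (intro integrable_mult_right Bochner_Integration.integrable_add w integrable_lborel_shift[OF w])
  show "AE x in lborel. norm (norm (\<theta> x *\<^sub>R (w (x + y) - w x)) powr m)
    \<le> norm (B powr m * (2 powr m * (norm (w (x + y)) powr m + norm (w x) powr m)))"
  proof (rule AE_I2)
    fix x
    have "norm (\<theta> x *\<^sub>R (w (x + y) - w x)) powr m = \<bar>\<theta> x\<bar> powr m * norm (w (x + y) - w x) powr m"
      by (simp add: powr_mult)
    also have "\<dots> \<le> B powr m * (norm (w (x + y)) + norm (w x)) powr m"
      using B[of x] m norm_triangle_ineq4[of "w (x + y)" "w x"] by (intro mult_mono powr_mono2) auto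
    also have "\<dots> \<le> B powr m * (2 powr m * (norm (w (x + y)) powr m + norm (w x) powr m))"
      using m by (intro mult_left_mono powr_add_le) auto
    finally show "norm (norm (\<theta> x *\<^sub>R (w (x + y) - w x)) powr m)
    \<le> norm (B powr m * (2 powr m * (norm (w (x + y)) powr m + norm (w x) powr m)))" by simp
  qed
qed measurable

text \<open>The term carrying \<open>grad \<psi>\<close> has compact support, so local integrability
  of \<open>u\<close> to the power \<open>m\<close> suffices; globally only the powers
  \<open>P\<close> and \<open>Q\<close> are available.\<close>

lemma integrable_gradient_shift_mult:
  assumes psi: "\<psi> \<in> test_functions" and m: "m \<ge> 0" and um: "Lp_loc m u"
    and gm: "integrable lborel (\<lambda>x. norm (g x) powr m)"
  shows "integrable lborel (\<lambda>x. norm (\<psi> x *\<^sub>R (g (x + y) - g x) + (u (x + y) - u x) *\<^sub>R grad \<psi> x) powr m)"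
proof -
  note [measurable] = test_functions_measurable[OF psi] grad_measurable[OF psi]
  obtain B where B: "\<And>x. \<bar>\<psi> x\<bar> \<le> B" using test_functions_bounded[OF psi] by blast
  obtain L where L: "\<And>x. norm (grad \<psi> x) \<le> L" using grad_bounded[OF psi] by blast
  obtain R where R: "\<And>x. norm x \<ge> R \<Longrightarrow> grad \<psi> x = 0" using grad_support[OF psi] by metis
  have i1: "integrable lborel (\<lambda>x. norm (\<psi> x *\<^sub>R (g (x + y) - g x)) powr m)"
    by (rule integrable_powr_shift_diff[OF _ gm m _ B]) measurable
  have "Lp_loc m (\<lambda>x. norm (grad \<psi> x) * (u (x + y) - u x))"
    by (rule Lp_loc_bounded_mult[OF Lp_loc_diff[OF Lp_loc_shift[OF um] um m]]) (use L m in auto)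
  from Lp_loc_integrable[OF this, of R]
  have "integrable lborel (\<lambda>x. \<bar>cut R x * (norm (grad \<psi> x) * (u (x + y) - u x))\<bar> powr m)" .
  moreover have "\<bar>cut R x * (norm (grad \<psi> x) * (u (x + y) - u x))\<bar> = norm ((u (x + y) - u x) *\<^sub>R grad \<psi> x)" for x
    using R[of x] by (cases "norm x \<le> R") (auto simp: abs_mult)
  ultimately have i2: "integrable lborel (\<lambda>x. norm ((u (x + y) - u x) *\<^sub>R grad \<psi> x) powr m)"
    by (simp only:)
  from integrable_mult_right[OF Bochner_Integration.integrable_add[OF i1 i2], of "2 powr m"]
  show ?thesis
  proof (rule Bochner_Integration.integrable_bound)
    show "AE x in lborel. norm (norm (\<psi> x *\<^sub>R (g (x + y) - g x) + (u (x + y) - u x) *\<^sub>R grad \<psi> x) powr m)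
      \<le> norm (2 powr m * (norm (\<psi> x *\<^sub>R (g (x + y) - g x)) powr m + norm ((u (x + y) - u x) *\<^sub>R grad \<psi> x) powr m))"
    proof (rule AE_I2)
      fix x
      let ?a = "\<psi> x *\<^sub>R (g (x + y) - g x)" and ?b = "(u (x + y) - u x) *\<^sub>R grad \<psi> x"
      have "norm (?a + ?b) powr m \<le> (norm ?a + norm ?b) powr m"
        using m by (intro powr_mono2 norm_triangle_ineq) auto
      also have "\<dots> \<le> 2 powr m * (norm ?a powr m + norm ?b powr m)"
        using m by (intro powr_add_le) auto
      finally show "norm (norm (?a + ?b) powr m) \<le> norm (2 powr m * (norm ?a powr m + norm ?b powr m))"
        by simp
    qed
  qed measurable
qed

lemma weak_difference_quotient:
  assumes psi: "\<psi> \<in> test_functions"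
  shows "integrable lborel (\<lambda>x. A x \<bullet> (\<psi> x *\<^sub>R (g (x + y) - g x) + (u (x + y) - u x) *\<^sub>R grad \<psi> x))"
    and "integrable lborel (\<lambda>x. f (u x) * (\<psi> x * (u (x + y) - u x)))"
    and "(LBINT x. A x \<bullet> (\<psi> x *\<^sub>R (g (x + y) - g x) + (u (x + y) - u x) *\<^sub>R grad \<psi> x))
       = (LBINT x. f (u x) * (\<psi> x * (u (x + y) - u x)))"
proof -
  note [measurable] = test_functions_measurable[OF psi]
  obtain B where B: "\<And>x. \<bar>\<psi> x\<bar> \<le> B" using test_functions_bounded[OF psi] by blast
  note w = wgrad_test_mult[OF wgrad_diff[OF wgrad_shift[OF wu, of y] wu] psi]
  have "integrable lborel (\<lambda>x. \<bar>\<psi> x * (u (x + y) - u x)\<bar> powr m)"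
    if "integrable lborel (\<lambda>x. \<bar>u x\<bar> powr m)" "m \<ge> 0" for m
    using integrable_powr_shift_diff[of u m \<psi> B y] that B by simp
  from weak[OF w this[OF uP PQ(1)] this[OF uQ PQ(2)]
      integrable_gradient_shift_mult[OF psi _ u_loc gp] integrable_gradient_shift_mult[OF psi _ uq_loc gq]]
  show "integrable lborel (\<lambda>x. A x \<bullet> (\<psi> x *\<^sub>R (g (x + y) - g x) + (u (x + y) - u x) *\<^sub>R grad \<psi> x))"
    and "integrable lborel (\<lambda>x. f (u x) * (\<psi> x * (u (x + y) - u x)))"
    and "(LBINT x. A x \<bullet> (\<psi> x *\<^sub>R (g (x + y) - g x) + (u (x + y) - u x) *\<^sub>R grad \<psi> x))
       = (LBINT x. f (u x) * (\<psi> x * (u (x + y) - u x)))"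
    using q1 qp unfolding A_def by auto
qed

text \<open>The quotient splits into \<open>?S\<close>, where the increment of \<open>g\<close>
  meets the flux, and \<open>?T\<close>, where it falls on \<open>u\<close>. \<open>?T\<close>
  converges by pairing with the strong limit of the difference quotient; \<open>?S\<close> is
  replaced by the quotient \<open>?W\<close> of \<open>G\<close>, whose limit comes from integration
  by parts.\<close>

lemma principal_part_limit:
  assumes psi: "\<psi> \<in> test_functions" and b: "b \<in> Basis"
  shows "((\<lambda>t. (LBINT x. A x \<bullet> (\<psi> x *\<^sub>R (g (x + t *\<^sub>R b) - g x) + (u (x + t *\<^sub>R b) - u x) *\<^sub>R grad \<psi> x)) / t)
     \<longlongrightarrow> - (LBINT x. G x * (grad \<psi> x \<bullet> b)) + (LBINT x. (A x \<bullet> grad \<psi> x) * (g x \<bullet> b))) (at (0::real))"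
proof -
  note [measurable] = test_functions_measurable[OF psi] grad_measurable[OF psi]
  obtain B where B: "B > 0" "\<And>x. \<bar>\<psi> x\<bar> \<le> B" using test_functions_bounded[OF psi] by blast
  obtain L where L: "\<And>x. norm (grad \<psi> x) \<le> L" using grad_bounded[OF psi] by blast
  obtain R where R: "\<And>x. norm x \<ge> R \<Longrightarrow> \<psi> x = 0" "\<And>x. norm x \<ge> R \<Longrightarrow> grad \<psi> x = 0"
    using grad_support[OF psi] by metis
  let ?S = "\<lambda>t x. \<psi> x * ((A x \<bullet> (g (x + t *\<^sub>R b) - g x)) / t)"
  let ?T = "\<lambda>t x. (A x \<bullet> grad \<psi> x) * diff_quot u b t x"
  let ?W = "\<lambda>t x. \<psi> x * ((G (x + t *\<^sub>R b) - G x) / t)"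
  have Aloc: "Lp_loc p' (\<lambda>x. A x \<bullet> grad \<psi> x)" by (rule A_inner_loc[OF _ L]) measurable
  have T: "((\<lambda>t. \<integral>x. ?T t x \<partial>lborel) \<longlongrightarrow> (LBINT x. (A x \<bullet> grad \<psi> x) * (g x \<bullet> b))) (at 0)"
    by (rule difference_quotient_pairing[OF wu b exponents g_comp_loc[OF b] Aloc u_loc, of R]) (use R in simp)
  have iT: "integrable lborel (?T t)" for t
  proof -
    have "integrable lborel (\<lambda>x. cut R x * ((u (x + t *\<^sub>R b) - u x) * (A x \<bullet> grad \<psi> x)))"
      using exponents by (intro Lp_loc_mult_integrable[OF exponents _ Aloc] Lp_loc_diff Lp_loc_shift u_loc) auto
    moreover have "cut R x * ((u (x + t *\<^sub>R b) - u x) * (A x \<bullet> grad \<psi> x)) = (A x \<bullet> grad \<psi> x) * (u (x + t *\<^sub>R b) - u x)" for x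
      using R(2)[of x] by (cases "norm x \<le> R") auto
    ultimately show ?thesis by simp
  qed
  have sum_eq: "A x \<bullet> (\<psi> x *\<^sub>R (g (x + t *\<^sub>R b) - g x) + (u (x + t *\<^sub>R b) - u x) *\<^sub>R grad \<psi> x) / t = ?S t x + ?T t x" for t x
    by (simp add: inner_add_right add_divide_distrib mult.commute)
  have iST: "integrable lborel (\<lambda>x. ?S t x + ?T t x)" for t
    using integrable_divide[OF weak_difference_quotient(1)[OF psi, of "t *\<^sub>R b"], of t] unfolding sum_eq .
  have iS: "integrable lborel (?S t)" for t
    using Bochner_Integration.integrable_diff[OF iST[of t] iT[of t]] by simp
  have W: "((\<lambda>t. \<integral>x. ?W t x \<partial>lborel) \<longlongrightarrow> - (LBINT x. G x * (grad \<psi> x \<bullet> b))) (at 0)"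
    and iW: "integrable lborel (?W t)" for t
    by (rule difference_quotient_by_parts[OF G_int psi b])+
  \<comment> \<open>\<open>G_error\<close> divided by \<bar>t\<bar>: for each component, a vanishing
    translation error of \<open>A\<close> is paired with a bounded difference quotient of
    \<open>g\<close>.\<close>
  have "((\<lambda>t. \<integral>\<^sup>+x. ennreal \<bar>?W t x - ?S t x\<bar> \<partial>lborel) \<longlongrightarrow> 0) (at 0)"
  proof (rule tendsto_0_nn_integral_mono[where C = B and I = Basis and
        g = "\<lambda>c t x. (cut R x * (A (x + t *\<^sub>R b) \<bullet> c - A x \<bullet> c))
          * (cut R x * ((g (x + t *\<^sub>R b) \<bullet> c - g x \<bullet> c) / t))"])
    fix c :: 'a assume c: "c \<in> Basis"
    show "((\<lambda>t. \<integral>\<^sup>+x. ennreal \<bar>(cut R x * (A (x + t *\<^sub>R b) \<bullet> c - A x \<bullet> c))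
          * (cut R x * ((g (x + t *\<^sub>R b) \<bullet> c - g x \<bullet> c) / t))\<bar> \<partial>lborel) \<longlongrightarrow> 0) (at 0)"
      by (rule translation_difference_quotient[OF wg[OF c] b exponents H_loc[OF b c] A_inner_loc[where w = "\<lambda>x. c" and K = 1]])
        (use c in auto)
  next
    fix t x
    show "\<bar>?W t x - ?S t x\<bar> \<le> B * (\<Sum>c\<in>Basis. \<bar>(cut R x * (A (x + t *\<^sub>R b) \<bullet> c - A x \<bullet> c))
          * (cut R x * ((g (x + t *\<^sub>R b) \<bullet> c - g x \<bullet> c) / t))\<bar>)"
    proof (cases "norm x \<le> R")
      case True
      have "\<bar>?W t x - ?S t x\<bar> = \<bar>\<psi> x\<bar> * (\<bar>G (x + t *\<^sub>R b) - G x - A x \<bullet> (g (x + t *\<^sub>R b) - g x)\<bar> / \<bar>t\<bar>)"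
        by (simp add: abs_mult[symmetric] right_diff_distrib diff_divide_distrib flip: abs_divide)
      also have "\<dots> \<le> B * ((\<Sum>c\<in>Basis. \<bar>A (x + t *\<^sub>R b) \<bullet> c - A x \<bullet> c\<bar> * \<bar>g (x + t *\<^sub>R b) \<bullet> c - g x \<bullet> c\<bar>) / \<bar>t\<bar>)"
        using B G_error by (intro mult_mono divide_right_mono) auto
      finally show ?thesis
        using True by (simp add: abs_mult sum_divide_distrib)
    next
      case False
      then show ?thesis using R(1)[of x] by simp
    qed
  qed (use B in auto)
  from tendsto_integral_0[OF this]
  have "((\<lambda>t. (LBINT x. ?W t x) - (LBINT x. ?S t x)) \<longlongrightarrow> 0) (at 0)"
    by (simp only: Bochner_Integration.integral_diff[OF iW iS])
  from tendsto_add[OF tendsto_diff[OF W this] T]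
  have "((\<lambda>t. (LBINT x. ?S t x) + (LBINT x. ?T t x)) \<longlongrightarrow>
     - (LBINT x. G x * (grad \<psi> x \<bullet> b)) + (LBINT x. (A x \<bullet> grad \<psi> x) * (g x \<bullet> b))) (at 0)"
    by simp
  moreover have "(LBINT x. ?S t x) + (LBINT x. ?T t x)
    = (LBINT x. A x \<bullet> (\<psi> x *\<^sub>R (g (x + t *\<^sub>R b) - g x) + (u (x + t *\<^sub>R b) - u x) *\<^sub>R grad \<psi> x)) / t" for t
    unfolding Bochner_Integration.integral_add[OF iS iT, symmetric] sum_eq[symmetric] by simp
  ultimately show ?thesis by (simp only:)
qed

text \<open>Integration by parts gives the limit of \<open>?W\<close> and the weak formulation that
  of \<open>?N\<close>, so \<open>?W - ?N\<close> has the limit \<open>- ?l\<close>. What has to be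
  shown is that the Taylor remainder of \<open>F\<close> integrates to 0 in the limit.\<close>

theorem local_identity:
  assumes psi: "\<psi> \<in> test_functions" and nonneg: "\<And>x. \<psi> x \<ge> 0" and b: "b \<in> Basis"
  shows "(LBINT x. F (u x) * (grad \<psi> x \<bullet> b)) - (LBINT x. G x * (grad \<psi> x \<bullet> b))
     + (LBINT x. (A x \<bullet> grad \<psi> x) * (g x \<bullet> b)) = 0" (is "?l = 0")
proof -
  note [measurable] = test_functions_measurable[OF psi]
  obtain B where B: "B > 0" "\<And>x. \<bar>\<psi> x\<bar> \<le> B" using test_functions_bounded[OF psi] by blast
  obtain R where R: "\<And>x. norm x \<ge> R \<Longrightarrow> \<psi> x = 0" using test_functions_support[OF psi] by blast
  let ?W = "\<lambda>t x. \<psi> x * ((F (u (x + t *\<^sub>R b)) - F (u x)) / t)"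
  let ?N = "\<lambda>t x. f (u x) * (\<psi> x * (u (x + t *\<^sub>R b) - u x)) / t"
  let ?e = "\<lambda>t x. \<psi> x * (\<Sum>i<n. \<bar>k i (u (x + t *\<^sub>R b)) - k i (u x)\<bar>) * \<bar>diff_quot u b t x\<bar>"
  have W: "((\<lambda>t. \<integral>x. ?W t x \<partial>lborel) \<longlongrightarrow> - (LBINT x. F (u x) * (grad \<psi> x \<bullet> b))) (at 0)"
    and iW: "integrable lborel (?W t)" for t
    by (rule difference_quotient_by_parts[OF F_int psi b])+
  have iN: "integrable lborel (?N t)" for t
    by (intro integrable_divide weak_difference_quotient(2)[OF psi])
  have N: "((\<lambda>t. \<integral>x. ?N t x \<partial>lborel) \<longlongrightarrow> - (LBINT x. G x * (grad \<psi> x \<bullet> b)) + (LBINT x. (A x \<bullet> grad \<psi> x) * (g x \<bullet> b))) (at 0)"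
    using principal_part_limit[OF psi b] by (simp add: weak_difference_quotient(3)[OF psi])
  have E: "((\<lambda>t. \<integral>x. ?W t x - ?N t x \<partial>lborel) \<longlongrightarrow> - ?l) (at 0)"
  proof -
    have "((\<lambda>t. (LBINT x. ?W t x) - (LBINT x. ?N t x)) \<longlongrightarrow> - ?l) (at 0)"
      using tendsto_diff[OF W N] by (simp only: minus_add_distrib diff_conv_add_uminus minus_minus ac_simps)
    then show ?thesis by (simp only: Bochner_Integration.integral_diff[OF iW iN])
  qed
  have km: "(\<lambda>x. k i (u x)) \<in> borel_measurable borel" if "i < n" for i
    using measurable_compose[OF u_meas k_meas[OF that]] .
  have kloc: "Lp_loc p' (\<lambda>x. k i (u x))" if "i < n" for i
    using k_bounded[OF that] Lp_loc_bounded[OF km[OF that], of _ p'] exponents by fastforce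
  have [measurable]: "(\<lambda>x. k i (u x)) \<in> borel_measurable borel" "(\<lambda>x. k i (u (x + y))) \<in> borel_measurable borel"
    if "i \<in> {..<n}" for i y
    using that km[of i] measurable_compose[OF _ km[of i], of "\<lambda>x. x + y" borel] by auto
  have bound: "\<bar>?e t x\<bar> \<le> B * (\<Sum>i<n. \<bar>(cut R x * (k i (u (x + t *\<^sub>R b)) - k i (u x)))
          * (cut R x * diff_quot u b t x)\<bar>)" for t x
  proof (cases "norm x \<le> R")
    case True
    have "\<bar>?e t x\<bar> = \<bar>\<psi> x\<bar> * (\<Sum>i<n. \<bar>(k i (u (x + t *\<^sub>R b)) - k i (u x)) * diff_quot u b t x\<bar>)"
      unfolding abs_mult sum_distrib_right[symmetric] by (simp add: sum_nonneg)
    also have "\<dots> \<le> B * (\<Sum>i<n. \<bar>(k i (u (x + t *\<^sub>R b)) - k i (u x)) * diff_quot u b t x\<bar>)"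
      using B by (intro mult_right_mono sum_nonneg) auto
    finally show ?thesis using True by simp
  next
    case False
    then show ?thesis using R[of x] by simp
  qed
  have "((\<lambda>t. \<integral>\<^sup>+x. ennreal \<bar>?e t x\<bar> \<partial>lborel) \<longlongrightarrow> 0) (at 0)"
  proof (rule tendsto_0_nn_integral_mono[where C = B and I = "{..<n}", OF _ _ _ bound])
    fix i assume i: "i \<in> {..<n}"
    then show "((\<lambda>t. \<integral>\<^sup>+x. ennreal \<bar>(cut R x * (k i (u (x + t *\<^sub>R b)) - k i (u x)))
          * (cut R x * diff_quot u b t x)\<bar> \<partial>lborel) \<longlongrightarrow> 0) (at 0)"
      by (intro translation_difference_quotient[OF wu b exponents g_comp_loc[OF b] kloc]) simp
    show "(\<lambda>x. (cut R x * (k i (u (x + t *\<^sub>R b)) - k i (u x)))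
          * (cut R x * diff_quot u b t x)) \<in> borel_measurable borel" for t
      using i by measurable
  qed (use B in auto)
  from tendsto_integral_0[OF this]
  have e: "((\<lambda>t. \<integral>x. ?e t x \<partial>lborel) \<longlongrightarrow> 0) (at 0)" .
  have ie: "integrable lborel (?e t)" for t
  proof (rule Bochner_Integration.integrable_bound)
    have "integrable lborel (\<lambda>x. cut R x * ((u (x + t *\<^sub>R b) - u x) * (k i (u (x + t *\<^sub>R b)) - k i (u x))))"
      if "i < n" for i
      using exponents that by (intro Lp_loc_mult_integrable[OF exponents] Lp_loc_diff u_loc kloc
          Lp_loc_shift[where f = u] Lp_loc_shift[where f = "\<lambda>x. k i (u x)"]) auto
    then show "integrable lborel (\<lambda>x. B * (\<Sum>i<n. (1 / \<bar>t\<bar>) * \<bar>cut R x * ((u (x + t *\<^sub>R b) - u x) * (k i (u (x + t *\<^sub>R b)) - k i (u x)))\<bar>))"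
      by (intro integrable_mult_right Bochner_Integration.integrable_sum integrable_abs) auto
    show "AE x in lborel. norm (?e t x) \<le> norm (B * (\<Sum>i<n. (1 / \<bar>t\<bar>) * \<bar>cut R x * ((u (x + t *\<^sub>R b) - u x) * (k i (u (x + t *\<^sub>R b)) - k i (u x)))\<bar>))"
    proof (rule AE_I2)
      fix x
      have eq: "\<bar>(cut R x * (k i (u (x + t *\<^sub>R b)) - k i (u x)))
          * (cut R x * diff_quot u b t x)\<bar>
        = (1 / \<bar>t\<bar>) * \<bar>cut R x * ((u (x + t *\<^sub>R b) - u x) * (k i (u (x + t *\<^sub>R b)) - k i (u x)))\<bar>" for i
        by (cases "norm x \<le> R") (auto simp: abs_mult)
      show "norm (?e t x) \<le> norm (B * (\<Sum>i<n. (1 / \<bar>t\<bar>) * \<bar>cut R x * ((u (x + t *\<^sub>R b) - u x) * (k i (u (x + t *\<^sub>R b)) - k i (u x)))\<bar>))"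
        using bound[where t = t and x = x] unfolding eq real_norm_def by (rule order_trans[OF _ abs_ge_self])
    qed
  qed (intro borel_measurable_times borel_measurable_sum borel_measurable_abs borel_measurable_divide
      borel_measurable_diff; measurable)
  \<comment> \<open>Dividing \<open>nonlinearity\<close> by \<bar>t\<bar> keeps its direction and
    produces \<open>sgn t\<close>; multiplying by \<psi> requires \<psi> \<ge> 0. At
    \<open>t = 0\<close> all quotients are 0 by convention.\<close>
  have le: "0 \<le> sgn t * \<sigma> * (?W t x - ?N t x) + ?e t x" for t x
  proof (cases "t = 0")
    case False
    let ?y = "u x" and ?z = "u (x + t *\<^sub>R b)"
    have "0 \<le> \<psi> x / \<bar>t\<bar> * (\<sigma> * (F ?z - F ?y - f ?y * (?z - ?y)) + (\<Sum>i<n. \<bar>k i ?z - k i ?y\<bar>) * \<bar>?z - ?y\<bar>)"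
      using nonlinearity[of ?z ?y] nonneg[of x] by (intro mult_nonneg_nonneg) auto
    also have "\<dots> = sgn t * \<sigma> * (?W t x - ?N t x) + ?e t x"
      using False by (simp add: sgn_if abs_if[of t] divide_simps) (simp add: algebra_simps)
    finally show ?thesis .
  qed simp
  have pos: "0 \<le> sgn t * \<sigma> * (LBINT x. ?W t x - ?N t x) + (LBINT x. ?e t x)" for t
  proof -
    have "0 \<le> (LBINT x. sgn t * \<sigma> * (?W t x - ?N t x) + ?e t x)"
      by (rule Bochner_Integration.integral_nonneg[OF le])
    also have "\<dots> = sgn t * \<sigma> * (LBINT x. ?W t x - ?N t x) + (LBINT x. ?e t x)"
      by (subst Bochner_Integration.integral_add[OF integrable_mult_right[OF Bochner_Integration.integrable_diff[OF iW iN]] ie])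
        (simp only: integral_mult_right_zero)
    finally show ?thesis .
  qed
  have lim: "((\<lambda>t. s * \<sigma> * (LBINT x. ?W t x - ?N t x) + (LBINT x. ?e t x)) \<longlongrightarrow> s * \<sigma> * - ?l + 0) (at 0)" for s
    by (intro tendsto_intros E e)
  \<comment> \<open>The limit from the right bounds \<open>\<sigma> * - ?l\<close> below by 0 and
    the limit from the left bounds it above by 0, so \<open>?l = 0\<close> for either sign
    \<sigma>.\<close>
  have "0 \<le> 1 * \<sigma> * - ?l + 0"
  proof (rule tendsto_lowerbound[OF filterlim_mono[OF lim order_refl]])
    show "at_right 0 \<le> at (0::real)" by (simp add: at_le)
    show "\<forall>\<^sub>F t in at_right 0. 0 \<le> 1 * \<sigma> * (LBINT x. ?W t x - ?N t x) + (LBINT x. ?e t x)"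
    proof (rule eventually_mono)
      show "\<forall>\<^sub>F t in at_right (0::real). t > 0" by (simp add: eventually_at_filter)
      show "0 \<le> 1 * \<sigma> * (LBINT x. ?W t x - ?N t x) + (LBINT x. ?e t x)" if "t > 0" for t
        using pos[of t] unfolding sgn_pos[OF that] .
    qed
  qed simp
  moreover have "0 \<le> (-1) * \<sigma> * - ?l + 0"
  proof (rule tendsto_lowerbound[OF filterlim_mono[OF lim order_refl]])
    show "at_left 0 \<le> at (0::real)" by (simp add: at_le)
    show "\<forall>\<^sub>F t in at_left 0. 0 \<le> (-1) * \<sigma> * (LBINT x. ?W t x - ?N t x) + (LBINT x. ?e t x)"
    proof (rule eventually_mono)
      show "\<forall>\<^sub>F t in at_left (0::real). t < 0" by (simp add: eventually_at_filter)
      show "0 \<le> (-1) * \<sigma> * (LBINT x. ?W t x - ?N t x) + (LBINT x. ?e t x)" if "t < 0" for t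
        using pos[of t] unfolding sgn_neg[OF that] .
    qed
  qed simp
  ultimately show ?thesis using \<sigma> by auto
qed

end

section \<open>The global Pohozaev identity\<close>

text \<open>The squared norm is written as a polynomial in the coordinates so that the closure rules
  for \<open>C_k\<close> apply.\<close>

definition bump :: "'a::euclidean_space \<Rightarrow> real" where
  "bump x = flat 0 (1 - (\<Sum>b\<in>Basis. (x \<bullet> b) * (x \<bullet> b)))"

lemma bump_eq: "bump x = flat 0 (1 - (norm x)\<^sup>2)"
  by (simp add: bump_def power2_norm_eq_inner euclidean_inner[of x x])

lemma bump_eq_0: "norm x \<ge> 1 \<Longrightarrow> bump x = 0"
  using one_le_power[of "norm x" 2] by (simp add: bump_eq flat_def not_less del: one_le_power)

lemma bump_nonneg: "bump x \<ge> 0"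
  by (simp add: bump_def flat_nonneg)

lemma bump_le_1: "bump x \<le> 1"
  by (simp add: bump_def flat_0_le_1)

lemma bump_0_pos: "bump 0 > 0"
  by (simp add: bump_def flat_def)

lemma bump_test: "(bump :: 'a::euclidean_space \<Rightarrow> real) \<in> test_functions"
proof (rule test_functionsI[of _ 1])
  show "C_k k (bump :: 'a \<Rightarrow> real)" for k
    unfolding bump_def[abs_def]
    by (intro C_k_flat C_k_diff C_k_const C_k_sum C_k_mult C_k_inner finite_Basis)
qed (simp add: bump_eq_0)

lemma grad_scale:
  assumes "\<phi> \<in> test_functions"
  shows "grad (\<lambda>x. \<phi> (c *\<^sub>R x)) x = c *\<^sub>R grad \<phi> (c *\<^sub>R x)"
proof (rule grad_eqI)
  have "((\<lambda>x. c *\<^sub>R x) has_derivative (\<lambda>h. c *\<^sub>R h)) (at x)"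
    by (auto intro!: derivative_eq_intros)
  from has_derivative_compose[OF this test_functions_has_grad[OF assms]]
  show "((\<lambda>x. \<phi> (c *\<^sub>R x)) has_derivative (\<lambda>h. c *\<^sub>R grad \<phi> (c *\<^sub>R x) \<bullet> h)) (at x)" by simp
qed

lemma grad_mult_affine:
  assumes "\<phi> \<in> test_functions"
  shows "grad (\<lambda>x. \<phi> x * (x \<bullet> b + a)) x = \<phi> x *\<^sub>R b + (x \<bullet> b) *\<^sub>R grad \<phi> x + a *\<^sub>R grad \<phi> x"
proof (rule grad_eqI)
  have "((\<lambda>x. x \<bullet> b + a) has_derivative (\<lambda>h. h \<bullet> b)) (at x)"
    by (auto intro!: derivative_eq_intros)
  from has_derivative_mult[OF test_functions_has_grad[OF assms] this]
  show "((\<lambda>x. \<phi> x * (x \<bullet> b + a)) has_derivative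
     (\<lambda>h. (\<phi> x *\<^sub>R b + (x \<bullet> b) *\<^sub>R grad \<phi> x + a *\<^sub>R grad \<phi> x) \<bullet> h)) (at x)"
    by (simp add: inner_add_left algebra_simps inner_commute[of b])
qed

context quasilinear_solution
begin

text \<open>The energy-momentum tensor of the equation, contracted with a field \<open>w\<close> and
  the direction \<open>b\<close>. \<open>local_identity\<close> says that it integrates to 0 for
  \<open>w\<close> the gradient of a nonnegative test function; linearity in \<open>w\<close> then
  allows differences.\<close>

definition stress :: "('a \<Rightarrow> 'a) \<Rightarrow> 'a \<Rightarrow> 'a \<Rightarrow> real" where
  "stress w b x = (F (u x) - G x) * (w x \<bullet> b) + (A x \<bullet> w x) * (g x \<bullet> b)"

lemma A_inner_g: "A x \<bullet> g x = norm (g x) powr p + norm (g x) powr q"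
  by (simp add: A_def inner_add_left power_field_self)

text \<open>Makes the second term of \<open>stress\<close> integrable over the whole space for
  bounded \<open>w\<close>, although the flux alone was placed only in a local space.\<close>

lemma norm_A_times_norm_g: "norm (A x) * norm (g x) \<le> norm (g x) powr p + norm (g x) powr q"
proof -
  have "norm (g x) powr (m - 1) * norm (g x) = norm (g x) powr m" for m
    using powr_add[of "norm (g x)" "m - 1" 1] by (cases "g x = 0") auto
  moreover have "norm (A x) \<le> norm (g x) powr (p - 1) + norm (g x) powr (q - 1)"
    unfolding A_def using norm_triangle_ineq[of "power_field p (g x)" "power_field q (g x)"] by (simp add: norm_power_field)
  then have "norm (A x) * norm (g x) \<le> (norm (g x) powr (p - 1) + norm (g x) powr (q - 1)) * norm (g x)"
    by (intro mult_right_mono) auto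
  ultimately show ?thesis by (simp add: distrib_right)
qed

lemma Fu_measurable [measurable]: "(\<lambda>x. F (u x)) \<in> borel_measurable borel"
  using F_int by (auto dest: borel_measurable_integrable)

lemma stress_integrable:
  assumes [measurable]: "w \<in> borel_measurable borel" and w: "\<And>x. norm (w x) \<le> K" and b: "b \<in> Basis"
  shows "integrable lborel (stress w b)"
    "integrable lborel (\<lambda>x. (F (u x) - G x) * (w x \<bullet> b))" "integrable lborel (\<lambda>x. (A x \<bullet> w x) * (g x \<bullet> b))"
proof -
  have K: "K \<ge> 0" using order_trans[OF norm_ge_zero w] .
  show i1: "integrable lborel (\<lambda>x. (F (u x) - G x) * (w x \<bullet> b))"
  proof (rule Bochner_Integration.integrable_bound)
    show "integrable lborel (\<lambda>x. K * \<bar>F (u x) - G x\<bar>)" using F_int G_int by simp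
    show "AE x in lborel. norm ((F (u x) - G x) * (w x \<bullet> b)) \<le> norm (K * \<bar>F (u x) - G x\<bar>)"
    proof (rule AE_I2)
      fix x
      have "\<bar>w x \<bullet> b\<bar> \<le> K" using Basis_le_norm[OF b, of "w x"] w[of x] by linarith
      then show "norm ((F (u x) - G x) * (w x \<bullet> b)) \<le> norm (K * \<bar>F (u x) - G x\<bar>)"
        using K by (simp add: abs_mult mult.commute[of "F (u x) - G x"] mult_right_mono)
    qed
  qed measurable
  show i2: "integrable lborel (\<lambda>x. (A x \<bullet> w x) * (g x \<bullet> b))"
  proof (rule Bochner_Integration.integrable_bound)
    show "integrable lborel (\<lambda>x. K * (norm (g x) powr p + norm (g x) powr q))" using gp gq by simp
    show "AE x in lborel. norm ((A x \<bullet> w x) * (g x \<bullet> b)) \<le> norm (K * (norm (g x) powr p + norm (g x) powr q))"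
    proof (rule AE_I2)
      fix x
      have "\<bar>A x \<bullet> w x\<bar> * \<bar>g x \<bullet> b\<bar> \<le> (norm (A x) * norm (w x)) * norm (g x)"
        using Basis_le_norm[OF b] by (intro mult_mono Cauchy_Schwarz_ineq2) auto
      also have "\<dots> \<le> (norm (A x) * K) * norm (g x)"
        using w by (intro mult_right_mono mult_left_mono) auto
      also have "\<dots> \<le> K * (norm (g x) powr p + norm (g x) powr q)"
        using mult_left_mono[OF norm_A_times_norm_g K] by (simp add: mult_ac)
      also have "\<dots> \<le> norm (K * (norm (g x) powr p + norm (g x) powr q))" by simp
      finally show "norm ((A x \<bullet> w x) * (g x \<bullet> b)) \<le> norm (K * (norm (g x) powr p + norm (g x) powr q))"
        by (simp only: real_norm_def abs_mult)
    qed
  qed measurable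
  show "integrable lborel (stress w b)"
    unfolding stress_def[abs_def] by (rule Bochner_Integration.integrable_add[OF i1 i2])
qed

lemma stress_identity:
  assumes psi: "\<psi> \<in> test_functions" and nonneg: "\<And>x. \<psi> x \<ge> 0" and b: "b \<in> Basis"
  shows "integrable lborel (stress (grad \<psi>) b)" "(LBINT x. stress (grad \<psi>) b x) = 0"
proof -
  note m = grad_measurable[OF psi]
  obtain K where K: "\<And>x. norm (grad \<psi> x) \<le> K" using grad_bounded[OF psi] by blast
  note i = stress_integrable[OF m K b]
  show "integrable lborel (stress (grad \<psi>) b)" by (rule i)
  have bd: "integrable lborel (\<lambda>x. w x * (grad \<psi> x \<bullet> b))" if w: "integrable lborel w" for w :: "'a \<Rightarrow> real"
  proof (rule Bochner_Integration.integrable_bound[OF integrable_mult_right[OF w, of K]])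
    show "AE x in lborel. norm (w x * (grad \<psi> x \<bullet> b)) \<le> norm (K * w x)"
    proof (rule AE_I2)
      fix x
      have "\<bar>grad \<psi> x \<bullet> b\<bar> \<le> \<bar>K\<bar>" using Basis_le_norm[OF b, of "grad \<psi> x"] K[of x] by linarith
      then show "norm (w x * (grad \<psi> x \<bullet> b)) \<le> norm (K * w x)"
        unfolding real_norm_def abs_mult by (subst mult.commute) (rule mult_right_mono, auto)
    qed
  qed (use w m in measurable)
  have "(LBINT x. stress (grad \<psi>) b x) = (LBINT x. (F (u x) - G x) * (grad \<psi> x \<bullet> b))
     + (LBINT x. (A x \<bullet> grad \<psi> x) * (g x \<bullet> b))"
    unfolding stress_def by (rule Bochner_Integration.integral_add[OF i(2,3)])
  also have "(LBINT x. (F (u x) - G x) * (grad \<psi> x \<bullet> b))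
     = (LBINT x. F (u x) * (grad \<psi> x \<bullet> b)) - (LBINT x. G x * (grad \<psi> x \<bullet> b))"
    unfolding left_diff_distrib by (rule Bochner_Integration.integral_diff[OF bd[OF F_int] bd[OF G_int]])
  finally show "(LBINT x. stress (grad \<psi>) b x) = 0"
    using local_identity[OF psi nonneg b] by simp
qed

text \<open>Here \<open>w\<close> is the gradient of \<eta>(x) times the coordinate along
  \<open>b\<close>, which changes sign. Adding \<eta> / c makes the function nonnegative, and the
  identity for the nonnegative \<eta> removes the addition.\<close>

lemma stress_dilation:
  assumes b: "b \<in> Basis" and c: "c > 0"
  defines "\<eta> \<equiv> \<lambda>x::'a. bump (c *\<^sub>R x)"
  defines "w \<equiv> \<lambda>x. \<eta> x *\<^sub>R b + (x \<bullet> b) *\<^sub>R grad \<eta> x"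
  shows "integrable lborel (stress w b)" "(LBINT x. stress w b x) = 0"
proof -
  have eta: "\<eta> \<in> test_functions"
    unfolding \<eta>_def using test_functions_affine[OF bump_test, of c 0] c by simp
  \<comment> \<open>On the support of \<eta> one has \<bar>x\<bar> \<le> 1 / c, so this shift is
    just enough for a nonnegative factor.\<close>
  define \<psi> where "\<psi> x = \<eta> x * (x \<bullet> b + 1 / c)" for x
  have psi: "\<psi> \<in> test_functions"
    unfolding \<psi>_def by (intro test_functions_mult[OF eta] C_k_add C_k_inner C_k_const)
  have nonneg: "\<psi> x \<ge> 0" for x
  proof (cases "norm (c *\<^sub>R x) \<ge> 1")
    case True
    then show ?thesis by (simp add: \<psi>_def \<eta>_def bump_eq_0)
  next
    case False
    then have "norm x \<le> 1 / c" using c by (simp add: field_simps)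
    then have "x \<bullet> b + 1 / c \<ge> 0" using Basis_le_norm[OF b, of x] by linarith
    then show ?thesis by (simp add: \<psi>_def \<eta>_def bump_nonneg)
  qed
  note i = stress_identity[OF psi nonneg b] stress_identity[OF eta _ b]
  have eta0: "\<And>x. \<eta> x \<ge> 0" by (simp add: \<eta>_def bump_nonneg)
  have eq: "stress w b = (\<lambda>x. stress (grad \<psi>) b x - (1 / c) * stress (grad \<eta>) b x)"
    unfolding stress_def w_def \<psi>_def[abs_def] grad_mult_affine[OF eta]
    by (rule ext) (simp add: inner_add_left inner_add_right algebra_simps)
  show "integrable lborel (stress w b)"
    unfolding eq by (intro Bochner_Integration.integrable_diff integrable_mult_right i eta0)
  have "(LBINT x. stress w b x) = (LBINT x. stress (grad \<psi>) b x) - (LBINT x. (1 / c) * stress (grad \<eta>) b x)"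
    unfolding eq by (intro Bochner_Integration.integral_diff integrable_mult_right i eta0)
  also have "\<dots> = 0"
    using i(2) i(4)[OF eta0] by simp
  finally show "(LBINT x. stress w b x) = 0" .
qed

text \<open>Summing over the basis takes traces, which produces the dimension and the products of
  \<open>x\<close> and \<open>A\<close> with \<open>g\<close>. The cutoff and its gradient then
  enter only through \<open>c *\<^sub>R x\<close>, which gives bounds uniform in
  \<open>c\<close>.\<close>

lemma dilation_identity:
  assumes c: "c > 0"
  shows "(LBINT x. (F (u x) - G x) * (DIM('a) * bump (c *\<^sub>R x) + (c *\<^sub>R x) \<bullet> grad bump (c *\<^sub>R x))
     + bump (c *\<^sub>R x) * (A x \<bullet> g x) + (A x \<bullet> grad bump (c *\<^sub>R x)) * ((c *\<^sub>R x) \<bullet> g x)) = 0"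
proof -
  let ?w = "\<lambda>b x. bump (c *\<^sub>R x) *\<^sub>R b + (x \<bullet> b) *\<^sub>R grad (\<lambda>x. bump (c *\<^sub>R x)) x"
  have eq: "(\<Sum>b\<in>Basis. stress (?w b) b x) = (F (u x) - G x) * (DIM('a) * bump (c *\<^sub>R x) + (c *\<^sub>R x) \<bullet> grad bump (c *\<^sub>R x))
     + bump (c *\<^sub>R x) * (A x \<bullet> g x) + (A x \<bullet> grad bump (c *\<^sub>R x)) * ((c *\<^sub>R x) \<bullet> g x)" for x
  proof -
    let ?\<eta> = "bump (c *\<^sub>R x)" and ?v = "c *\<^sub>R grad bump (c *\<^sub>R x)"
    have "(\<Sum>b\<in>Basis. stress (?w b) b x)
      = (\<Sum>b\<in>Basis. (F (u x) - G x) * (?\<eta> + (x \<bullet> b) * (?v \<bullet> b))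
        + ?\<eta> * ((A x \<bullet> b) * (g x \<bullet> b)) + (A x \<bullet> ?v) * ((x \<bullet> b) * (g x \<bullet> b)))"
      unfolding grad_scale[OF bump_test]
      by (intro sum.cong refl) (simp add: stress_def inner_add_left inner_add_right algebra_simps)
    also have "\<dots> = (F (u x) - G x) * (DIM('a) * ?\<eta> + (\<Sum>b\<in>Basis. (x \<bullet> b) * (?v \<bullet> b)))
        + ?\<eta> * (\<Sum>b\<in>Basis. (A x \<bullet> b) * (g x \<bullet> b)) + (A x \<bullet> ?v) * (\<Sum>b\<in>Basis. (x \<bullet> b) * (g x \<bullet> b))"
      by (simp only: sum.distrib sum_distrib_left[symmetric] sum_constant distrib_left[symmetric])
    also have "\<dots> = (F (u x) - G x) * (DIM('a) * ?\<eta> + x \<bullet> ?v) + ?\<eta> * (A x \<bullet> g x) + (A x \<bullet> ?v) * (x \<bullet> g x)"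
      by (simp only: euclidean_inner[symmetric])
    finally show ?thesis by simp
  qed
  have "(LBINT x. (\<Sum>b\<in>Basis. stress (?w b) b x)) = (\<Sum>b\<in>Basis. \<integral>x. stress (?w b) b x \<partial>lborel)"
    by (rule Bochner_Integration.integral_sum) (rule stress_dilation(1)[OF _ c])
  also have "\<dots> = 0"
    by (intro sum.neutral ballI stress_dilation(2)[OF _ c])
  finally show ?thesis unfolding eq .
qed

text \<open>Dominated convergence in \<open>dilation_identity\<close> as \<open>c\<close> tends to
  0. The products of \<open>y = c *\<^sub>R x\<close> with \<open>grad bump y\<close> are bounded by
  \<open>R * L\<close>, since the gradient has compact support, and they tend to 0 pointwise with
  \<open>y\<close>.\<close>

theorem global_identity:
  "real DIM('a) * (LBINT x. F (u x)) + (1 - real DIM('a) / p) * (LBINT x. norm (g x) powr p)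
     + (1 - real DIM('a) / q) * (LBINT x. norm (g x) powr q) = 0"
proof -
  let ?N = "real DIM('a)"
  note [measurable] = test_functions_measurable[OF bump_test[where 'a = 'a]] grad_measurable[OF bump_test[where 'a = 'a]]
  obtain L where L: "L > 0" "\<And>y::'a. norm (grad bump y) \<le> L" using grad_bounded[OF bump_test] by blast
  obtain R where R: "R > 0" "\<And>y::'a. norm y \<ge> R \<Longrightarrow> grad bump y = 0" using grad_support[OF bump_test] by metis
  have RL: "norm y * norm (grad bump y) \<le> R * L" for y :: 'a
  proof (cases "norm y \<ge> R")
    case False
    then show ?thesis using L(2)[of y] R(1) by (intro mult_mono) auto
  qed (use R L in simp)
  let ?I = "\<lambda>y x. (F (u x) - G x) * (?N * bump y + y \<bullet> grad bump y)
     + bump y * (A x \<bullet> g x) + (A x \<bullet> grad bump y) * (y \<bullet> g x)"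
  define Z where "Z x = norm (g x) powr p + norm (g x) powr q" for x
  have Z: "integrable lborel Z" unfolding Z_def[abs_def] by (intro Bochner_Integration.integrable_add gp gq)
  have Zn: "Z x \<ge> 0" for x by (simp add: Z_def)
  define c where "c n = inverse (real (Suc n))" for n
  have c: "c n > 0" for n by (simp add: c_def)
  have clim: "c \<longlonglongrightarrow> 0" unfolding c_def[abs_def] by (rule LIMSEQ_inverse_real_of_nat)
  have "(\<lambda>n. \<integral>x. ?I (c n *\<^sub>R x) x \<partial>lborel) \<longlonglongrightarrow> (LBINT x. ?I 0 x)"
  proof (rule integral_dominated_convergence[where w = "\<lambda>x. \<bar>F (u x) - G x\<bar> * (?N + R * L) + (1 + R * L) * Z x"])
    show "integrable lborel (\<lambda>x. \<bar>F (u x) - G x\<bar> * (?N + R * L) + (1 + R * L) * Z x)"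
      using F_int G_int Z by simp
    show "AE x in lborel. (\<lambda>n. ?I (c n *\<^sub>R x) x) \<longlonglongrightarrow> ?I 0 x"
    proof (rule AE_I2)
      fix x :: 'a
      have y: "(\<lambda>n. c n *\<^sub>R x) \<longlonglongrightarrow> 0"
        using tendsto_scaleR[OF clim tendsto_const[of x]] by simp
      have "(\<lambda>n. bump (c n *\<^sub>R x)) \<longlonglongrightarrow> bump (0::'a)"
        using test_functions_continuous[OF bump_test[where 'a = 'a]]
        by (intro isCont_tendsto_compose[OF _ y]) (simp add: continuous_on_eq_continuous_at)
      moreover have "(\<lambda>n. grad bump (c n *\<^sub>R x)) \<longlonglongrightarrow> grad bump 0"
        using grad_continuous[OF bump_test[where 'a = 'a]]
        by (intro isCont_tendsto_compose[OF _ y]) (simp add: continuous_on_eq_continuous_at)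
      ultimately show "(\<lambda>n. ?I (c n *\<^sub>R x) x) \<longlonglongrightarrow> ?I 0 x"
        using y by (intro tendsto_intros)
    qed
    show "AE x in lborel. norm (?I (c n *\<^sub>R x) x) \<le> \<bar>F (u x) - G x\<bar> * (?N + R * L) + (1 + R * L) * Z x" for n
    proof (rule AE_I2)
      fix x :: 'a
      let ?y = "c n *\<^sub>R x"
      have 1: "\<bar>?N * bump ?y + ?y \<bullet> grad bump ?y\<bar> \<le> ?N + R * L"
      proof -
        have "\<bar>?N * bump ?y\<bar> \<le> ?N * 1"
          using bump_nonneg[of ?y] bump_le_1[of ?y] by (simp add: abs_mult)
        moreover have "\<bar>?y \<bullet> grad bump ?y\<bar> \<le> R * L"
          using Cauchy_Schwarz_ineq2[of ?y "grad bump ?y"] RL[of ?y] by linarith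
        ultimately show ?thesis by linarith
      qed
      have 2: "\<bar>bump ?y * (A x \<bullet> g x)\<bar> \<le> 1 * Z x"
        using bump_nonneg[of ?y] bump_le_1[of ?y] Zn[of x]
        unfolding A_inner_g Z_def[symmetric] by (simp add: abs_mult mult_left_le_one_le)
      have 3: "\<bar>(A x \<bullet> grad bump ?y) * (?y \<bullet> g x)\<bar> \<le> (R * L) * Z x"
      proof -
        have "\<bar>(A x \<bullet> grad bump ?y) * (?y \<bullet> g x)\<bar> \<le> (norm (A x) * norm (grad bump ?y)) * (norm ?y * norm (g x))"
          unfolding abs_mult by (intro mult_mono Cauchy_Schwarz_ineq2) auto
        also have "\<dots> = (norm ?y * norm (grad bump ?y)) * (norm (A x) * norm (g x))" by (simp only: mult_ac)
        also have "\<dots> \<le> (R * L) * Z x"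
          using norm_A_times_norm_g R L unfolding Z_def by (intro mult_mono RL) auto
        finally show ?thesis .
      qed
      have "\<bar>(F (u x) - G x) * (?N * bump ?y + ?y \<bullet> grad bump ?y)\<bar> \<le> \<bar>F (u x) - G x\<bar> * (?N + R * L)"
        unfolding abs_mult by (intro mult_left_mono 1) auto
      with 2 3 show "norm (?I ?y x) \<le> \<bar>F (u x) - G x\<bar> * (?N + R * L) + (1 + R * L) * Z x"
        unfolding real_norm_def distrib_right by linarith
    qed
  qed (measurable, measurable)
  moreover have "(LBINT x. ?I (c n *\<^sub>R x) x) = 0" for n
    by (rule dilation_identity[OF c])
  ultimately have "(LBINT x. ?I 0 x) = 0"
    by (simp add: LIMSEQ_const_iff)
  \<comment> \<open>At \<open>y = 0\<close> only the terms with \<open>bump 0\<close> survive;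
    subtracting the dimension times \<open>G\<close> and adding \<open>A x \<bullet> g x\<close>
    gives the coefficients 1 - N / p and 1 - N / q, where N is the dimension.\<close>
  moreover have "?I 0 x = bump (0::'a) * (?N * F (u x) + ((1 - ?N / p) * norm (g x) powr p + (1 - ?N / q) * norm (g x) powr q))" for x
    unfolding A_inner_g G_def by (simp add: algebra_simps)
  ultimately have "bump (0::'a) * (LBINT x. ?N * F (u x) + ((1 - ?N / p) * norm (g x) powr p + (1 - ?N / q) * norm (g x) powr q)) = 0"
    by (simp only: integral_mult_right_zero)
  then have "(LBINT x. ?N * F (u x) + ((1 - ?N / p) * norm (g x) powr p + (1 - ?N / q) * norm (g x) powr q)) = 0"
    unfolding mult_eq_0_iff using bump_0_pos[where 'a = 'a] by linarith
  moreover note i = integrable_mult_right[OF F_int, of ?N] integrable_mult_right[OF gp, of "1 - ?N / p"]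
    integrable_mult_right[OF gq, of "1 - ?N / q"]
  have "(LBINT x. ?N * F (u x) + ((1 - ?N / p) * norm (g x) powr p + (1 - ?N / q) * norm (g x) powr q))
    = ?N * (LBINT x. F (u x)) + ((1 - ?N / p) * (LBINT x. norm (g x) powr p)
     + (1 - ?N / q) * (LBINT x. norm (g x) powr q))"
    by (simp only: Bochner_Integration.integral_add[OF i(1) Bochner_Integration.integrable_add[OF i(2,3)]]
        Bochner_Integration.integral_add[OF i(2,3)] integral_mult_right_zero)
  ultimately show ?thesis by simp
qed

end

section \<open>The nonlinearity\<close>

definition signed_power :: "real \<Rightarrow> real \<Rightarrow> real" where
  "signed_power m x = \<bar>x\<bar> powr (m - 2) * x"

lemma signed_power_nonneg: "x \<ge> 0 \<Longrightarrow> signed_power m x = x powr (m - 1)"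
  using powr_add[of x "m - 2" 1] by (cases "x = 0") (simp_all add: signed_power_def)

lemma signed_power_minus: "signed_power m (- x) = - signed_power m x"
  by (simp add: signed_power_def)

lemma signed_power_mult_self: "signed_power m x * x = \<bar>x\<bar> powr m"
proof -
  have "signed_power m x = power_field m x"
    by (simp add: signed_power_def power_field_def)
  with power_field_self[of m x] show ?thesis by simp
qed

lemma abs_signed_power: "\<bar>signed_power m x\<bar> = \<bar>x\<bar> powr (m - 1)"
  using norm_power_field[of m x] by (simp add: signed_power_def power_field_def)

lemma signed_power_mono:
  assumes m: "m > 1" and "x \<le> y"
  shows "signed_power m x \<le> signed_power m y"
proof -
  have pos: "signed_power m a \<le> signed_power m b" if "0 \<le> a" "a \<le> b" for a b
    using that m by (simp add: signed_power_nonneg powr_mono2)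
  have nn: "0 \<le> signed_power m a" if "0 \<le> a" for a
    using that by (simp add: signed_power_nonneg)
  consider "0 \<le> x" | "y \<le> 0" | "x \<le> 0" "0 \<le> y" by linarith
  then show ?thesis
  proof cases
    case 1 with pos assms show ?thesis by simp
  next
    case 2 with pos[of "-y" "-x"] assms show ?thesis by (simp add: signed_power_minus)
  next
    case 3 with nn[of "-x"] nn[of y] show ?thesis by (simp add: signed_power_minus)
  qed
qed

lemma signed_power_measurable [measurable]: "signed_power m \<in> borel_measurable borel"
  unfolding signed_power_def[abs_def] by measurable

lemma abs_powr_has_derivative:
  assumes m: "m > 1"
  shows "((\<lambda>x. \<bar>x\<bar> powr m / m) has_real_derivative signed_power m x) (at x)"
proof -
  consider "x > 0" | "x = 0" | "x < 0" by linarith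
  then show ?thesis
  proof cases
    case 1
    have "((\<lambda>x. x powr m / m) has_real_derivative signed_power m x) (at x)"
      using 1 m by (auto intro!: derivative_eq_intros simp: signed_power_nonneg)
    then show ?thesis
      by (rule has_field_derivative_transform_within_open[of _ _ _ "{0<..}"]) (use 1 in auto)
  next
    case 3
    have "((\<lambda>x. (- x) powr m / m) has_real_derivative signed_power m x) (at x)"
      using 3 m signed_power_nonneg[of "-x" m] by (auto intro!: derivative_eq_intros simp: signed_power_minus)
    then show ?thesis
      by (rule has_field_derivative_transform_within_open[of _ _ _ "{..<0}"]) (use 3 in auto)
  next
    case 2
    \<comment> \<open>At 0 the difference quotient is at most
      \<open>\<bar>h\<bar> powr (m - 1) / m\<close> in absolute value, which vanishes because m >
      1.\<close>
    have "((\<lambda>h. \<bar>h\<bar> powr (m - 1) / m) \<longlongrightarrow> \<bar>0\<bar> powr (m - 1) / m) (at (0::real))"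
      using m by (intro tendsto_divide tendsto_powr2 tendsto_rabs tendsto_ident_at tendsto_const) (auto intro: always_eventually)
    then have z: "((\<lambda>h. \<bar>h\<bar> powr (m - 1) / m) \<longlongrightarrow> 0) (at (0::real))" by simp
    have "((\<lambda>h. (\<bar>h\<bar> powr m / m) / h) \<longlongrightarrow> 0) (at (0::real))"
    proof (rule Lim_null_comparison[OF _ z])
      have "norm ((\<bar>h\<bar> powr m / m) / h) \<le> \<bar>h\<bar> powr (m - 1) / m" for h :: real
      proof (cases "h = 0")
        case False
        then have "\<bar>h\<bar> powr m = \<bar>h\<bar> powr (m - 1) * \<bar>h\<bar>" using powr_add[of "\<bar>h\<bar>" "m - 1" 1] by simp
        then show ?thesis using False m by (simp add: abs_mult)
      qed simp
      then show "\<forall>\<^sub>F h in at 0. norm ((\<bar>h\<bar> powr m / m) / h) \<le> \<bar>h\<bar> powr (m - 1) / m"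
        by (intro always_eventually allI)
    qed
    then show ?thesis using 2 by (simp add: DERIV_def signed_power_def)
  qed
qed

text \<open>The larger exponent decides far out, and \<sigma> is the sign of its coefficient; for r
  = s the function is \<open>1 + \<mu>\<close> times a monotone one. Monotonicity on one half-line
  suffices later because the nonlinearity is odd.\<close>

lemma signed_power_sum_eventually_monotone:
  fixes r s \<mu> :: real
  assumes r: "r > 1" and s: "s > 1"
  obtains \<sigma> c where "\<sigma> = 1 \<or> \<sigma> = -1" "c > 0"
    "\<And>x y. c \<le> x \<Longrightarrow> x \<le> y \<Longrightarrow>
      \<sigma> * (signed_power r x + \<mu> * signed_power s x) \<le> \<sigma> * (signed_power r y + \<mu> * signed_power s y)"
proof -
  \<comment> \<open>The difference factors as
    \<open>z powr (a - 1) * (z powr (b - a) - \<nu>)\<close>. Beyond the zero of the bracket, at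
    \<open>\<nu> powr (1 / (b - a))\<close>, both factors are nonnegative and increasing.\<close>
  have key: "\<exists>c>0. \<forall>x y. c \<le> x \<longrightarrow> x \<le> y \<longrightarrow> x powr (b - 1) - \<nu> * x powr (a - 1) \<le> y powr (b - 1) - \<nu> * y powr (a - 1)"
    if ab: "a > 1" "b > a" and nu: "\<nu> > 0" for a b \<nu> :: real
  proof (intro exI[of _ "\<nu> powr (1 / (b - a))"] conjI allI impI)
    show "0 < \<nu> powr (1 / (b - a))" using nu by simp
    fix x y assume x: "\<nu> powr (1 / (b - a)) \<le> x" and xy: "x \<le> y"
    have "\<nu> powr (1 / (b - a)) > 0" using nu by simp
    with x have x0: "x > 0" by linarith
    have ge: "\<nu> \<le> z powr (b - a)" if "x \<le> z" for z
    proof -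
      have "\<nu> = (\<nu> powr (1 / (b - a))) powr (b - a)" using nu ab by (simp add: powr_powr)
      also have "\<dots> \<le> z powr (b - a)" using x that ab by (intro powr_mono2) auto
      finally show ?thesis .
    qed
    have fac: "z powr (b - 1) - \<nu> * z powr (a - 1) = z powr (a - 1) * (z powr (b - a) - \<nu>)" if "z > 0" for z
    proof -
      have "z powr (b - 1) = z powr (a - 1) * z powr (b - a)" by (simp flip: powr_add)
      then show ?thesis by (simp add: algebra_simps)
    qed
    show "x powr (b - 1) - \<nu> * x powr (a - 1) \<le> y powr (b - 1) - \<nu> * y powr (a - 1)"
      using x0 xy ab ge[of x] ge[of y] unfolding fac[OF x0] fac[OF less_le_trans[OF x0 xy]]
      by (intro mult_mono powr_mono2 diff_right_mono) auto
  qed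
  consider "\<mu> \<ge> 0" | "\<mu> < 0" "r > s" | "\<mu> < 0" "r < s" | "\<mu> < 0" "r = s" by linarith
  then show ?thesis
  proof cases
    case 1
    show ?thesis
      by (rule that[of 1 1]) (use 1 r s in \<open>auto intro!: add_mono mult_left_mono signed_power_mono\<close>)
  next
    case 2
    then obtain c where c: "c > 0" "\<And>x y. c \<le> x \<Longrightarrow> x \<le> y \<Longrightarrow> x powr (r - 1) - (- \<mu>) * x powr (s - 1) \<le> y powr (r - 1) - (- \<mu>) * y powr (s - 1)"
      using key[of s r "- \<mu>"] s by auto
    show ?thesis
      by (rule that[of 1 c]) (use c in \<open>auto simp: signed_power_nonneg\<close>)
  next
    case 3
    \<comment> \<open>The leading coefficient \<mu> is negative, so \<open>key\<close> is applied
      after factoring out \<open>- \<mu>\<close>, and the sign becomes -1.\<close>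
    then have "1 / (- \<mu>) > 0" by simp
    then obtain c where c: "c > 0" "\<And>x y. c \<le> x \<Longrightarrow> x \<le> y \<Longrightarrow> x powr (s - 1) - (1 / (- \<mu>)) * x powr (r - 1) \<le> y powr (s - 1) - (1 / (- \<mu>)) * y powr (r - 1)"
      using key[of r s "1 / (- \<mu>)"] r 3 by blast
    show ?thesis
    proof (rule that[of "-1" c])
      fix x y assume xy: "c \<le> x" "x \<le> y"
      have "(- \<mu>) * (x powr (s - 1) - (1 / (- \<mu>)) * x powr (r - 1)) \<le> (- \<mu>) * (y powr (s - 1) - (1 / (- \<mu>)) * y powr (r - 1))"
        using c(2)[OF xy] 3 by (intro mult_left_mono) auto
      then show "-1 * (signed_power r x + \<mu> * signed_power s x) \<le> -1 * (signed_power r y + \<mu> * signed_power s y)"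
        using c(1) xy 3 by (simp add: signed_power_nonneg algebra_simps)
    qed (use c in auto)
  next
    case 4
    show ?thesis
    proof (cases "1 + \<mu> \<ge> 0")
      case True
      have "signed_power r x + \<mu> * signed_power s x \<le> signed_power r y + \<mu> * signed_power s y" if "x \<le> y" for x y
        using mult_left_mono[OF signed_power_mono[OF r that] True] 4 by (simp add: algebra_simps)
      then show ?thesis by (intro that[of 1 1]) auto
    next
      case False
      then have "- (1 + \<mu>) \<ge> 0" by simp
      have "-1 * (signed_power r x + \<mu> * signed_power s x) \<le> -1 * (signed_power r y + \<mu> * signed_power s y)" if "x \<le> y" for x y
        using mult_left_mono[OF signed_power_mono[OF r that] \<open>- (1 + \<mu>) \<ge> 0\<close>] 4 by (simp add: algebra_simps)
      then show ?thesis by (intro that[of "-1" 1]) auto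
    qed
  qed
qed

text \<open>Outside of a large interval the nonlinearity is monotone, so that \<open>\<sigma> f\<close> is the sum of a
  monotone function and of the bounded function \<open>\<sigma> f \<circ> clamp\<close>; the mean value theorem turns this
  into a one-sided bound for the Taylor remainder of \<open>\<sigma> F\<close>.\<close>

lemma signed_power_sum_remainder:
  fixes r s \<mu> :: real
  assumes r: "r > 1" and s: "s > 1"
  defines "f \<equiv> \<lambda>x. signed_power r x + \<mu> * signed_power s x"
    and "F \<equiv> \<lambda>x. \<bar>x\<bar> powr r / r + \<mu> * (\<bar>x\<bar> powr s / s)"
  obtains \<sigma> k where "\<sigma> = 1 \<or> \<sigma> = -1"
    "\<And>i. k i \<in> borel_measurable borel" "\<And>i::nat. \<exists>K. \<forall>y. \<bar>k i y\<bar> \<le> K"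
    "\<And>y z. - (\<Sum>i<2. \<bar>k i z - k i y\<bar>) * \<bar>z - y\<bar> \<le> \<sigma> * (F z - F y - f y * (z - y))"
proof -
  obtain \<sigma> c where \<sigma>: "\<sigma> = 1 \<or> \<sigma> = -1" and c: "c > 0"
    and ev: "\<And>x y. c \<le> x \<Longrightarrow> x \<le> y \<Longrightarrow> \<sigma> * f x \<le> \<sigma> * f y"
    using signed_power_sum_eventually_monotone[OF r s] unfolding f_def by metis
  define cl where "cl x = max (- c) (min c x)" for x
  have cl_mono: "cl x \<le> cl y" if "x \<le> y" for x y using that by (auto simp: cl_def)
  have cl_abs: "\<bar>cl x\<bar> \<le> c" for x using c by (auto simp: cl_def)
  \<comment> \<open>One function for each power: each is monotone in one direction on its own,
    whereas their sum need not be when \<mu> < 0.\<close>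
  define k where "k i x = (if i = 0 then signed_power r (cl x) else \<mu> * signed_power s (cl x))" for i :: nat and x
  have f_minus: "f (- x) = - f x" for x by (simp add: f_def signed_power_minus)
  \<comment> \<open>The part of \<sigma> \<open>f\<close> left after removing the clamped one: zero
    on [-c, c], odd, and nondecreasing beyond \<open>c\<close> by the choice of
    \<open>c\<close>.\<close>
  define f1 where "f1 x = \<sigma> * (f x - f (cl x))" for x
  have f1_pos: "f1 x = \<sigma> * f x - \<sigma> * f c" "f1 x \<ge> 0" if "x \<ge> c" for x
    using ev[of c x] that c by (auto simp: f1_def cl_def max_def right_diff_distrib)
  have f1_mid: "f1 x = 0" if "\<bar>x\<bar> \<le> c" for x
  proof -
    have "cl x = x" using that by (auto simp: cl_def)
    then show ?thesis by (simp add: f1_def)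
  qed
  have f1_odd: "f1 (- x) = - f1 x" for x
  proof -
    have "cl (- x) = - cl x" using c by (auto simp: cl_def)
    then show ?thesis by (simp add: f1_def f_minus algebra_simps)
  qed
  have f1_mono0: "f1 x \<le> f1 y" if "0 \<le> x" "x \<le> y" for x y
  proof (cases "x \<le> c")
    case True
    then have "f1 x = 0" using that by (intro f1_mid) auto
    then show ?thesis using f1_mid[of y] f1_pos(2)[of y] that by (cases "y \<le> c") auto
  next
    case False
    then show ?thesis using ev[of x y] that by (simp add: f1_pos(1))
  qed
  have f1_nonneg: "f1 x \<ge> 0" if "0 \<le> x" for x
    using f1_mono0[OF order_refl that] f1_mid[of 0] c by simp
  have f1_mono: "f1 x \<le> f1 y" if "x \<le> y" for x y
  proof -
    consider "0 \<le> x" | "y \<le> 0" | "x \<le> 0" "0 \<le> y" by linarith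
    then show ?thesis
    proof cases
      case 1 with f1_mono0 that show ?thesis by simp
    next
      case 2 with f1_mono0[of "-y" "-x"] that show ?thesis by (simp add: f1_odd)
    next
      case 3 with f1_nonneg[of "-x"] f1_nonneg[of y] show ?thesis by (simp add: f1_odd)
    qed
  qed
  \<comment> \<open>Monotonicity replaces the unknown mean value point by the endpoint
    \<open>z\<close>, so that the error involves only the two function values.\<close>
  have k_between: "\<bar>k i \<xi> - k i y\<bar> \<le> \<bar>k i z - k i y\<bar>" if "y \<le> \<xi> \<and> \<xi> \<le> z \<or> z \<le> \<xi> \<and> \<xi> \<le> y" for i \<xi> y z
  proof -
    have mono: "signed_power m (cl a) \<le> signed_power m (cl b)" if "a \<le> b" "m > 1" for a b m
      by (intro signed_power_mono cl_mono that)
    have "\<bar>signed_power m (cl \<xi>) - signed_power m (cl y)\<bar> \<le> \<bar>signed_power m (cl z) - signed_power m (cl y)\<bar>" if "m > 1" for m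
      using \<open>y \<le> \<xi> \<and> \<xi> \<le> z \<or> z \<le> \<xi> \<and> \<xi> \<le> y\<close> mono[of y \<xi> m] mono[of \<xi> z m] mono[of z \<xi> m] mono[of \<xi> y m] that by auto
    from this[OF r] this[OF s] show ?thesis
      by (cases "i = 0") (simp_all add: k_def abs_mult mult_left_mono flip: right_diff_distrib)
  qed
  have DF: "(F has_real_derivative f x) (at x)" for x
    unfolding F_def f_def by (intro DERIV_add DERIV_cmult abs_powr_has_derivative r s)
  have mvt: "\<exists>\<xi>. (y \<le> \<xi> \<and> \<xi> \<le> z \<or> z \<le> \<xi> \<and> \<xi> \<le> y) \<and> F z - F y = f \<xi> * (z - y)" for y z
  proof -
    consider "y < z" | "y = z" | "z < y" by linarith
    then show ?thesis
    proof cases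
      case 1
      from MVT2[OF 1 DF] obtain \<xi> where "y < \<xi>" "\<xi> < z" "F z - F y = (z - y) * f \<xi>" by blast
      then show ?thesis by (intro exI[of _ \<xi>]) (auto simp: mult.commute)
    next
      case 3
      from MVT2[OF 3 DF] obtain \<xi> where "z < \<xi>" "\<xi> < y" "F y - F z = (y - z) * f \<xi>" by blast
      then show ?thesis by (intro exI[of _ \<xi>]) (auto simp: algebra_simps)
    qed auto
  qed
  have "- (\<Sum>i<2. \<bar>k i z - k i y\<bar>) * \<bar>z - y\<bar> \<le> \<sigma> * (F z - F y - f y * (z - y))" for y z
  proof -
    obtain \<xi> where \<xi>: "y \<le> \<xi> \<and> \<xi> \<le> z \<or> z \<le> \<xi> \<and> \<xi> \<le> y" "F z - F y = f \<xi> * (z - y)"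
      using mvt by blast
    have "\<sigma> * (F z - F y - f y * (z - y)) = \<sigma> * (f \<xi> - f y) * (z - y)"
      unfolding \<xi>(2) by (simp add: algebra_simps)
    also have "\<dots> = (f1 \<xi> - f1 y) * (z - y) + \<sigma> * (f (cl \<xi>) - f (cl y)) * (z - y)"
      by (simp add: f1_def algebra_simps)
    finally have eq: "\<sigma> * (F z - F y - f y * (z - y)) = (f1 \<xi> - f1 y) * (z - y) + \<sigma> * (f (cl \<xi>) - f (cl y)) * (z - y)" .
    have 1: "0 \<le> (f1 \<xi> - f1 y) * (z - y)"
      using \<xi>(1) f1_mono[of y \<xi>] f1_mono[of \<xi> y] by (auto intro: mult_nonneg_nonneg mult_nonpos_nonpos)
    have "\<bar>f (cl \<xi>) - f (cl y)\<bar> \<le> (\<Sum>i<2. \<bar>k i \<xi> - k i y\<bar>)"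
      by (simp add: f_def k_def eval_nat_numeral)
    also have "\<dots> \<le> (\<Sum>i<2. \<bar>k i z - k i y\<bar>)"
      by (intro sum_mono k_between \<xi>(1))
    finally have "\<bar>\<sigma> * (f (cl \<xi>) - f (cl y)) * (z - y)\<bar> \<le> (\<Sum>i<2. \<bar>k i z - k i y\<bar>) * \<bar>z - y\<bar>"
      using \<sigma> by (auto simp: abs_mult intro!: mult_right_mono)
    then have "- (\<Sum>i<2. \<bar>k i z - k i y\<bar>) * \<bar>z - y\<bar> \<le> \<sigma> * (f (cl \<xi>) - f (cl y)) * (z - y)"
      by linarith
    with 1 eq show ?thesis by linarith
  qed
  moreover have "k i \<in> borel_measurable borel" for i
    unfolding k_def[abs_def] cl_def by (cases "i = 0") (simp_all add: signed_power_def)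
  moreover have "\<exists>K. \<forall>y. \<bar>k i y\<bar> \<le> K" for i
  proof (intro exI allI)
    fix y
    have "\<bar>cl y\<bar> powr (m - 1) \<le> c powr (m - 1)" if "m > 1" for m
      using cl_abs[of y] that by (intro powr_mono2) auto
    from this[OF r] mult_left_mono[OF this[OF s], of "\<bar>\<mu>\<bar>"]
    show "\<bar>k i y\<bar> \<le> c powr (r - 1) + \<bar>\<mu>\<bar> * c powr (s - 1)"
      by (cases "i = 0") (auto simp: k_def abs_mult abs_signed_power intro: add_increasing add_increasing2)
  qed
  ultimately show ?thesis using \<sigma> that by blast
qed

section \<open>Integrable functions with vanishing weak gradient\<close>

text \<open>With zero gradient \<open>wgrad_FTC_AE\<close> makes
  \<open>\<bar>u x\<bar> powr m\<close> invariant under shifts along a basis vector. Its integral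
  over a ball thus equals that over translates of the ball moving to infinity, which tends to 0 by
  integrability.\<close>

lemma wgrad_zero_imp_zero:
  fixes u :: "'a::euclidean_space \<Rightarrow> real"
  assumes w: "wgrad u g" and z: "AE x in lborel. g x = 0" and u: "integrable lborel (\<lambda>x. \<bar>u x\<bar> powr m)"
  shows "AE x in lborel. u x = 0"
proof -
  note [measurable] = loc_int_measurable[OF wgrad_loc_int(1)[OF w]] loc_int_measurable[OF wgrad_loc_int(2)[OF w]]
  have w0: "wgrad u (\<lambda>x. 0)"
    unfolding wgrad_def
  proof (intro conjI ballI)
    show "loc_int u" by (rule wgrad_loc_int(1)[OF w])
    show "loc_int (\<lambda>x::'a. 0::'a)" by (simp add: loc_int_def)
    fix \<phi> :: "'a \<Rightarrow> real" and b :: 'a assume phi: "\<phi> \<in> test_functions" and b: "b \<in> Basis"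
    note [measurable] = test_functions_measurable[OF phi]
    have "(LBINT x. (g x \<bullet> b) * \<phi> x) = (LBINT x. (0 \<bullet> b) * \<phi> x)"
      using z by (intro integral_cong_AE) (measurable, auto)
    then show "(LBINT x. u x * (grad \<phi> x \<bullet> b)) = - (LBINT x. (0 \<bullet> b) * \<phi> x)"
      using wgradD[OF w phi b] by simp
  qed
  obtain b :: 'a where b: "b \<in> Basis" using nonempty_Basis by blast
  define v where "v x = \<bar>u x\<bar> powr m" for x
  have [measurable]: "v \<in> borel_measurable borel" unfolding v_def by measurable
  have v: "integrable lborel v" using u unfolding v_def .
  have inv: "AE x in lborel. v (x + t *\<^sub>R b) = v x" for t
    using wgrad_FTC_AE[OF w0 b, of t] by eventually_elim (simp add: v_def)
  have "AE x in lborel. x \<in> cball 0 (real R) \<longrightarrow> v x = 0" for R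
  proof -
    let ?I = "indicat_real (cball (0::'a) (real R))"
    have "(\<lambda>n. \<integral>x. ?I (x - real n *\<^sub>R b) * v x \<partial>lborel) \<longlonglongrightarrow> (\<integral>x. 0 \<partial>(lborel::'a measure))"
    proof (rule integral_dominated_convergence[where w = v])
      show "AE x in lborel. (\<lambda>n. ?I (x - real n *\<^sub>R b) * v x) \<longlonglongrightarrow> 0"
      proof (rule AE_I2, rule tendsto_eventually)
        fix x :: 'a
        obtain N :: nat where N: "norm x + real R < real N" using reals_Archimedean2 by blast
        show "\<forall>\<^sub>F n in sequentially. ?I (x - real n *\<^sub>R b) * v x = 0"
        proof (rule eventually_sequentiallyI[of N])
          fix n assume "N \<le> n"
          then have "norm x + real R < norm (real n *\<^sub>R b)" using N b by simp
          then have "norm (x - real n *\<^sub>R b) > real R"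
            using norm_triangle_ineq4[of x "x - real n *\<^sub>R b"] by simp
          then show "?I (x - real n *\<^sub>R b) * v x = 0" by simp
        qed
      qed
      show "AE x in lborel. norm (?I (x - real n *\<^sub>R b) * v x) \<le> v x" for n
        by (rule AE_I2) (simp add: v_def indicator_def)
    qed (use v in auto)
    moreover have "(LBINT x. ?I (x - real n *\<^sub>R b) * v x) = (LBINT x. ?I x * v x)" for n
    proof -
      have "(LBINT x. ?I x * v x) = (LBINT x. ?I x * v (x + real n *\<^sub>R b))"
        using inv[of "real n"] by (intro integral_cong_AE) (measurable, auto)
      also have "\<dots> = (LBINT x. ?I (x + real n *\<^sub>R b - real n *\<^sub>R b) * v (x + real n *\<^sub>R b))" by simp
      also have "\<dots> = (LBINT x. ?I (x - real n *\<^sub>R b) * v x)"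
        by (rule integral_lborel_shift[where f = "\<lambda>x. ?I (x - real n *\<^sub>R b) * v x"]) measurable
      finally show ?thesis by simp
    qed
    ultimately have "(LBINT x. ?I x * v x) = 0" by (simp add: LIMSEQ_const_iff)
    moreover have "integrable lborel (\<lambda>x. ?I x * v x)"
      by (rule Bochner_Integration.integrable_bound[OF v]) (auto intro!: AE_I2 simp: indicator_def)
    ultimately have "AE x in lborel. ?I x * v x = 0"
      by (subst (asm) integral_nonneg_eq_0_iff_AE) (auto simp: v_def)
    then show ?thesis by eventually_elim (auto simp: indicator_def)
  qed
  then have "AE x in lborel. \<forall>R::nat. x \<in> cball 0 (real R) \<longrightarrow> v x = 0"
    unfolding AE_all_countable ..
  then show ?thesis
  proof eventually_elim
    case (elim x)
    obtain R :: nat where "norm x \<le> R" using real_arch_simple by blast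
    with elim have "v x = 0" by auto
    then show ?case by (simp add: v_def)
  qed
qed

section \<open>Nonexistence\<close>

lemma L_space_representative:
  assumes f: "f \<in> L_space m" and [measurable]: "f0 \<in> borel_measurable borel" and ae: "AE x in lebesgue. f x = f0 x"
  shows "integrable lborel (\<lambda>x. norm (f0 x) powr m)"
proof -
  have "integrable lebesgue (\<lambda>x. norm (f x) powr m)" using f by (simp add: L_space_def)
  then have "integrable lebesgue (\<lambda>x. norm (f0 x) powr m)"
  proof (rule integrable_cong_AE_imp)
    show "(\<lambda>x. norm (f0 x) powr m) \<in> borel_measurable lebesgue"
      by (rule measurable_completion) measurable
    show "AE x in lebesgue. norm (f x) powr m = norm (f0 x) powr m"
      using ae by eventually_elim simp
  qed
  then show ?thesis by (subst (asm) integrable_completion) measurable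
qed

lemma L_loc_representative:
  fixes f :: "'a::euclidean_space \<Rightarrow> real"
  assumes f: "f \<in> L_loc m" and [measurable]: "f0 \<in> borel_measurable borel" and ae: "AE x in lebesgue. f x = f0 x"
  shows "Lp_loc m f0"
  unfolding Lp_loc_def
proof (intro conjI allI)
  fix R
  have "(\<lambda>x. norm (f x) powr m) absolutely_integrable_on cball 0 R"
    using f by (auto simp: L_loc_def)
  then have "integrable lebesgue (\<lambda>x. cut R x * \<bar>f x\<bar> powr m)"
    by (simp add: set_integrable_def)
  then have "integrable lebesgue (\<lambda>x. cut R x * \<bar>f0 x\<bar> powr m)"
  proof (rule integrable_cong_AE_imp)
    show "(\<lambda>x. cut R x * \<bar>f0 x\<bar> powr m) \<in> borel_measurable lebesgue"
      by (rule measurable_completion) measurable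
    show "AE x in lebesgue. cut R x * \<bar>f x\<bar> powr m = cut R x * \<bar>f0 x\<bar> powr m"
      using ae by eventually_elim simp
  qed
  then show "integrable lborel (\<lambda>x. cut R x * \<bar>f0 x\<bar> powr m)"
    by (subst (asm) integrable_completion) measurable
qed fact

lemma weak_gradient_representative:
  assumes u: "weakly_differentiable u" and u0: "u0 \<in> borel_measurable borel" "AE x in lebesgue. u x = u0 x"
  obtains g0 where "g0 \<in> borel_measurable borel" "AE x in lebesgue. weak_gradient u x = g0 x" "wgrad u0 g0"
proof -
  have w: "u has_weak_gradient weak_gradient u"
    using u someI_ex[of "\<lambda>g. u has_weak_gradient g"]
    unfolding weakly_differentiable_def weak_gradient_def by blast
  then have "weak_gradient u \<in> borel_measurable lebesgue"
    by (simp add: has_weak_gradient_def L1_loc_measurable)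
  then obtain g0 where g0: "g0 \<in> borel_measurable borel" "AE x in lebesgue. weak_gradient u x = g0 x"
    using ex_borel_representative by blast
  from that[OF g0 has_weak_gradient_wgrad[OF w u0(1) g0(1) u0(2) g0(2)]] show ?thesis .
qed

text \<open>For \<mu> < 0 the two powers may cancel in the given sum. If s \<le> P \<le> r, the
  power \<open>r\<close> is dominated by \<open>P\<close> where \<bar>v\<bar> \<le> 1; where
  \<bar>v\<bar> > 1 the power \<open>s\<close> is, and \<open>r\<close> is recovered from the sum.
  The case of \<open>Q\<close> is the same with \<open>r\<close> and \<open>s\<close> exchanged, and
  one integrable term yields the other.\<close>

lemma powr_terms_integrable:
  fixes v :: "'a::euclidean_space \<Rightarrow> real"
  assumes [measurable]: "v \<in> borel_measurable borel"
    and w: "integrable lborel (\<lambda>x. \<bar>v x\<bar> powr r + \<mu> * \<bar>v x\<bar> powr s)"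
    and P: "integrable lborel (\<lambda>x. \<bar>v x\<bar> powr P)" and Q: "integrable lborel (\<lambda>x. \<bar>v x\<bar> powr Q)"
    and pos: "r > 0" "s > 0" "P > 0" "Q > 0"
    and cases: "\<mu> > 0 \<or> \<mu> < 0 \<and> (s \<le> P \<and> P \<le> r \<or> r \<le> Q \<and> Q \<le> s)"
  shows "integrable lborel (\<lambda>x. \<bar>v x\<bar> powr r)" "integrable lborel (\<lambda>x. \<bar>v x\<bar> powr s)"
proof -
  let ?w = "\<lambda>x. \<bar>v x\<bar> powr r + \<mu> * \<bar>v x\<bar> powr s"
  have mu: "\<mu> \<noteq> 0" using cases by auto
  have dom: "integrable lborel h"
    if "integrable lborel k" "h \<in> borel_measurable borel" "\<And>x. \<bar>h x\<bar> \<le> k x" for h k :: "'a \<Rightarrow> real"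
    by (rule Bochner_Integration.integrable_bound[OF that(1)])
      (use that(2) order_trans[OF that(3) abs_ge_self] in \<open>auto intro!: AE_I2\<close>)
  have small: "y powr a \<le> y powr b" if "0 \<le> y" "y \<le> 1" "0 < b" "b \<le> a" for y a b :: real
    using that powr_mono'[of b a y] by (cases "y = 0") auto
  have large: "y powr a \<le> y powr b" if "1 \<le> y" "a \<le> b" for y a b :: real
    using that by (intro powr_mono) auto
  have one: "integrable lborel (\<lambda>x. \<bar>v x\<bar> powr r) \<or> integrable lborel (\<lambda>x. \<bar>v x\<bar> powr s)"
    using cases
  proof (elim disjE conjE)
    assume "\<mu> > 0"
    then have "\<bar>\<bar>v x\<bar> powr r\<bar> \<le> ?w x" for x by simp
    then show ?thesis using dom[OF w, of "\<lambda>x. \<bar>v x\<bar> powr r"] by simp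
  next
    assume m: "\<mu> < 0" and sP: "s \<le> P" "P \<le> r"
    have "\<bar>\<bar>v x\<bar> powr r\<bar> \<le> \<bar>?w x\<bar> + (1 + \<bar>\<mu>\<bar>) * \<bar>v x\<bar> powr P" for x
    proof (cases "\<bar>v x\<bar> \<le> 1")
      case True
      have "\<bar>v x\<bar> powr r \<le> \<bar>v x\<bar> powr P" using True sP pos by (intro small) auto
      moreover have "\<bar>\<mu>\<bar> * \<bar>v x\<bar> powr P \<ge> 0" "\<bar>\<bar>v x\<bar> powr r\<bar> = \<bar>v x\<bar> powr r" by auto
      ultimately show ?thesis unfolding distrib_right by linarith
    next
      case False
      have "\<bar>\<mu>\<bar> * \<bar>v x\<bar> powr s \<le> \<bar>\<mu>\<bar> * \<bar>v x\<bar> powr P" using False sP by (intro mult_left_mono large) auto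
      moreover have "\<bar>v x\<bar> powr r = ?w x + \<bar>\<mu>\<bar> * \<bar>v x\<bar> powr s" using m by simp
      moreover have "\<bar>v x\<bar> powr P \<ge> 0" "\<bar>\<bar>v x\<bar> powr r\<bar> = \<bar>v x\<bar> powr r" by auto
      ultimately show ?thesis unfolding distrib_right by linarith
    qed
    then show ?thesis
      using dom[OF Bochner_Integration.integrable_add[OF integrable_abs[OF w] integrable_mult_right[OF P, of "1 + \<bar>\<mu>\<bar>"]],
          of "\<lambda>x. \<bar>v x\<bar> powr r"] by simp
  next
    assume m: "\<mu> < 0" and sQ: "r \<le> Q" "Q \<le> s"
    have "\<bar>\<bar>\<mu>\<bar> * \<bar>v x\<bar> powr s\<bar> \<le> \<bar>?w x\<bar> + (1 + \<bar>\<mu>\<bar>) * \<bar>v x\<bar> powr Q" for x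
    proof (cases "\<bar>v x\<bar> \<le> 1")
      case True
      have "\<bar>\<mu>\<bar> * \<bar>v x\<bar> powr s \<le> \<bar>\<mu>\<bar> * \<bar>v x\<bar> powr Q" using True sQ pos by (intro mult_left_mono small) auto
      moreover have "\<bar>v x\<bar> powr Q \<ge> 0" "\<bar>\<bar>\<mu>\<bar> * \<bar>v x\<bar> powr s\<bar> = \<bar>\<mu>\<bar> * \<bar>v x\<bar> powr s" by auto
      ultimately show ?thesis unfolding distrib_right by linarith
    next
      case False
      have "\<bar>v x\<bar> powr r \<le> \<bar>v x\<bar> powr Q" using False sQ by (intro large) auto
      moreover have "\<bar>\<mu>\<bar> * \<bar>v x\<bar> powr s = \<bar>v x\<bar> powr r - ?w x" using m by simp
      moreover have "\<bar>\<mu>\<bar> * \<bar>v x\<bar> powr Q \<ge> 0" "\<bar>\<bar>\<mu>\<bar> * \<bar>v x\<bar> powr s\<bar> = \<bar>\<mu>\<bar> * \<bar>v x\<bar> powr s" by auto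
      ultimately show ?thesis unfolding distrib_right by linarith
    qed
    then have "integrable lborel (\<lambda>x. \<bar>\<mu>\<bar> * \<bar>v x\<bar> powr s)"
      by (intro dom[OF Bochner_Integration.integrable_add[OF integrable_abs[OF w] integrable_mult_right[OF Q, of "1 + \<bar>\<mu>\<bar>"]]]) auto
    then show ?thesis using mu by simp
  qed
  have "integrable lborel (\<lambda>x. \<bar>v x\<bar> powr r) \<longleftrightarrow> integrable lborel (\<lambda>x. \<mu> * \<bar>v x\<bar> powr s)"
    using Bochner_Integration.integrable_diff[OF w, of "\<lambda>x. \<bar>v x\<bar> powr r"]
      Bochner_Integration.integrable_diff[OF w, of "\<lambda>x. \<mu> * \<bar>v x\<bar> powr s"] by auto
  with one mu show "integrable lborel (\<lambda>x. \<bar>v x\<bar> powr r)" "integrable lborel (\<lambda>x. \<bar>v x\<bar> powr s)" by auto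
qed

text \<open>Translates the weak formulation to Borel representatives over \<open>lborel\<close>,
  with the gradient of the test function supplied explicitly; this is the form of the assumption
  \<open>weak\<close> in the locale.\<close>

lemma weak_solution_representative:
  fixes u :: "'a::euclidean_space \<Rightarrow> real"
  assumes sol: "weak_solution p q r s \<mu> u"
    and [measurable]: "u0 \<in> borel_measurable borel" "g0 \<in> borel_measurable borel"
    and ae: "AE x in lebesgue. u x = u0 x" "AE x in lebesgue. weak_gradient u x = g0 x"
    and w: "wgrad \<phi> h"
    and int: "integrable lborel (\<lambda>x. \<bar>\<phi> x\<bar> powr critical_exponent DIM('a) p)"
      "integrable lborel (\<lambda>x. \<bar>\<phi> x\<bar> powr critical_exponent DIM('a) q)"
      "integrable lborel (\<lambda>x. norm (h x) powr p)" "integrable lborel (\<lambda>x. norm (h x) powr q)"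
  shows "integrable lborel (\<lambda>x. (power_field p (g0 x) + power_field q (g0 x)) \<bullet> h x)"
    and "integrable lborel (\<lambda>x. (signed_power r (u0 x) + \<mu> * signed_power s (u0 x)) * \<phi> x)"
    and "(LBINT x. (power_field p (g0 x) + power_field q (g0 x)) \<bullet> h x)
       = (LBINT x. (signed_power r (u0 x) + \<mu> * signed_power s (u0 x)) * \<phi> x)"
proof -
  note [measurable] = loc_int_measurable[OF wgrad_loc_int(1)[OF w]] loc_int_measurable[OF wgrad_loc_int(2)[OF w]]
  let ?lhs = "\<lambda>x. (norm (weak_gradient u x) powr (p - 2) *\<^sub>R weak_gradient u x
      + norm (weak_gradient u x) powr (q - 2) *\<^sub>R weak_gradient u x) \<bullet> weak_gradient \<phi> x"
  let ?rhs = "\<lambda>x. (\<bar>u x\<bar> powr (r - 2) * u x + \<mu> * (\<bar>u x\<bar> powr (s - 2) * u x)) * \<phi> x"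
  let ?l = "\<lambda>x. (power_field p (g0 x) + power_field q (g0 x)) \<bullet> h x"
  let ?r = "\<lambda>x. (signed_power r (u0 x) + \<mu> * signed_power s (u0 x)) * \<phi> x"
  have "\<phi> \<in> E_space p q"
    unfolding E_space_def using D1_intro[OF w int(1,3)] D1_intro[OF w int(2,4)] by simp
  then have eq: "integrable lebesgue ?lhs" "integrable lebesgue ?rhs" "integral\<^sup>L lebesgue ?lhs = integral\<^sup>L lebesgue ?rhs"
    using sol by (auto simp: weak_solution_def Let_def)
  have ael: "AE x in lebesgue. ?lhs x = ?l x"
    using ae(2) weak_gradient_AE_wgrad(1)[OF w] by eventually_elim (simp add: power_field_def)
  have aer: "AE x in lebesgue. ?rhs x = ?r x"
    using ae(1) by eventually_elim (simp add: signed_power_def)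
  have ml: "?l \<in> borel_measurable lebesgue" by (rule measurable_completion) measurable
  have mr: "?r \<in> borel_measurable lebesgue" by (rule measurable_completion) measurable
  have il: "integrable lebesgue ?l" by (rule integrable_cong_AE_imp[OF eq(1) ml ael])
  have ir: "integrable lebesgue ?r" by (rule integrable_cong_AE_imp[OF eq(2) mr aer])
  show "integrable lborel ?l" using il by (subst (asm) integrable_completion) measurable
  show "integrable lborel ?r" using ir by (subst (asm) integrable_completion) measurable
  have "integral\<^sup>L lebesgue ?l = integral\<^sup>L lebesgue ?r"
    using integral_cong_AE[OF borel_measurable_integrable[OF eq(1)] ml ael]
      integral_cong_AE[OF borel_measurable_integrable[OF eq(2)] mr aer] eq(3) by simp
  then show "integral\<^sup>L lborel ?l = integral\<^sup>L lborel ?r"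
    by (simp add: integral_completion)
qed

lemma critical_exponent_less:
  assumes "0 < q" "q < p" "p < real N"
  shows "0 < critical_exponent N q" "critical_exponent N q < critical_exponent N p"
  using assms by (auto simp: critical_exponent_def field_simps)

text \<open>Both identities are linear in the four integrals. Combined with the exponent conditions
  they give \<open>Ip / P + Iq / Q \<le> (Ip + Iq) / P\<close> or
  \<open>(Ip + Iq) / Q \<le> Ip / P + Iq / Q\<close>. As Q < P strictly, the first forces
  \<open>Iq = 0\<close> and the second \<open>Ip = 0\<close>; either makes the gradient
  vanish.\<close>

theorem weak_solution_trivial:
  fixes u :: "'a::euclidean_space \<Rightarrow> real" and p q r s \<mu> :: real
  defines "P \<equiv> critical_exponent DIM('a) p" and "Q \<equiv> critical_exponent DIM('a) q"
  assumes q1: "1 < q" and qp: "q < p" and pN: "p < real DIM('a)" and r1: "1 < r" and s1: "1 < s"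
    and exps: "(\<mu> > 0 \<and> (P \<le> min r s \<or> max r s \<le> Q)) \<or> (\<mu> < 0 \<and> ((s \<le> P \<and> P \<le> r) \<or> (r \<le> Q \<and> Q \<le> s)))"
    and u: "u \<in> E_space p q" "u \<in> W_loc 2 p" and sol: "weak_solution p q r s \<mu> u"
  shows "AE x in lebesgue. u x = 0"
proof -
  have QP: "0 < Q" "Q < P"
    unfolding P_def Q_def using critical_exponent_less[of q p] q1 qp pN by auto
  have Ep: "u \<in> L_space P" "weakly_differentiable u" "weak_gradient u \<in> L_space p"
    and Eq: "u \<in> L_space Q" "weak_gradient u \<in> L_space q"
    using u(1) by (auto simp: E_space_def D1_def P_def Q_def)
  have W: "u \<in> L_loc p" "\<And>c. c \<in> Basis \<Longrightarrow> weakly_differentiable (\<lambda>x. weak_gradient u x \<bullet> c)"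
    "\<And>b c. b \<in> Basis \<Longrightarrow> c \<in> Basis \<Longrightarrow> (\<lambda>x. weak_gradient (\<lambda>x. weak_gradient u x \<bullet> c) x \<bullet> b) \<in> L_loc p"
    using u(2) by (simp_all add: numeral_2_eq_2)
  obtain u0 where u0 [measurable]: "u0 \<in> borel_measurable borel" and ae0: "AE x in lebesgue. u x = u0 x"
    using ex_borel_representative[of u] Ep(1) by (auto simp: L_space_def)
  obtain g0 where g0 [measurable]: "g0 \<in> borel_measurable borel" and aeg: "AE x in lebesgue. weak_gradient u x = g0 x"
    and wu: "wgrad u0 g0"
    using weak_gradient_representative[OF Ep(2) u0 ae0] .
  have "\<exists>Hc. (AE x in lebesgue. weak_gradient (\<lambda>x. weak_gradient u x \<bullet> c) x = Hc x)
      \<and> Hc \<in> borel_measurable borel \<and> wgrad (\<lambda>x. g0 x \<bullet> c) Hc" if c: "c \<in> Basis" for c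
  proof -
    have "AE x in lebesgue. weak_gradient u x \<bullet> c = g0 x \<bullet> c" using aeg by eventually_elim simp
    moreover have "(\<lambda>x. g0 x \<bullet> c) \<in> borel_measurable borel" by measurable
    ultimately show ?thesis using weak_gradient_representative[OF W(2)[OF c]] by metis
  qed
  then obtain H where H: "\<And>c. c \<in> Basis \<Longrightarrow> AE x in lebesgue. weak_gradient (\<lambda>x. weak_gradient u x \<bullet> c) x = H c x"
    "\<And>c. c \<in> Basis \<Longrightarrow> H c \<in> borel_measurable borel" "\<And>c. c \<in> Basis \<Longrightarrow> wgrad (\<lambda>x. g0 x \<bullet> c) (H c)"
    by metis
  have H_loc: "Lp_loc p (\<lambda>x. H c x \<bullet> b)" if "b \<in> Basis" "c \<in> Basis" for b c
  proof (rule L_loc_representative[OF W(3)[OF that]])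
    show "(\<lambda>x. H c x \<bullet> b) \<in> borel_measurable borel" using H(2)[OF that(2)] by measurable
    show "AE x in lebesgue. weak_gradient (\<lambda>x. weak_gradient u x \<bullet> c) x \<bullet> b = H c x \<bullet> b"
      using H(1)[OF that(2)] by eventually_elim simp
  qed
  note gp = L_space_representative[OF Ep(3) g0 aeg] and gq = L_space_representative[OF Eq(2) g0 aeg]
  have uP: "integrable lborel (\<lambda>x. \<bar>u0 x\<bar> powr P)" and uQ: "integrable lborel (\<lambda>x. \<bar>u0 x\<bar> powr Q)"
    using L_space_representative[OF Ep(1) u0 ae0] L_space_representative[OF Eq(1) u0 ae0] by auto
  note u_loc = L_loc_representative[OF W(1) u0 ae0]
  note weak = weak_solution_representative[OF sol u0 g0 ae0 aeg, folded P_def Q_def]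
  define f where "f x = signed_power r x + \<mu> * signed_power s x" for x
  define F where "F x = \<bar>x\<bar> powr r / r + \<mu> * (\<bar>x\<bar> powr s / s)" for x
  \<comment> \<open>The test function is the solution itself, which belongs to the space of test
    functions.\<close>
  note nehari = weak[OF wu uP uQ gp gq]
  have fu: "(signed_power r y + \<mu> * signed_power s y) * y = \<bar>y\<bar> powr r + \<mu> * \<bar>y\<bar> powr s" for y
    using signed_power_mult_self[of r y] signed_power_mult_self[of s y] by (simp add: distrib_right mult.assoc)
  have ur: "integrable lborel (\<lambda>x. \<bar>u0 x\<bar> powr r)" and us: "integrable lborel (\<lambda>x. \<bar>u0 x\<bar> powr s)"
    by (rule powr_terms_integrable[OF u0 nehari(2)[unfolded fu] uP uQ]; use exps QP r1 s1 in auto)+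
  define Ip where "Ip = (LBINT x. norm (g0 x) powr p)"
  define Iq where "Iq = (LBINT x. norm (g0 x) powr q)"
  define Ir where "Ir = (LBINT x. \<bar>u0 x\<bar> powr r)"
  define Is where "Is = (LBINT x. \<bar>u0 x\<bar> powr s)"
  have nonneg: "Ip \<ge> 0" "Iq \<ge> 0" "Ir \<ge> 0" "Is \<ge> 0"
    unfolding Ip_def Iq_def Ir_def Is_def by (auto intro!: Bochner_Integration.integral_nonneg)
  have F_int: "integrable lborel (\<lambda>x. F (u0 x))"
    unfolding F_def by (intro Bochner_Integration.integrable_add integrable_mult_right integrable_divide ur us)
  obtain \<sigma> k where sk: "\<sigma> = 1 \<or> \<sigma> = -1" "\<And>i. k i \<in> borel_measurable borel" "\<And>i::nat. \<exists>K. \<forall>y. \<bar>k i y\<bar> \<le> K"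
    "\<And>y z. - (\<Sum>i<2. \<bar>k i z - k i y\<bar>) * \<bar>z - y\<bar> \<le> \<sigma> * (F z - F y - f y * (z - y))"
    using that unfolding F_def f_def by (rule signed_power_sum_remainder[OF r1 s1, of \<mu>])
  interpret quasilinear_solution u0 g0 H p q P Q f F \<sigma> k 2
    by (rule quasilinear_solution.intro)
      (use q1 qp QP wu H(3) H_loc u_loc gp gq uP uQ F_int sk weak in \<open>simp_all add: f_def\<close>)
  have Fint: "(LBINT x. F (u0 x)) = Ir / r + \<mu> * (Is / s)"
    unfolding F_def Ir_def Is_def using ur us by simp
  have "Ip + Iq = (LBINT x. (power_field p (g0 x) + power_field q (g0 x)) \<bullet> g0 x)"
    unfolding Ip_def Iq_def inner_add_left power_field_self
    by (rule Bochner_Integration.integral_add[OF gp gq, symmetric])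
  also have "\<dots> = Ir + \<mu> * Is"
    unfolding nehari(3) fu Ir_def Is_def using ur us by simp
  finally have Nehari: "Ip + Iq = Ir + \<mu> * Is" .
  have N: "real DIM('a) > 0" by simp
  \<comment> \<open>By definition of the critical exponent, N / P = (N - p) / p with N the
    dimension, and likewise for \<open>q\<close>.\<close>
  have "1 - real DIM('a) / p = - real DIM('a) / P" "1 - real DIM('a) / q = - real DIM('a) / Q"
    using q1 qp pN by (auto simp: P_def Q_def critical_exponent_def field_simps)
  with global_identity have "real DIM('a) * (Ir / r + \<mu> * (Is / s) - Ip / P - Iq / Q) = 0"
    unfolding Fint Ip_def[symmetric] Iq_def[symmetric] by (simp add: algebra_simps)
  then have Pohozaev: "Ir / r + \<mu> * (Is / s) = Ip / P + Iq / Q" using N by simp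
  have inv: "1 / P < 1 / Q" using QP by (simp add: frac_less2)
  have div: "x / a \<le> x / b" if "b \<le> a" "0 < b" "0 \<le> x" for x a b :: real
    using that by (intro divide_left_mono) auto
  have "Iq = 0 \<or> Ip = 0"
  proof -
    \<comment> \<open>Replacing both \<open>r\<close> and \<open>s\<close> by \<open>P\<close>, or
      both by \<open>Q\<close>, must change the two terms in the same direction. For \<mu> > 0 this
      needs \<open>r\<close> and \<open>s\<close> on the same side of the critical exponent, for
      \<mu> < 0 on opposite sides.\<close>
    consider (P) "Ir / r + \<mu> * (Is / s) \<le> Ir / P + \<mu> * (Is / P)"
      | (Q) "Ir / Q + \<mu> * (Is / Q) \<le> Ir / r + \<mu> * (Is / s)"
      using exps
    proof (elim disjE conjE)
      assume "\<mu> > 0" "P \<le> min r s"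
      then show thesis using QP nonneg by (intro that(1) add_mono mult_left_mono div) auto
    next
      assume "\<mu> > 0" "max r s \<le> Q"
      then show thesis using r1 s1 nonneg by (intro that(2) add_mono mult_left_mono div) auto
    next
      assume "\<mu> < 0" "s \<le> P" "P \<le> r"
      then show thesis using s1 QP nonneg by (intro that(1) add_mono mult_left_mono_neg div) auto
    next
      assume "\<mu> < 0" "r \<le> Q" "Q \<le> s"
      then show thesis using r1 QP nonneg by (intro that(2) add_mono mult_left_mono_neg div) auto
    qed
    then show ?thesis
    proof cases
      case P
      also have "Ir / P + \<mu> * (Is / P) = (Ip + Iq) / P" by (simp add: Nehari add_divide_distrib)
      finally have "Iq * (1 / Q - 1 / P) \<le> 0"
        unfolding Pohozaev by (simp add: right_diff_distrib add_divide_distrib)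
      with inv nonneg(2) show ?thesis by (simp add: mult_le_0_iff)
    next
      case Q
      moreover have "Ir / Q + \<mu> * (Is / Q) = (Ip + Iq) / Q" by (simp add: Nehari add_divide_distrib)
      ultimately have "Ip * (1 / Q - 1 / P) \<le> 0"
        unfolding Pohozaev by (simp add: right_diff_distrib add_divide_distrib)
      with inv nonneg(1) show ?thesis by (simp add: mult_le_0_iff)
    qed
  qed
  then have "AE x in lborel. g0 x = 0"
  proof
    assume "Iq = 0"
    then have "AE x in lborel. norm (g0 x) powr q = 0"
      unfolding Iq_def by (subst (asm) integral_nonneg_eq_0_iff_AE[OF gq]) auto
    then show ?thesis by eventually_elim simp
  next
    assume "Ip = 0"
    then have "AE x in lborel. norm (g0 x) powr p = 0"
      unfolding Ip_def by (subst (asm) integral_nonneg_eq_0_iff_AE[OF gp]) auto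
    then show ?thesis by eventually_elim simp
  qed
  from AE_completion[OF wgrad_zero_imp_zero[OF wu this uP]] ae0
  show ?thesis by eventually_elim simp
qed

theorem theorem1p4:
  fixes p q r s \<mu> :: real
  assumes "CARD('n::finite) \<ge> 2"
    and "1 < q" and "q < p" and "p < real CARD('n)"
    and "1 < r" and "1 < s"
    and "(\<mu> > 0 \<and> (critical_exponent CARD('n) p \<le> min r s
                  \<or> max r s \<le> critical_exponent CARD('n) q))
       \<or> (\<mu> < 0 \<and> ((s \<le> critical_exponent CARD('n) p \<and> critical_exponent CARD('n) p \<le> r)
                  \<or> (r \<le> critical_exponent CARD('n) q \<and> critical_exponent CARD('n) q \<le> s)))"
  shows "\<not> (\<exists>u :: real ^ 'n \<Rightarrow> real.
            u \<in> E_space p q \<inter> W_loc 2 p \<and> weak_solution p q r s \<mu> u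
            \<and> \<not> (AE x in lebesgue. u x = 0))"
  using weak_solution_trivial[where 'a = "real ^ 'n", OF assms(2,3) _ assms(5,6)] assms(4,7) by auto

end
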